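(* For all integers $k\ge1$ and $n\ge0$, $$e_6(11^{2k}n+\delta_{11,2k})\equiv0\pmod{11^{2k}}.$$
   Context: $q=e^{2\pi i\tau}$, $(q;q)_\infty=\prod_{n\ge1}(1-q^n)$, $E_6(\tau)=1-504\sum_{n\ge1}\sigma_5(n)q^n$ with $\sigma_5(n)=\sum_{d\mid n}d^5$. The numbers $e_6(n)$ are defined by $\sum_{n\ge0}e_6(n)q^n=E_6(\tau)/(q;q)_\infty$. For a prime $\ell\ge5$ and $k\ge1$, $\delta_{\ell,k}$ is the integer with $0<\delta_{\ell,k}<\ell^k$ and $24\delta_{\ell,k}\equiv1\pmod{\ell^k}$. *)

theory Defs
  imports
    "HOL-Analysis.Analysis"
    "HOL-Computational_Algebra.Formal_Power_Series"
    "HOL-Number_Theory.Cong"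
begin

text \<open>
  All \<open>q\<close>-expansions are formal power series over the integers; \<^term>\<open>fps_X\<close> plays the role of
  \<open>q\<close>.
\<close>

definition sigma5 :: "nat \<Rightarrow> nat" where
  "sigma5 n = (\<Sum>d | d dvd n. d ^ 5)"

definition E6 :: "int fps" where
  "E6 = Abs_fps (\<lambda>n. if n = 0 then 1 else - 504 * int (sigma5 n))"

text \<open>The infinite product converges in the topology of coefficientwise stabilisation that the
  library puts on formal power series; see \<open>euler_product_has_prod\<close> below.\<close>

definition euler_product :: "int fps" where
  "euler_product = (\<Prod>n. 1 - fps_X ^ Suc n)"

text \<open>The library's division of formal power series needs inverses of coefficients, which the
  integers lack. The constant term of the product is \<open>1\<close>, so it has a multiplicative inverse over
  the integers; the second argument \<open>1\<close> of \<^term>\<open>fps_right_inverse\<close> is the inverse of that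
  constant term.\<close>

definition e6 :: "nat \<Rightarrow> int" where
  "e6 n = fps_nth (E6 * fps_right_inverse euler_product 1) n"

text \<open>Well-defined for \<open>l\<close> coprime to \<open>24\<close> with \<open>l > 1\<close> and \<open>k \<ge> 1\<close>; see
  \<open>ex1_delta\<close> below.\<close>

definition delta :: "nat \<Rightarrow> nat \<Rightarrow> nat" where
  "delta l k = (THE d. 0 < d \<and> d < l ^ k \<and> [24 * d = 1] (mod l ^ k))"

lemma euler_partial_nth_stable:
  assumes "n \<le> N"
  shows "fps_nth (\<Prod>i\<le>N. 1 - fps_X ^ Suc i :: int fps) n =
         fps_nth (\<Prod>i\<le>n. 1 - fps_X ^ Suc i :: int fps) n"
  using assms
proof (induction N rule: dec_induct)
  case (step N)
  have "(\<Prod>i\<le>Suc N. 1 - fps_X ^ Suc i :: int fps) =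
      (\<Prod>i\<le>N. 1 - fps_X ^ Suc i) - (\<Prod>i\<le>N. 1 - fps_X ^ Suc i) * fps_X ^ Suc (Suc N)"
    by (simp only: prod.atMost_Suc right_diff_distrib mult_1_right)
  then show ?case
    using step by (simp only: fps_sub_nth fps_X_power_mult_right_nth) simp
qed simp

lemma euler_product_has_prod:
  "(\<lambda>n. 1 - fps_X ^ Suc n :: int fps) has_prod euler_product"
proof -
  define g :: "int fps" where
    "g = Abs_fps (\<lambda>n. fps_nth (\<Prod>i\<le>n. 1 - fps_X ^ Suc i) n)"
  have "(\<lambda>N. \<Prod>i\<le>N. 1 - fps_X ^ Suc i :: int fps) \<longlonglongrightarrow> g"
    unfolding tendsto_fps_iff g_def fps_nth_Abs_fps
    by (intro allI eventually_sequentiallyI) (rule euler_partial_nth_stable)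
  moreover have "fps_nth g 0 = 1"
    by (simp add: g_def)
  then have "g \<noteq> 0"
    by auto
  ultimately have "(\<lambda>n. 1 - fps_X ^ Suc n :: int fps) has_prod g"
    by (simp only: has_prod_def raw_has_prod_def add_0_right) simp
  then show ?thesis
    unfolding euler_product_def using has_prod_unique by metis
qed

lemma euler_product_nth:
  "fps_nth euler_product n = fps_nth (\<Prod>i\<le>n. 1 - fps_X ^ Suc i) n"
proof -
  have "euler_product \<noteq> 0"
  proof
    assume "euler_product = 0"
    then obtain i where "1 - fps_X ^ Suc i = (0 :: int fps)"
      using euler_product_has_prod by (auto simp: has_prod_0_iff)
    then have "fps_nth (1 - fps_X ^ Suc i :: int fps) 0 = 0"
      by simp
    then show False
      by simp
  qed
  then have "(\<lambda>N. \<Prod>i\<le>N. 1 - fps_X ^ Suc i :: int fps) \<longlonglongrightarrow> euler_product"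
    using euler_product_has_prod by (simp add: has_prod_def raw_has_prod_def)
  then have "eventually (\<lambda>N. fps_nth (\<Prod>i\<le>N. 1 - fps_X ^ Suc i :: int fps) n =
      fps_nth euler_product n) sequentially"
    unfolding tendsto_fps_iff by blast
  then obtain N where "n \<le> N"
    "fps_nth (\<Prod>i\<le>N. 1 - fps_X ^ Suc i :: int fps) n = fps_nth euler_product n"
    unfolding eventually_sequentially by (meson nat_le_linear order_refl)
  then show ?thesis
    using euler_partial_nth_stable by metis
qed

lemma e6_generating_function: "Abs_fps e6 * euler_product = E6"
proof -
  have "euler_product * fps_right_inverse euler_product 1 = 1"
    by (rule fps_right_inverse) (simp add: euler_product_nth)
  moreover have "Abs_fps e6 = E6 * fps_right_inverse euler_product 1"
    by (rule fps_ext) (simp add: e6_def)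
  ultimately show ?thesis
    by (metis mult.assoc mult.commute mult_1_right)
qed

lemma ex1_delta:
  assumes "coprime 24 l" "l > 1" "k \<ge> 1"
  shows "\<exists>!d::nat. 0 < d \<and> d < l ^ k \<and> [24 * d = 1] (mod l ^ k)"
proof -
  have l: "l ^ k > 1"
    using assms by (intro one_less_power) simp_all
  have c: "coprime 24 (l ^ k)"
    using assms by simp
  obtain x where x: "[24 * x = 1] (mod l ^ k)"
    using cong_solve_coprime_nat[OF c] by auto
  have y: "[24 * (x mod l ^ k) = 1] (mod l ^ k)"
    using x by (simp add: cong_def mod_mult_right_eq)
  have "x mod l ^ k \<noteq> 0"
  proof
    assume "x mod l ^ k = 0"
    then have "1 mod l ^ k = 0"
      using y by (simp only: cong_def mult_0_right mod_0)
    then show False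
      using l by (simp only: mod_less)
  qed
  moreover have "x mod l ^ k < l ^ k"
    using l by (intro mod_less_divisor) linarith
  ultimately have "0 < x mod l ^ k \<and> x mod l ^ k < l ^ k \<and> [24 * (x mod l ^ k) = 1] (mod l ^ k)"
    using y by (intro conjI) (simp_all only: neq0_conv)
  moreover have "d = d'"
    if "d < l ^ k" "[24 * d = 1] (mod l ^ k)" "d' < l ^ k" "[24 * d' = 1] (mod l ^ k)" for d d'
  proof -
    have "[24 * d = 24 * d'] (mod l ^ k)"
      using that cong_trans cong_sym by blast
    then have "[d = d'] (mod l ^ k)"
      using c cong_mult_lcancel_nat by blast
    then show ?thesis
      using that by (simp add: cong_def)
  qed
  ultimately show ?thesis
    by blast
qed

end

theory Submission
  imports Defs "HOL-Complex_Analysis.Complex_Analysis" "HOL-Real_Asymp.Real_Asymp"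
begin

text \<open>
  \<open>E\<^sub>6 / \<eta>\<close> is a weakly holomorphic form of weight \<open>11/2\<close> on the full modular group, and its
  coefficient at \<open>q\<^bsup>n - 1/24\<^esup>\<close> is \<open>e\<^sub>6(n)\<close>. There is no nonzero form with the same multiplier
  system and without principal part: the absolute value of \<open>D\<^sup>2 / \<eta>\<^bsup>22\<^esup>\<close> would be invariant and tend
  to \<open>0\<close> at the cusp, against the maximum principle. Hence such a form is determined by its principal part, and since
  \<open>E\<^sub>6\<^bsup>2i+1\<^esup> / \<eta>\<^bsup>24i+1\<^esup>\<close> has leading coefficient \<open>1\<close> there is a form \<open>F\<^sub>j\<close> with integral coefficients
  and principal part \<open>q\<close> to the power \<open>- l\<^bsup>2j\<^esup> / 24\<close>; in particular \<open>F\<^sub>0 = E\<^sub>6 / \<eta>\<close>.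

  For a prime \<open>l > 3\<close> the Hecke operator \<open>T = T(l\<^sup>2)\<close>, which sends the coefficients \<open>a(n)\<close> to
  \<open>a(l\<^sup>2n) + \<chi>\<^bsub>12\<^esub>(l) (-n/l) l\<^sup>4 a(n) + l\<^sup>9 a(n/l\<^sup>2)\<close>, acts on these forms. Comparing principal parts,
  \<open>T F\<^sub>0 = l\<^sup>9 F\<^sub>1 + c l\<^sup>4 F\<^sub>0\<close> and \<open>T F\<^sub>j = l\<^sup>9 F\<^bsub>j+1\<^esub> + F\<^bsub>j-1\<^esub>\<close> for \<open>j > 0\<close>. Solving for \<open>a(l\<^sup>2n)\<close> and
  inducting on \<open>k\<close>, the coefficients of \<open>F\<^sub>j\<close> at multiples of \<open>l\<^bsup>2k\<^esup>\<close> are divisible by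
  \<open>l\<^bsup>4(k-j)\<^esup>\<close>, which for \<open>j = 0\<close> is more than required.

  That \<open>T\<close> preserves the transformation law is checked on the generator \<open>\<tau> \<mapsto> - 1 / \<tau>\<close>. The terms
  \<open>D((\<tau> + 24b) / l\<^sup>2)\<close> with \<open>b \<noteq> 0\<close> need the multiplier of \<open>\<eta>\<close> for general
  modular matrices; it is read off from \<open>\<eta>\<close> as a theta series, by splitting the series into residue
  classes, Poisson summation and an evaluation of Gauss sums.
\<close>

section \<open>The theta transformation\<close>

text \<open>In weight 11/2 the law of a form \<open>D\<close> under a general modular matrix
  contains a root of unity depending on the matrix. It is reached by a detour:
  \<open>D * eta\<close> has weight 6 and trivial multiplier, so its law follows from the two
  generators, and dividing by the explicit law of \<open>eta\<close> gives that of \<open>D\<close>.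
  The Gauss sums left over by this division are the source of the quadratic symbol in the middle
  Hecke term.

  Translations are taken by multiples of 24 because the exponents are multiples of 1/24: such a
  shift, divided by c, multiplies the coefficient at q^(n/24) by an additive character of n modulo
  c.

  The whole family F_j is involved since T does not map F_0 to a multiple of itself. The slope 4 of
  the bound 4(k-j) is the exponent of the middle term of T, whose index stays at the previous level.
  The dependence on j is dictated by F_(j-1), which appears without any power of l: its bound at
  level k-1 must already be the one wanted for F_j at level k. The factor l^9 then covers
  F_(j+1).\<close>

lemma tendsto_infsum_dominated:
  fixes f :: "nat \<Rightarrow> 'a \<Rightarrow> 'b::banach"
  assumes lim: "\<And>k. k \<in> A \<Longrightarrow> (\<lambda>n. f n k) \<longlonglongrightarrow> g k"
    and bound: "\<And>n k. k \<in> A \<Longrightarrow> norm (f n k) \<le> M k"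
    and M: "M summable_on A"
  shows "(\<lambda>n. infsum (f n) A) \<longlonglongrightarrow> infsum g A"
proof (rule LIMSEQ_I)
  fix e :: real assume e: "e > 0"
  have bound_g: "norm (g k) \<le> M k" if "k \<in> A" for k
    using lim[OF that] bound[OF that] by (intro Lim_bounded[OF tendsto_norm]) auto
  \<comment> \<open>Tannery's argument: outside the finite set \<open>F\<close> the majorant has sum
    at most e/4, so the tails of \<open>f n\<close> and of the limit cost e/4 each, and the finitely
    many terms in \<open>F\<close> cost another e/4 for large \<open>n\<close>.\<close>
  obtain F where F: "finite F" "F \<subseteq> A" and FM: "dist (sum M F) (infsum M A) \<le> e / 4"
    using infsum_finite_approximation[OF M, of "e / 4"] e by auto
  have split: "infsum u A = sum u F + infsum u (A - F)"
    and tail: "norm (infsum u (A - F)) \<le> infsum M (A - F)" 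
    if u: "\<And>k. k \<in> A \<Longrightarrow> norm (u k) \<le> M k" for u :: "'a \<Rightarrow> 'b"
  proof -
    have "(\<lambda>k. norm (u k)) summable_on A"
      by (rule summable_on_comparison_test[OF M]) (use u in auto)
    then have s: "u summable_on A - F" "(\<lambda>k. norm (u k)) summable_on A - F"
      by (auto intro: summable_on_subset abs_summable_summable)
    show "infsum u A = sum u F + infsum u (A - F)"
      using infsum_Un_disjoint[of u F "A - F"] F s by (simp add: Un_absorb1)
    have "norm (infsum u (A - F)) \<le> infsum (\<lambda>k. norm (u k)) (A - F)"
      using s by (intro norm_infsum_bound)
    also have "\<dots> \<le> infsum M (A - F)"
      using s M u by (intro infsum_mono) (auto intro: summable_on_subset)
    finally show "norm (infsum u (A - F)) \<le> infsum M (A - F)" .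
  qed
  have Mtail: "infsum M (A - F) \<le> e / 4"
  proof -
    have "infsum M A = sum M F + infsum M (A - F)"
      using infsum_Un_disjoint[of M F "A - F"] F M
      by (simp add: Un_absorb1 summable_on_subset)
    then show ?thesis using FM by (simp add: dist_real_def)
  qed
  have "(\<lambda>n. \<Sum>k\<in>F. f n k) \<longlonglongrightarrow> (\<Sum>k\<in>F. g k)"
    using F lim by (intro tendsto_sum) auto
  then obtain N where N: "\<And>n. n \<ge> N \<Longrightarrow> norm (sum (f n) F - sum g F) < e / 4"
    using e unfolding LIMSEQ_iff by (metis divide_pos_pos zero_less_numeral)
  show "\<exists>N. \<forall>n\<ge>N. norm (infsum (f n) A - infsum g A) < e"
  proof (intro exI allI impI)
    fix n assume n: "n \<ge> N"
    have "infsum (f n) A - infsum g A =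
      (sum (f n) F - sum g F) + (infsum (f n) (A - F) - infsum g (A - F))"
      using split[of "f n"] split[of g] bound bound_g by simp
    also have "norm \<dots> \<le> norm (sum (f n) F - sum g F)
        + (norm (infsum (f n) (A - F)) + norm (infsum g (A - F)))"
      by (meson norm_triangle_ineq norm_triangle_ineq4 order_trans add_left_mono)
    also have "\<dots> < e / 4 + (e / 4 + e / 4)"
      using N[OF n] tail[of "f n"] tail[of g] bound bound_g Mtail by force
    finally show "norm (infsum (f n) A - infsum g A) < e" using e by simp
  qed
qed

lemma summable_on_intI:
  fixes f :: "int \<Rightarrow> real"
  assumes "(\<lambda>n. f (int n)) summable_on UNIV" "(\<lambda>n. f (- int n)) summable_on UNIV"
  shows "f summable_on UNIV"
proof -
  have p: "f summable_on range int"
    by (subst summable_on_reindex) (use assms in \<open>auto simp: o_def\<close>)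
  have n: "f summable_on range (\<lambda>n. - int n)"
    by (subst summable_on_reindex) (use assms in \<open>auto simp: o_def inj_on_def\<close>)
  have "k \<in> range int \<union> range (\<lambda>n. - int n)" for k
    by (cases k rule: int_cases2) auto
  then have "range int \<union> range (\<lambda>n. - int n) = UNIV" by blast
  then show ?thesis using summable_on_union[OF p n] by simp
qed

section \<open>Fourier analysis at roots of unity\<close>

lemma sum_roots_of_unity:
  fixes l :: nat and \<nu> :: int
  assumes "l > 0"
  shows "(\<Sum>j<l. cis (2 * pi * real j * \<nu> / l)) = (if int l dvd \<nu> then of_nat l else 0)"
proof -
  define \<zeta> where "\<zeta> = cis (2 * pi * \<nu> / l)"
  have pow: "cis (2 * pi * real j * \<nu> / l) = \<zeta> ^ j" for j
    unfolding \<zeta>_def Complex.DeMoivre by (simp add: mult_ac)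
  have one: "\<zeta> = 1 \<longleftrightarrow> int l dvd \<nu>"
  proof
    assume "\<zeta> = 1"
    then have "cos (2 * pi * \<nu> / l) = 1"
      by (simp add: \<zeta>_def complex_eq_iff)
    then obtain n where "2 * pi * \<nu> / l = of_int n * 2 * pi"
      unfolding cos_one_2pi_int by auto
    then have "real_of_int \<nu> = of_int (n * int l)"
      using assms by (simp add: field_simps)
    then have "\<nu> = n * int l" by (simp only: of_int_eq_iff)
    then show "int l dvd \<nu>" by simp
  next
    assume "int l dvd \<nu>"
    then obtain n where "\<nu> = int l * n" by (elim dvdE)
    then have "2 * pi * \<nu> / l = 2 * pi * of_int n" using assms by (simp add: field_simps)
    then show "\<zeta> = 1" unfolding \<zeta>_def by (simp add: cis_multiple_2pi)
  qed
  have "\<zeta> ^ l = cis (2 * pi * of_int \<nu>)"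
    using assms by (simp add: \<zeta>_def Complex.DeMoivre)
  then have "\<zeta> ^ l = 1" by (simp add: cis_multiple_2pi)
  then have "(\<Sum>j<l. \<zeta> ^ j) = (if int l dvd \<nu> then of_nat l else 0)"
    using one by (auto simp: geometric_sum)
  then show ?thesis by (simp only: pow)
qed

text \<open>The residues -h, ..., h form a complete system because the modulus 2h + 1 is odd.
  Shifting them to 0, ..., l - 1 isolates a constant phase; when l divides \<nu>, its part coming
  from -h is a number of full turns and the part with \<alpha> is left.\<close>

lemma sum_roots_of_unity_sym:
  fixes h :: nat and \<nu> :: int
  defines "l \<equiv> 2 * h + 1"
  shows "(\<Sum>j=-int h..int h. cis (2 * pi * (real_of_int j + \<alpha>) * \<nu> / l))
       = (if int l dvd \<nu> then of_nat l * cis (2 * pi * \<alpha> * \<nu> / l) else 0)"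
proof -
  have "(\<Sum>j=-int h..int h. cis (2 * pi * (real_of_int j + \<alpha>) * \<nu> / l))
      = (\<Sum>j<l. cis (2 * pi * (\<alpha> - h) * \<nu> / l) * cis (2 * pi * real j * \<nu> / l))"
  proof (rule sum.reindex_bij_witness[of _ "\<lambda>i. int i - int h" "\<lambda>j. nat (j + int h)"])
    fix j assume "j \<in> {- int h..int h}"
    then have "real (nat (j + int h)) = of_int j + h" by simp
    then show "cis (2 * pi * (\<alpha> - h) * \<nu> / l) * cis (2 * pi * real (nat (j + int h)) * \<nu> / l)
        = cis (2 * pi * (real_of_int j + \<alpha>) * \<nu> / l)"
      by (simp only: cis_mult add_divide_distrib[symmetric]) (simp add: algebra_simps)
  qed (auto simp: l_def)
  also have "\<dots> = cis (2 * pi * (\<alpha> - h) * \<nu> / l) * (if int l dvd \<nu> then of_nat l else 0)"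
    by (subst sum_distrib_left[symmetric], subst sum_roots_of_unity) (auto simp: l_def)
  also have "\<dots> = (if int l dvd \<nu> then of_nat l * cis (2 * pi * \<alpha> * \<nu> / l) else 0)"
  proof (cases "int l dvd \<nu>")
    case True
    then obtain n where n: "\<nu> = int l * n" by (elim dvdE)
    have "l > 0" by (simp add: l_def)
    then have "2 * pi * (\<alpha> - h) * \<nu> / l = 2 * pi * \<alpha> * \<nu> / l + 2 * pi * of_int (- int h * n)"
      by (simp add: n field_simps)
    then have "cis (2 * pi * (\<alpha> - h) * \<nu> / l) = cis (2 * pi * \<alpha> * \<nu> / l) * cis (2 * pi * of_int (- int h * n))"
      by (simp only: cis_mult)
    also have "cis (2 * pi * of_int (- int h * n)) = 1"
      by (rule cis_multiple_2pi) auto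
    finally show ?thesis using True by simp
  qed auto
  finally show ?thesis .
qed

lemma cos_power_even:
  "complex_of_real (cos x ^ (2 * m))
    = (\<Sum>i\<le>2*m. of_nat (2*m choose i) / 4 ^ m * cis (2 * x * (real i - m)))"
proof -
  have "complex_of_real (cos x) = (cis x + cis (-x)) / 2"
    by (simp add: complex_eq_iff)
  then have "complex_of_real (cos x ^ (2 * m)) = (cis x + cis (-x)) ^ (2 * m) / 2 ^ (2 * m)"
    by (simp only: of_real_power power_divide)
  also have "\<dots> = (\<Sum>i\<le>2*m. of_nat (2*m choose i) * cis x ^ i * cis (-x) ^ (2*m-i)) / 4 ^ m"
    by (subst binomial_ring) (simp add: power_mult)
  also have "\<dots> = (\<Sum>i\<le>2*m. of_nat (2*m choose i) / 4 ^ m * cis (2 * x * (real i - m)))"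
    unfolding sum_divide_distrib
  proof (rule sum.cong[OF refl])
    fix i assume "i \<in> {..2*m}"
    then have "cis x ^ i * cis (-x) ^ (2*m-i) = cis (2 * x * (real i - m))"
      by (simp add: Complex.DeMoivre cis_mult of_nat_diff algebra_simps)
    then show "of_nat (2*m choose i) * cis x ^ i * cis (-x) ^ (2*m-i) / 4 ^ m =
      of_nat (2*m choose i) / 4 ^ m * cis (2 * x * (real i - m))"
      by (simp add: mult.assoc)
  qed
  finally show ?thesis .
qed

text \<open>
  Polya's derivation: the Fourier coefficients of \<open>cos\<^bsup>2m\<^esup>\<close> are binomial, so sampling it at
  \<open>l = 2h + 1\<close> equidistant points and letting \<open>m \<sim> t l\<^sup>2 / \<pi>\<close> turns both sides into Gaussian sums.
\<close>

definition binom_weight :: "nat \<Rightarrow> int \<Rightarrow> real" where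
  "binom_weight m v = (if \<bar>v\<bar> \<le> int m then real (2 * m choose nat (int m + v)) / 4 ^ m else 0)"

text \<open>Summing the binomial expansion of cos^(2m) over the sample points keeps exactly the
  frequencies i - m that are multiples l * k of \<open>l\<close>. The range of \<open>k\<close> on
  the right is generous: \<open>binom_weight\<close> vanishes once |l * k| > m.\<close>

lemma polya_identity:
  fixes h m :: nat and \<alpha> :: real
  defines "l \<equiv> 2 * h + 1"
  shows "(\<Sum>j=-int h..int h. complex_of_real (cos (pi * (real_of_int j + \<alpha>) / l) ^ (2 * m)))
       = (\<Sum>k=-int m..int m. of_real (real l * binom_weight m (int l * k)) * cis (2 * pi * k * \<alpha>))"
proof -
  have l: "l > 0" by (simp add: l_def)
  have "(\<Sum>j=-int h..int h. complex_of_real (cos (pi * (real_of_int j + \<alpha>) / l) ^ (2 * m)))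
     = (\<Sum>i\<le>2*m. of_nat (2*m choose i) / 4 ^ m * 
          (\<Sum>j=-int h..int h. cis (2 * pi * (real_of_int j + \<alpha>) * of_int (int i - int m) / l)))"
    unfolding cos_power_even
    by (subst sum.swap) (simp add: sum_distrib_left field_simps)
  also have "\<dots> = (\<Sum>i\<le>2*m. of_nat (2*m choose i) / 4 ^ m *
     (if int l dvd int i - int m then of_nat l * cis (2 * pi * \<alpha> * of_int (int i - int m) / l) else 0))"
    using sum_roots_of_unity_sym[where h = h and \<alpha> = \<alpha>] unfolding l_def by presburger
  also have "\<dots> = (\<Sum>i | i \<le> 2*m \<and> int l dvd int i - int m. of_nat (2*m choose i) / 4 ^ m *
     of_nat l * cis (2 * pi * \<alpha> * of_int (int i - int m) / l))"
    by (rule sum.mono_neutral_cong_right) auto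
  also have "\<dots> = (\<Sum>k | \<bar>int l * k\<bar> \<le> int m. of_real (real l * binom_weight m (int l * k)) * cis (2 * pi * k * \<alpha>))"
  proof (rule sum.reindex_bij_witness[of _ "\<lambda>k. nat (int m + int l * k)" "\<lambda>i. (int i - int m) div int l"])
    fix i assume i: "i \<in> {i. i \<le> 2*m \<and> int l dvd int i - int m}"
    then have k: "int l * ((int i - int m) div int l) = int i - int m" by simp
    show "nat (int m + int l * ((int i - int m) div int l)) = i" using k by simp
    have ab: "\<bar>int i - int m\<bar> \<le> int m" using i by auto
    then show "(int i - int m) div int l \<in> {k. \<bar>int l * k\<bar> \<le> int m}" by (simp add: k)
    have "real l * real_of_int ((int i - int m) div int l) = of_int (int l * ((int i - int m) div int l))"
      by simp
    then have r: "real_of_int ((int i - int m) div int l) = of_int (int i - int m) / l"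
      using l unfolding k by (simp add: field_simps)
    show "of_real (real l * binom_weight m (int l * ((int i - int m) div int l))) *
        cis (2 * pi * real_of_int ((int i - int m) div int l) * \<alpha>) =
      of_nat (2*m choose i) / 4 ^ m * of_nat l * cis (2 * pi * \<alpha> * of_int (int i - int m) / l)"
      using i ab unfolding k r binom_weight_def by (simp add: field_simps)
  qed (use l in auto)
  also have "\<dots> = (\<Sum>k=-int m..int m. of_real (real l * binom_weight m (int l * k)) * cis (2 * pi * k * \<alpha>))"
  proof (rule sum.mono_neutral_left)
    show "{k. \<bar>int l * k\<bar> \<le> int m} \<subseteq> {- int m..int m}"
    proof safe
      fix k assume "\<bar>int l * k\<bar> \<le> int m"
      moreover have "\<bar>k\<bar> \<le> \<bar>int l * k\<bar>" using l by (simp add: abs_mult mult_le_cancel_right1)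
      ultimately show "k \<in> {- int m..int m}" by auto
    qed
  qed (auto simp: binom_weight_def)
  finally show ?thesis .
qed

section \<open>Gaussian asymptotics of binomial coefficients\<close>

lemma central_binomial_wallis:
  "(\<lambda>m. real (2 * m choose m) / 4 ^ m * sqrt m) \<longlonglongrightarrow> 1 / sqrt pi"
proof -
  \<comment> \<open>The m-th partial Wallis product, the squared central weight and the factor 2m +
    1 multiply to 1 for every m, so the limit pi/2 of the product determines that of the weight. The
    factor m / (2m + 1) turns 2 / pi into 1 / pi before square roots are taken.\<close>
  have eq: "(\<Prod>k=1..m. (4*real k^2) / (4*real k^2 - 1)) * (real (2 * m choose m) / 4 ^ m)\<^sup>2 * real (2 * m + 1) = 1" for m
  proof (induction m)
    case (Suc m)
    have *: "real (2 * Suc m choose Suc m) * (m + 1) = real (2 * m choose m) * (2 * (2 * m + 1))"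
    proof -
      have "Suc m * (2 * Suc m choose Suc m) = 2 * (2 * m + 1) * (2 * m choose m)"
      proof -
        have "Suc m * (Suc (Suc (2 * m)) choose Suc m) = Suc (Suc (2 * m)) * (Suc (2*m) choose m)"
          by (rule Suc_times_binomial)
        moreover have "Suc m * (Suc (2 * m) choose Suc m) = Suc (2 * m) * (2*m choose m)"
          by (rule Suc_times_binomial)
        moreover have "(Suc (2 * m) choose Suc m) = (Suc (2*m) choose m)"
          using binomial_symmetric[of "Suc m" "Suc (2*m)"] by simp
        ultimately show ?thesis by (simp add: algebra_simps)
      qed
      then show ?thesis by (simp only: of_nat_mult[symmetric] of_nat_eq_iff) (simp add: algebra_simps)
    qed
    then have **: "real (2 * Suc m choose Suc m) = real (2 * m choose m) * (2 * (2 * m + 1)) / (m + 1)"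
      by (simp add: field_simps)
    have "(4 * real (Suc m)^2 - 1) = (2 * m + 1) * (2 * m + 3)"
      by (simp add: power2_eq_square algebra_simps)
    then have "(\<Prod>k=1..Suc m. (4*real k^2) / (4*real k^2 - 1)) =
       (\<Prod>k=1..m. (4*real k^2) / (4*real k^2 - 1)) * (4 * (m+1)^2 / ((2 * m + 1) * (2 * m + 3)))"
      by (simp add: algebra_simps)
    moreover have "(4 * (m+1)^2 / ((2 * m + 1) * (2 * m + 3))) * (real (2 * Suc m choose Suc m) / 4 ^ Suc m)\<^sup>2 * real (2 * Suc m + 1)
       = (real (2 * m choose m) / 4 ^ m)\<^sup>2 * real (2 * m + 1)"
    proof -
      have id: "(4 * (x + 1)^2 / ((2 * x + 1) * (2 * x + 3))) * (c * (2 * (2 * x + 1)) / (x + 1) / (4 * d))\<^sup>2 * (2 * x + 3)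
        = (c / d)\<^sup>2 * (2 * x + 1)" if "x \<ge> 0" "d > 0" for x c d :: real
      proof -
        define A B C where "A = 2 * x + 1" and "B = x + 1" and "C = 2 * x + 3"
        have nz: "A \<noteq> 0" "B \<noteq> 0" "C \<noteq> 0" using that by (auto simp: A_def B_def C_def)
        have "c * (2 * A) / B / (4 * d) = (c / d) * (A / (2 * B))"
          by (simp add: mult.assoc mult.commute mult.left_commute)
        then have "(4 * B\<^sup>2 / (A * C)) * (c * (2 * A) / B / (4 * d))\<^sup>2 * C
            = (4 * B\<^sup>2 / (A * C)) * ((c / d)\<^sup>2 * (A\<^sup>2 / (4 * B\<^sup>2))) * C"
          by (simp only: power_mult_distrib power_divide) simp
        also have "\<dots> = (c / d)\<^sup>2 * A"
          using nz by (simp add: power2_eq_square)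
        finally show ?thesis unfolding A_def B_def C_def .
      qed
      show ?thesis unfolding ** using id[of "real m" "4 ^ m" "real (2 * m choose m)"] by (simp add: algebra_simps)
    qed
    ultimately show ?case using Suc.IH by (simp only: mult.assoc)
  qed auto
  have "(\<lambda>m. inverse (\<Prod>k=1..m. (4*real k^2) / (4*real k^2 - 1)) * (m / real (2 * m + 1))) \<longlonglongrightarrow> inverse (pi / 2) * (1/2)"
    by (intro tendsto_mult tendsto_inverse wallis) (simp, real_asymp)
  moreover have "inverse (\<Prod>k=1..m. (4*real k^2) / (4*real k^2 - 1)) * (m / real (2 * m + 1)) =
     (real (2 * m choose m) / 4 ^ m)\<^sup>2 * m" for m
  proof -
    have "inverse (\<Prod>k=1..m. (4*real k^2) / (4*real k^2 - 1)) = (real (2 * m choose m) / 4 ^ m)\<^sup>2 * (2 * m + 1)"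
      using eq[of m] by (intro inverse_unique) (simp add: mult.assoc)
    then have "inverse (\<Prod>k=1..m. (4*real k^2) / (4*real k^2 - 1)) * (m / real (2 * m + 1))
        = (real (2 * m choose m) / 4 ^ m)\<^sup>2 * (real (2 * m + 1) * (m / real (2 * m + 1)))"
      by (simp only: mult.assoc)
    also have "real (2 * m + 1) * (m / real (2 * m + 1)) = m"
      by (rule nonzero_mult_div_cancel_left[of "real (2 * m + 1)", simplified times_divide_eq_right[symmetric]]) linarith
    finally show ?thesis .
  qed
  ultimately have "(\<lambda>m. (real (2 * m choose m) / 4 ^ m)\<^sup>2 * m) \<longlonglongrightarrow> inverse (pi / 2) * (1/2)"
    by (simp only:)
  moreover have "inverse (pi / 2) * (1/2) = 1 / pi" by simp
  ultimately have "(\<lambda>m. (real (2 * m choose m) / 4 ^ m)\<^sup>2 * m) \<longlonglongrightarrow> 1 / pi"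
    by (simp only:)
  then have "(\<lambda>m. sqrt ((real (2 * m choose m) / 4 ^ m)\<^sup>2 * m)) \<longlonglongrightarrow> sqrt (1 / pi)"
    by (rule tendsto_real_sqrt)
  then show ?thesis by (simp add: real_sqrt_mult real_sqrt_divide)
qed

text \<open>The ratio is the product over w < v of (m - w) / (m + w + 1). Each factor equals 1 - (2w
  + 1) / (m + w + 1), and its inverse is 1 + (2w + 1) / (m - w), so 1 + x \<le> exp x yields both
  bounds once the denominators are made uniform. The exponents add up to v^2 as a sum of odd
  numbers.\<close>

lemma binomial_ratio_bounds:
  fixes m v :: nat
  shows "v < m \<Longrightarrow> exp (- (real v)\<^sup>2 / (real m - v)) \<le> real (2 * m choose (m + v)) / real (2 * m choose m)"
    and "v \<le> m \<Longrightarrow> real (2 * m choose (m + v)) / real (2 * m choose m) \<le> exp (- (real v)\<^sup>2 / (real m + v))"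
proof -
  define p where "p = (\<lambda>w. real (2 * m choose (m + w)) / real (2 * m choose m))"
  have step: "p (Suc w) = p w * ((real m - real w) / (real m + real w + 1))" if "w < m" for w
  proof -
    have "Suc (m + w) * (2 * m choose Suc (m + w)) = (2 * m - (m + w)) * (2 * m choose (m + w))"
      by (metis binomial_absorb_comp binomial_absorption mult.commute Suc_times_binomial_add binomial_absorption)
    then have "real (Suc (m + w)) * real (2 * m choose Suc (m + w)) = real (2 * m - (m + w)) * real (2 * m choose (m + w))"
      by (simp only: of_nat_mult[symmetric])
    then have "real (2 * m choose Suc (m + w)) = real (2 * m choose (m + w)) * ((real m - real w) / (real m + real w + 1))"
      using that by (simp add: of_nat_diff field_simps)
    then show ?thesis by (simp add: p_def)
  qed
  have sum: "(\<Sum>w<u. 2 * real w + 1) = (real u)\<^sup>2" for u :: nat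
    by (induction u) (auto simp: power2_eq_square algebra_simps)
  have prod: "p u = (\<Prod>w<u. (real m - real w) / (real m + real w + 1))" if "u \<le> m" for u
    using that
  proof (induction u)
    case 0 then show ?case by (simp add: p_def)
  next
    case (Suc u) then show ?case using step[of u] by simp
  qed
  {
  assume assms: "v < m"
  have "exp (- (real v)\<^sup>2 / (real m - v)) = (\<Prod>w<v. exp (- ((2 * real w + 1) / (real m - v))))"
    by (simp add: exp_sum[symmetric] sum_negf sum_divide_distrib[symmetric] sum)
  also have "\<dots> \<le> p v"
    unfolding prod[OF less_imp_le[OF assms]]
  proof (rule prod_mono, safe)
    fix w assume w: "w < v"
    have "1 + (2 * real w + 1) / (real m - w) \<le> exp ((2 * real w + 1) / (real m - w))"
      by (rule exp_ge_add_one_self)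
    also have "\<dots> \<le> exp ((2 * real w + 1) / (real m - v))"
      using w assms by (auto intro!: divide_left_mono)
    finally have "(real m + w + 1) / (real m - w) \<le> exp ((2 * real w + 1) / (real m - v))"
      using w assms by (simp add: field_simps)
    then have "inverse (exp ((2 * real w + 1) / (real m - v))) \<le> inverse ((real m + w + 1) / (real m - w))"
      using w assms by (intro le_imp_inverse_le) auto
    then show "exp (- ((2 * real w + 1) / (real m - v))) \<le> (real m - real w) / (real m + real w + 1)"
      by (simp add: exp_minus inverse_eq_divide)
  qed auto
  finally show "exp (- (real v)\<^sup>2 / (real m - v)) \<le> real (2 * m choose (m + v)) / real (2 * m choose m)"
    unfolding p_def .
  }
  assume assms: "v \<le> m"
  have "p v \<le> (\<Prod>w<v. exp (- ((2 * real w + 1) / (real m + v))))"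
    unfolding prod[OF assms]
  proof (rule prod_mono, safe)
    fix w assume w: "w < v"
    have "(real m - real w) / (real m + real w + 1) = 1 + (- ((2 * real w + 1) / (real m + w + 1)))"
      by (simp add: field_simps)
    also have "\<dots> \<le> exp (- ((2 * real w + 1) / (real m + w + 1)))"
      by (rule exp_ge_add_one_self)
    also have "\<dots> \<le> exp (- ((2 * real w + 1) / (real m + v)))"
      using w assms by (auto intro!: divide_left_mono)
    finally show "(real m - real w) / (real m + real w + 1) \<le> exp (- ((2 * real w + 1) / (real m + v)))" .
  qed (use assms in auto)
  also have "\<dots> = exp (- (real v)\<^sup>2 / (real m + v))"
    by (simp add: exp_sum[symmetric] sum_negf sum_divide_distrib[symmetric] sum)
  finally show "real (2 * m choose (m + v)) / real (2 * m choose m) \<le> exp (- (real v)\<^sup>2 / (real m + v))"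
    unfolding p_def .
qed


text \<open>From sin y \<ge> y / 2 one gets cos^2 y \<le> 1 - y^2 / 4 \<le> exp (- y^2 / 4). A bound
  of Gaussian shape, uniform up to pi / 2, is what dominates the sampled cosine sum.\<close>

lemma cos_le_exp_quadratic:
  assumes "\<bar>y\<bar> \<le> pi / 2"
  shows "\<bar>cos y ^ (2 * m)\<bar> \<le> exp (- real m * y\<^sup>2 / 4)"
proof -
  \<comment> \<open>The range is cut at pi / 3, where the derivative cos x - 1/2 of sin x - x/2
    changes sign. Beyond it sin y \<ge> 0.85, whereas y / 2 \<le> pi / 4 \<le> 0.8.\<close>
  have aux: "sin y \<ge> y / 2" if "0 \<le> y" "y \<le> pi / 2" for y :: real
  proof (cases "y \<le> pi / 3")
    case True
    have "sin y - y / 2 \<ge> sin 0 - 0 / 2"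
    proof (rule DERIV_nonneg_imp_nondecreasing[OF \<open>0 \<le> y\<close>])
      fix x assume x: "0 \<le> x" "x \<le> y"
      have "cos x \<ge> cos (pi / 3)" using x True by (intro cos_monotone_0_pi_le) auto
      then have "cos x - 1 / 2 \<ge> 0" by (simp add: cos_60)
      moreover have "((\<lambda>x. sin x - x / 2) has_real_derivative cos x - 1 / 2) (at x)"
        by (auto intro!: derivative_eq_intros)
      ultimately show "\<exists>d. ((\<lambda>x. sin x - x / 2) has_real_derivative d) (at x) \<and> d \<ge> 0" by blast
    qed
    then show ?thesis by simp
  next
    case False
    have "sin y \<ge> sin (pi / 3)" using that False by (intro sin_monotone_2pi_le) auto
    moreover have "sqrt 3 \<ge> 1.7" by (rule real_le_rsqrt) (simp add: power2_eq_square)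
    then have "sin (pi / 3) \<ge> 85 / 100" by (simp add: sin_60)
    moreover have "pi \<le> 3.2" using pi_approx by simp
    ultimately show ?thesis using that by simp
  qed
  have s: "(sin y)\<^sup>2 \<ge> y\<^sup>2 / 4"
  proof -
    have "sin \<bar>y\<bar> \<ge> \<bar>y\<bar> / 2" using assms by (intro aux) auto
    then have "(sin \<bar>y\<bar>)\<^sup>2 \<ge> (\<bar>y\<bar> / 2)\<^sup>2" by (intro power_mono) auto
    moreover have "(sin \<bar>y\<bar>)\<^sup>2 = (sin y)\<^sup>2" by (auto simp: abs_if)
    ultimately show ?thesis by (simp add: power_divide)
  qed
  have "\<bar>cos y ^ (2 * m)\<bar> = (1 - (sin y)\<^sup>2) ^ m"
    by (simp add: power_mult cos_squared_eq abs_square_le_1)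
  also have "\<dots> \<le> exp (- (y\<^sup>2 / 4)) ^ m"
  proof (rule power_mono)
    have "1 - (sin y)\<^sup>2 \<le> 1 + (- (y\<^sup>2 / 4))" using s by simp
    also have "\<dots> \<le> exp (- (y\<^sup>2 / 4))" by (rule exp_ge_add_one_self)
    finally show "1 - (sin y)\<^sup>2 \<le> exp (- (y\<^sup>2 / 4))" .
    show "0 \<le> 1 - (sin y)\<^sup>2" by (simp add: abs_square_le_1)
  qed
  also have "\<dots> = exp (- real m * y\<^sup>2 / 4)"
    by (simp add: exp_of_nat_mult[symmetric])
  finally show ?thesis .
qed

lemma gaussian_shift_summable:
  fixes c \<alpha> :: real
  assumes "c > 0"
  shows "(\<lambda>k::int. exp (- c * (of_int k + \<alpha>)\<^sup>2)) summable_on UNIV"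
proof -
  \<comment> \<open>Completing the square in |k| gives k^2 - (2|\<alpha>| + 1)|k| \<ge> - Q, hence
    (k + \<alpha>)^2 \<ge> |k| - Q. The Gaussian is thus dominated by a geometric series in
    |k|.\<close>
  define Q where "Q = (2 * \<bar>\<alpha>\<bar> + 1)\<^sup>2 / 4"
  have "(\<lambda>n::nat. exp (- c) ^ n) summable_on UNIV"
    using assms by (intro norm_summable_imp_summable_on) (auto intro!: summable_geometric)
  then have s: "(\<lambda>n::nat. exp (c * Q) * exp (- c) ^ n) summable_on UNIV"
    by (rule summable_on_cmult_right)
  have bound: "exp (- c * (of_int k + \<alpha>)\<^sup>2) \<le> exp (c * Q) * exp (- c) ^ (nat \<bar>k\<bar>)" for k
  proof -
    have "(real_of_int k + \<alpha>)\<^sup>2 \<ge> \<bar>of_int k\<bar>\<^sup>2 - 2 * \<bar>\<alpha>\<bar> * \<bar>of_int k\<bar> + \<alpha>\<^sup>2"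
    proof -
      have "(of_int k) * \<alpha> \<ge> - (\<bar>of_int k\<bar> * \<bar>\<alpha>\<bar>)" by (metis abs_ge_minus_self abs_mult minus_le_iff)
      then show ?thesis by (simp add: power2_sum algebra_simps)
    qed
    moreover have "\<bar>real_of_int k\<bar>\<^sup>2 - 2 * \<bar>\<alpha>\<bar> * \<bar>of_int k\<bar> - \<bar>of_int k\<bar> + (2 * \<bar>\<alpha>\<bar> + 1)\<^sup>2 / 4 \<ge> 0"
    proof -
      have "(\<bar>real_of_int k\<bar> - (2 * \<bar>\<alpha>\<bar> + 1) / 2)\<^sup>2 \<ge> 0" by simp
      then show ?thesis by (simp add: power2_diff power_divide field_simps)
    qed
    ultimately have "(real_of_int k + \<alpha>)\<^sup>2 \<ge> \<bar>of_int k\<bar> - Q"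
      unfolding Q_def using zero_le_power2[of \<alpha>] by linarith
    then have "c * (real_of_int k + \<alpha>)\<^sup>2 \<ge> c * (real (nat \<bar>k\<bar>) - Q)"
      using assms by (intro mult_left_mono) auto
    then have "- c * (of_int k + \<alpha>)\<^sup>2 \<le> c * Q + real (nat \<bar>k\<bar>) * (- c)"
      unfolding right_diff_distrib mult_minus_left mult_minus_right mult.commute[of _ c] by linarith
    then have "exp (- c * (of_int k + \<alpha>)\<^sup>2) \<le> exp (c * Q + real (nat \<bar>k\<bar>) * (- c))"
      by (simp only: exp_le_cancel_iff)
    then show ?thesis by (simp only: exp_add exp_of_nat_mult)
  qed
  have "(\<lambda>n::nat. exp (- c * (of_int (int n) + \<alpha>)\<^sup>2)) summable_on UNIV"
  proof (rule summable_on_comparison_test[OF s])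
    fix n show "exp (- c * (of_int (int n) + \<alpha>)\<^sup>2) \<le> exp (c * Q) * exp (- c) ^ n"
      using bound[of "int n"] by (simp only: abs_of_nat nat_int)
  qed auto
  moreover have "(\<lambda>n::nat. exp (- c * (of_int (- int n) + \<alpha>)\<^sup>2)) summable_on UNIV"
  proof (rule summable_on_comparison_test[OF s])
    fix n show "exp (- c * (of_int (- int n) + \<alpha>)\<^sup>2) \<le> exp (c * Q) * exp (- c) ^ n"
      using bound[of "- int n"] by (simp only: abs_minus_cancel abs_of_nat nat_int)
  qed auto
  ultimately show ?thesis by (rule summable_on_intI)
qed

text \<open>The ceiling is the exponent m to be used in the Polya identity for l = 2h + 1; rounding
  changes the quotient by at most 1 / l^2.\<close>

lemma tendsto_exponent_ratio:
  assumes "t > 0"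
  shows "(\<lambda>h. real (nat \<lceil>t * (2 * real h + 1)\<^sup>2 / pi\<rceil>) / (2 * real h + 1)\<^sup>2) \<longlonglongrightarrow> t / pi"
proof (rule tendsto_sandwich[of "\<lambda>_. t / pi" _ _ "\<lambda>h. t / pi + 1 / (2 * real h + 1)\<^sup>2"])
  show "\<forall>\<^sub>F h in sequentially. t / pi \<le> real (nat \<lceil>t * (2 * real h + 1)\<^sup>2 / pi\<rceil>) / (2 * real h + 1)\<^sup>2"
  proof (rule always_eventually, rule allI)
    fix h
    have "t * (2 * real h + 1)\<^sup>2 / pi \<le> real (nat \<lceil>t * (2 * real h + 1)\<^sup>2 / pi\<rceil>)"
      by (rule real_nat_ceiling_ge)
    moreover have "(2 * real h + 1)\<^sup>2 > 0" by simp
    ultimately show "t / pi \<le> real (nat \<lceil>t * (2 * real h + 1)\<^sup>2 / pi\<rceil>) / (2 * real h + 1)\<^sup>2"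
      by (subst pos_le_divide_eq) auto
  qed
  show "\<forall>\<^sub>F h in sequentially. real (nat \<lceil>t * (2 * real h + 1)\<^sup>2 / pi\<rceil>) / (2 * real h + 1)\<^sup>2 \<le> t / pi + 1 / (2 * real h + 1)\<^sup>2"
  proof (rule always_eventually, rule allI)
    fix h
    have "t * (2 * real h + 1)\<^sup>2 / pi \<ge> 0" using assms by simp
    then have "real (nat \<lceil>t * (2 * real h + 1)\<^sup>2 / pi\<rceil>) \<le> t * (2 * real h + 1)\<^sup>2 / pi + 1"
      by linarith
    moreover have "(2 * real h + 1)\<^sup>2 > 0" by simp
    ultimately have "real (nat \<lceil>t * (2 * real h + 1)\<^sup>2 / pi\<rceil>) / (2 * real h + 1)\<^sup>2 \<le> (t * (2 * real h + 1)\<^sup>2 / pi + 1) / (2 * real h + 1)\<^sup>2"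
      by (intro divide_right_mono) auto
    also have "\<dots> = t / pi + 1 / (2 * real h + 1)\<^sup>2"
      by (simp add: add_divide_distrib)
    finally show "real (nat \<lceil>t * (2 * real h + 1)\<^sup>2 / pi\<rceil>) / (2 * real h + 1)\<^sup>2 \<le> t / pi + 1 / (2 * real h + 1)\<^sup>2" .
  qed
  show "(\<lambda>h. t / pi + 1 / (2 * real h + 1)\<^sup>2) \<longlonglongrightarrow> t / pi" by real_asymp
qed auto

lemma binom_weight_uminus: "binom_weight m (- v) = binom_weight m v"
proof (cases "\<bar>v\<bar> \<le> int m")
  case True
  then have "2 * m choose nat (int m + v) = 2 * m choose (2 * m - nat (int m + v))"
    by (intro binomial_symmetric) auto
  moreover have "2 * m - nat (int m + v) = nat (int m - v)" using True by auto
  ultimately show ?thesis using True by (simp add: binom_weight_def)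
qed (simp add: binom_weight_def)

lemma binom_weight_abs: "binom_weight m v = binom_weight m (int (nat \<bar>v\<bar>))"
  by (cases "v \<ge> 0") (auto simp: binom_weight_uminus)

text \<open>Replacing m + |v| by 2m in the upper ratio bound makes the Gaussian estimate uniform in
  \<open>v\<close>, since the weight is 0 for |v| > m. It provides the majorant on the binomial
  side.\<close>

lemma binom_weight_le:
  "binom_weight m v \<le> binom_weight m 0 * exp (- (real_of_int v)\<^sup>2 / (2 * real m))"
proof -
  define w where "w = nat \<bar>v\<bar>"
  have "binom_weight m (int w) \<le> binom_weight m 0 * exp (- (real w)\<^sup>2 / (2 * real m))"
  proof (cases "w \<le> m")
    case True
    have "real (2 * m choose (m + w)) / real (2 * m choose m) \<le> exp (- (real w)\<^sup>2 / (real m + w))"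
      using True by (rule binomial_ratio_bounds)
    also have "\<dots> \<le> exp (- (real w)\<^sup>2 / (2 * real m))"
    proof (cases "m = 0")
      case False
      have "(real w)\<^sup>2 / (2 * real m) \<le> (real w)\<^sup>2 / (real m + real w)"
        by (rule divide_left_mono) (use True False in \<open>auto intro!: mult_pos_pos\<close>)
      then show ?thesis by simp
    qed (use True in auto)
    finally have "real (2 * m choose (m + w)) \<le> real (2 * m choose m) * exp (- (real w)\<^sup>2 / (2 * real m))"
      by (simp add: field_simps)
    then show ?thesis using True by (simp add: binom_weight_def nat_add_distrib divide_right_mono)
  qed (auto simp: binom_weight_def)
  then show ?thesis using binom_weight_abs[of m v] by (simp add: w_def)
qed


lemma binom_weight_nonneg: "binom_weight m v \<ge> 0"
  by (simp add: binom_weight_def)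

text \<open>With l = 2h + 1, the weight at l * k is the central weight times a ratio. The central
  one is asymptotic to 1 / sqrt (pi M), and l / sqrt M tends to sqrt (pi / t). In the ratio, v = l *
  |k| has at most the order of sqrt M, so v^2 / (M - v) and v^2 / (M + v) both tend to pi * k^2 / t
  and the squeeze closes.\<close>

lemma tendsto_binom_weight:
  fixes M :: "nat \<Rightarrow> nat" and k :: int and t :: real
  assumes t: "t > 0" and M: "(\<lambda>h. real (M h) / (2 * real h + 1)\<^sup>2) \<longlonglongrightarrow> t / pi"
  shows "(\<lambda>h. (2 * real h + 1) * binom_weight (M h) (int (2 * h + 1) * k))
    \<longlonglongrightarrow> exp (- pi * (of_int k)\<^sup>2 / t) / sqrt t"
proof -
  define L where "L = (\<lambda>h::nat. 2 * real h + 1)"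
  define w where "w = nat \<bar>k\<bar>"
  have L: "filterlim L at_top sequentially" unfolding L_def by real_asymp
  have Lpos: "L h > 0" for h by (simp add: L_def)
  have quot: "(\<lambda>h. real (M h) / (L h)\<^sup>2) \<longlonglongrightarrow> t / pi" using M unfolding L_def .
  have LM: "(\<lambda>h. (L h)\<^sup>2 / real (M h)) \<longlonglongrightarrow> pi / t"
    using tendsto_inverse[OF quot] t by simp
  have L1M: "(\<lambda>h. L h / real (M h)) \<longlonglongrightarrow> 0"
  proof -
    have "(\<lambda>h. (L h)\<^sup>2 / real (M h) * inverse (L h)) \<longlonglongrightarrow> pi / t * 0"
      by (intro tendsto_mult LM tendsto_inverse_0_at_top L)
    moreover have "(L h)\<^sup>2 / real (M h) * inverse (L h) = L h / real (M h)" for h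
      using Lpos[of h] by (simp add: power2_eq_square field_simps)
    ultimately show ?thesis by (simp only: mult_zero_right)
  qed
  have Minf: "filterlim M at_top sequentially"
  proof -
    have "filterlim (\<lambda>h. real (M h) / (L h)\<^sup>2 * (L h)\<^sup>2) at_top sequentially"
      by (rule filterlim_tendsto_pos_mult_at_top[OF quot])
         (use t in \<open>auto intro!: filterlim_pow_at_top L\<close>)
    then have "filterlim (\<lambda>h. real (M h)) at_top sequentially"
      using Lpos less_imp_neq by (simp add: L_def)
    then show ?thesis using filterlim_sequentially_iff_filterlim_real by blast
  qed
  have Mev: "\<forall>\<^sub>F h in sequentially. M h > 0"
    using Minf[unfolded filterlim_at_top, rule_format, of 1] by eventually_elim simp
  have central: "(\<lambda>h. L h * binom_weight (M h) 0) \<longlonglongrightarrow> 1 / sqrt t"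
  proof -
    have "(\<lambda>h. real (2 * M h choose M h) / 4 ^ M h * sqrt (M h)) \<longlonglongrightarrow> 1 / sqrt pi"
      using filterlim_compose[OF central_binomial_wallis Minf] .
    then have lim: "(\<lambda>h. real (2 * M h choose M h) / 4 ^ M h * sqrt (M h) * sqrt ((L h)\<^sup>2 / real (M h))) \<longlonglongrightarrow> 1 / sqrt pi * sqrt (pi / t)"
      by (intro tendsto_mult tendsto_real_sqrt LM)
    have val: "1 / sqrt pi * sqrt (pi / t) = 1 / sqrt t" by (simp add: real_sqrt_divide)
    have ev: "\<forall>\<^sub>F h in sequentially. real (2 * M h choose M h) / 4 ^ M h * sqrt (M h) * sqrt ((L h)\<^sup>2 / real (M h))
       = L h * binom_weight (M h) 0"
      using Mev
    proof (eventually_elim)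
      case (elim h)
      then show ?case using Lpos[of h] by (simp add: real_sqrt_divide binom_weight_def)
    qed
    show ?thesis by (rule Lim_transform_eventually[OF lim[unfolded val] ev])
  qed
  have ratio: "(\<lambda>h. binom_weight (M h) (int (2 * h + 1) * k) / binom_weight (M h) 0) \<longlonglongrightarrow> exp (- pi * (of_int k)\<^sup>2 / t)"
  proof -
    \<comment> \<open>The sign parameter \<open>s\<close> is used with -1 for the lower and with 1
      for the upper bound of the squeeze.\<close>
    have lim1: "(\<lambda>h. - (L h * w)\<^sup>2 / (real (M h) + s * (L h * w))) \<longlonglongrightarrow> - pi * (of_int k)\<^sup>2 / t" for s
    proof -
      have a1: "(\<lambda>h. (L h)\<^sup>2 / real (M h) * w\<^sup>2) \<longlonglongrightarrow> pi / t * w\<^sup>2"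
        by (intro tendsto_mult LM tendsto_const)
      have a2: "(\<lambda>h. L h / real (M h) * w) \<longlonglongrightarrow> 0 * real w"
        by (intro tendsto_mult L1M tendsto_const)
      have lim: "(\<lambda>h. - ((L h)\<^sup>2 / real (M h) * w\<^sup>2) / (1 + s * (L h / real (M h) * w))) \<longlonglongrightarrow> - (pi / t * w\<^sup>2) / (1 + s * (0 * real w))"
        by (rule tendsto_divide[OF tendsto_minus[OF a1] tendsto_add[OF tendsto_const tendsto_mult[OF tendsto_const a2]]]) simp
      have ev: "\<forall>\<^sub>F h in sequentially. - ((L h)\<^sup>2 / real (M h) * w\<^sup>2) / (1 + s * (L h / real (M h) * w))
         = - (L h * w)\<^sup>2 / (real (M h) + s * (L h * w))"
        using Mev
      proof (eventually_elim)
        case (elim h)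
        then have "1 + s * (L h / real (M h) * w) = (real (M h) + s * (L h * w)) / M h"
          by (simp add: field_simps)
        then show ?case using elim by (simp add: power_mult_distrib)
      qed
      have val: "- (pi / t * w\<^sup>2) / (1 + s * (0 * real w)) = - pi * (of_int k)\<^sup>2 / t"
        by (simp add: w_def)
      show ?thesis by (rule Lim_transform_eventually[OF lim[unfolded val] ev])
    qed
    have vw: "nat \<bar>int (2 * h + 1) * k\<bar> = (2 * h + 1) * w" for h
      by (simp only: abs_mult abs_of_nat nat_mult_distrib[OF of_nat_0_le_iff] nat_int w_def)
    have ev: "\<forall>\<^sub>F h in sequentially. (2 * h + 1) * w < M h"
    proof -
      have "(\<lambda>h. L h / real (M h) * w) \<longlonglongrightarrow> 0 * real w" by (intro tendsto_mult tendsto_const L1M)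
      then have "\<forall>\<^sub>F h in sequentially. L h / real (M h) * w < 1"
        by (rule order_tendstoD) simp
      then show ?thesis using Mev
      proof eventually_elim
        case (elim h)
        then have "L h * w < real (M h)" by (simp add: field_simps)
        then have "real ((2 * h + 1) * w) < real (M h)" by (simp add: L_def algebra_simps)
        then show ?case by (simp only: of_nat_less_iff)
      qed
    qed
    have eq: "binom_weight (M h) (int (2 * h + 1) * k) / binom_weight (M h) 0 =
       real (2 * M h choose (M h + (2 * h + 1) * w)) / real (2 * M h choose M h)" if "(2 * h + 1) * w < M h" for h
    proof -
      have "binom_weight (M h) (int (2 * h + 1) * k) = binom_weight (M h) (int ((2 * h + 1) * w))"
        using binom_weight_abs[of "M h" "int (2 * h + 1) * k"] unfolding vw .
      also have "\<dots> = real (2 * M h choose (M h + (2 * h + 1) * w)) / 4 ^ M h"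
      proof -
        have "nat (int (M h) + int ((2 * h + 1) * w)) = M h + (2 * h + 1) * w" by linarith
        moreover have "\<bar>int ((2 * h + 1) * w)\<bar> \<le> int (M h)" using that by linarith
        ultimately show ?thesis unfolding binom_weight_def by presburger
      qed
      finally show ?thesis by (simp add: binom_weight_def)
    qed
    have Lw: "real ((2 * h + 1) * w) = L h * w" for h by (simp add: L_def algebra_simps)
    show ?thesis
    proof (rule tendsto_sandwich)
      show "(\<lambda>h. exp (- (L h * w)\<^sup>2 / (real (M h) + (-1) * (L h * w)))) \<longlonglongrightarrow> exp (- pi * (of_int k)\<^sup>2 / t)"
        by (intro tendsto_exp lim1)
      show "(\<lambda>h. exp (- (L h * w)\<^sup>2 / (real (M h) + 1 * (L h * w)))) \<longlonglongrightarrow> exp (- pi * (of_int k)\<^sup>2 / t)"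
        by (intro tendsto_exp lim1)
      show "\<forall>\<^sub>F h in sequentially. exp (- (L h * w)\<^sup>2 / (real (M h) + (-1) * (L h * w)))
         \<le> binom_weight (M h) (int (2 * h + 1) * k) / binom_weight (M h) 0"
        using ev
      proof eventually_elim
        case (elim h)
        from binomial_ratio_bounds(1)[OF elim] show ?case unfolding eq[OF elim] Lw by simp
      qed
      show "\<forall>\<^sub>F h in sequentially. binom_weight (M h) (int (2 * h + 1) * k) / binom_weight (M h) 0
         \<le> exp (- (L h * w)\<^sup>2 / (real (M h) + 1 * (L h * w)))"
        using ev
      proof eventually_elim
        case (elim h)
        from binomial_ratio_bounds(2)[OF less_imp_le[OF elim]] show ?case unfolding eq[OF elim] Lw by simp
      qed
    qed
  qed
  have "(\<lambda>h. (L h * binom_weight (M h) 0) * (binom_weight (M h) (int (2 * h + 1) * k) / binom_weight (M h) 0))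
      \<longlonglongrightarrow> 1 / sqrt t * exp (- pi * (of_int k)\<^sup>2 / t)"
    by (intro tendsto_mult central ratio)
  moreover have "binom_weight (M h) 0 \<noteq> 0" for h by (simp add: binom_weight_def)
  ultimately show ?thesis by (simp add: L_def mult.commute)
qed

text \<open>The bound |\<alpha>| \<le> 1/2 places every sample point pi * (j + \<alpha>) / (2h + 1)
  with |j| \<le> h inside [-pi/2, pi/2], the range of the cosine estimate. Both sides of the finite
  identity, extended by 0 to all integers, converge under a Gaussian majorant.\<close>

lemma theta_transformation_small:
  fixes t \<alpha> :: real
  assumes t: "t > 0" and \<alpha>: "\<bar>\<alpha>\<bar> \<le> 1 / 2"
  shows "(\<Sum>\<^sub>\<infinity>k::int. complex_of_real (exp (- pi * t * (of_int k + \<alpha>)\<^sup>2)))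
       = (\<Sum>\<^sub>\<infinity>k::int. complex_of_real (exp (- pi * (of_int k)\<^sup>2 / t) / sqrt t) * cis (2 * pi * k * \<alpha>))"
proof -
  define L where "L = (\<lambda>h::nat. 2 * real h + 1)"
  define M where "M = (\<lambda>h. nat \<lceil>t * (L h)\<^sup>2 / pi\<rceil>)"
  have Lpos: "L h > 0" for h by (simp add: L_def)
  have Mlim: "(\<lambda>h. real (M h) / (L h)\<^sup>2) \<longlonglongrightarrow> t / pi"
    unfolding M_def L_def by (rule tendsto_exponent_ratio[OF t])
  have Mge: "real (M h) \<ge> t * (L h)\<^sup>2 / pi" for h
    unfolding M_def by (rule real_nat_ceiling_ge)
  define f where "f = (\<lambda>h (j::int). if \<bar>j\<bar> \<le> int h then complex_of_real (cos (pi * (of_int j + \<alpha>) / L h) ^ (2 * M h)) else 0)"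
  define g where "g = (\<lambda>h (k::int). complex_of_real (L h * binom_weight (M h) (int (2 * h + 1) * k)) * cis (2 * pi * k * \<alpha>))"
  have fin: "infsum (f h) UNIV = infsum (g h) UNIV" for h
  proof -
    have "infsum (f h) UNIV = (\<Sum>j=-int h..int h. complex_of_real (cos (pi * (of_int j + \<alpha>) / L h) ^ (2 * M h)))"
      by (subst infsum_cong_neutral[where T = "{-int h..int h}" and g = "\<lambda>j. complex_of_real (cos (pi * (of_int j + \<alpha>) / L h) ^ (2 * M h))"])
         (auto simp: f_def)
    also have "\<dots> = (\<Sum>k=-int (M h)..int (M h). g h k)"
      using polya_identity[of \<alpha> h "M h"] by (simp add: L_def g_def algebra_simps)
    also have "\<dots> = infsum (g h) UNIV"
    proof (subst infsum_finite[symmetric], simp, rule infsum_cong_neutral)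
      fix k assume k: "k \<in> UNIV - {- int (M h)..int (M h)}"
      have "\<bar>k\<bar> \<le> \<bar>int (2 * h + 1) * k\<bar>" by (simp add: abs_mult mult_le_cancel_right1)
      moreover have "\<bar>k\<bar> > int (M h)" using k by auto
      ultimately have "binom_weight (M h) (int (2 * h + 1) * k) = 0" unfolding binom_weight_def by simp
      then show "g h k = 0" unfolding g_def by (simp only: mult_zero_right of_real_0 mult_zero_left)
    qed auto
    finally show ?thesis .
  qed
  have f_lim: "(\<lambda>h. infsum (f h) UNIV) \<longlonglongrightarrow> (\<Sum>\<^sub>\<infinity>k::int. complex_of_real (exp (- pi * t * (of_int k + \<alpha>)\<^sup>2)))"
  proof (rule tendsto_infsum_dominated)
    show "(\<lambda>k::int. exp (- (pi * t / 4) * (of_int k + \<alpha>)\<^sup>2)) summable_on UNIV"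
      using t by (intro gaussian_shift_summable) auto
    fix j :: int
    define a where "a = pi * (of_int j + \<alpha>)"
    show "norm (f h j) \<le> exp (- (pi * t / 4) * (of_int j + \<alpha>)\<^sup>2)" for h
    proof (cases "\<bar>j\<bar> \<le> int h")
      case True
      have "\<bar>of_int j + \<alpha>\<bar> \<le> real h + 1 / 2" using True \<alpha> by linarith
      then have "\<bar>of_int j + \<alpha>\<bar> * pi \<le> (real h + 1 / 2) * pi" by (rule mult_right_mono) simp
      moreover have "\<bar>a\<bar> = \<bar>of_int j + \<alpha>\<bar> * pi" by (simp add: a_def abs_mult)
      moreover have "(real h + 1 / 2) * pi = pi / 2 * L h" by (simp add: L_def algebra_simps)
      ultimately have "\<bar>a\<bar> \<le> pi / 2 * L h" by simp
      then have "\<bar>a / L h\<bar> \<le> pi / 2"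
        using Lpos[of h] by (simp add: pos_divide_le_eq)
      then have "\<bar>cos (a / L h) ^ (2 * M h)\<bar> \<le> exp (- real (M h) * (a / L h)\<^sup>2 / 4)"
        by (rule cos_le_exp_quadratic)
      also have "\<dots> \<le> exp (- (pi * t / 4) * (of_int j + \<alpha>)\<^sup>2)"
      proof -
        have "t * (L h)\<^sup>2 / pi * (a / L h)\<^sup>2 \<le> real (M h) * (a / L h)\<^sup>2"
          by (intro mult_right_mono Mge) auto
        moreover have "t * (L h)\<^sup>2 / pi * (a / L h)\<^sup>2 = pi * t * (of_int j + \<alpha>)\<^sup>2"
          using Lpos[of h] by (simp add: a_def power_divide power_mult_distrib power2_eq_square)
        ultimately show ?thesis by simp
      qed
      finally show ?thesis by (simp only: f_def a_def True if_True norm_of_real)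
    qed (simp add: f_def)
    \<comment> \<open>Since ln (cos x) behaves like - x^2 / 2 at 0, the power 2 * M of cos (a / L)
      tends to exp (- (t / pi) * a^2), the wanted Gaussian term.\<close>
    have "(\<lambda>h. (L h)\<^sup>2 * ln (cos (a / L h))) \<longlonglongrightarrow> - (a * a / 2)"
      unfolding L_def by real_asymp
    moreover have "- (a * a / 2) = - a\<^sup>2 / 2" by (simp add: power2_eq_square)
    ultimately have "(\<lambda>h. (L h)\<^sup>2 * ln (cos (a / L h))) \<longlonglongrightarrow> - a\<^sup>2 / 2" by (simp only:)
    then have lim: "(\<lambda>h. exp (2 * (real (M h) / (L h)\<^sup>2) * ((L h)\<^sup>2 * ln (cos (a / L h))))) \<longlonglongrightarrow> exp (2 * (t / pi) * (- a\<^sup>2 / 2))"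
      by (intro tendsto_intros Mlim)
    have val: "2 * (t / pi) * (- a\<^sup>2 / 2) = - pi * t * (of_int j + \<alpha>)\<^sup>2"
      by (simp add: a_def power_mult_distrib power2_eq_square)
    have ev: "\<forall>\<^sub>F h in sequentially. exp (2 * (real (M h) / (L h)\<^sup>2) * ((L h)\<^sup>2 * ln (cos (a / L h)))) = cos (a / L h) ^ (2 * M h)"
    proof -
      have "(\<lambda>h. cos (a / L h)) \<longlonglongrightarrow> 1" unfolding L_def by real_asymp
      then have "\<forall>\<^sub>F h in sequentially. cos (a / L h) > 0" by (rule order_tendstoD) simp
      then show ?thesis
      proof eventually_elim
        case (elim h)
        have "2 * (real (M h) / (L h)\<^sup>2) * ((L h)\<^sup>2 * ln (cos (a / L h))) = real (2 * M h) * ln (cos (a / L h))"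
          using Lpos[of h] by simp
        also have "exp \<dots> = cos (a / L h) ^ (2 * M h)"
          using elim by (simp only: exp_of_nat_mult exp_ln)
        finally show ?case .
      qed
    qed
    have "(\<lambda>h. cos (a / L h) ^ (2 * M h)) \<longlonglongrightarrow> exp (- pi * t * (of_int j + \<alpha>)\<^sup>2)"
      by (rule Lim_transform_eventually[OF lim[unfolded val] ev])
    then have "(\<lambda>h. complex_of_real (cos (a / L h) ^ (2 * M h))) \<longlonglongrightarrow> complex_of_real (exp (- pi * t * (of_int j + \<alpha>)\<^sup>2))"
      by (rule tendsto_of_real)
    moreover have "\<forall>\<^sub>F h in sequentially. complex_of_real (cos (a / L h) ^ (2 * M h)) = f h j"
      using eventually_ge_at_top[of "nat \<bar>j\<bar>"] by eventually_elim (simp add: f_def a_def)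
    ultimately show "(\<lambda>h. f h j) \<longlonglongrightarrow> complex_of_real (exp (- pi * t * (of_int j + \<alpha>)\<^sup>2))"
      by (rule Lim_transform_eventually)
  qed
  \<comment> \<open>The case k = 0 of the limit makes the central factor convergent, hence bounded;
    the bound becomes the constant of the majorant on the binomial side.\<close>
  have central_bounded: "\<exists>B. \<forall>h. L h * binom_weight (M h) 0 \<le> B"
  proof -
    have "convergent (\<lambda>h. L h * binom_weight (M h) 0)"
      using tendsto_binom_weight[OF t Mlim[unfolded L_def], of 0] unfolding convergent_def L_def by auto
    then have "Bseq (\<lambda>h. L h * binom_weight (M h) 0)" by (rule convergent_imp_Bseq)
    then obtain B where B: "\<forall>h. norm (L h * binom_weight (M h) 0) \<le> B" unfolding Bseq_def by blast
    have "L h * binom_weight (M h) 0 \<le> B" for h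
      using B[rule_format, of h] by (metis abs_ge_self order_trans real_norm_def)
    then show ?thesis by blast
  qed
  then obtain B where B: "\<And>h. L h * binom_weight (M h) 0 \<le> B" by blast
  \<comment> \<open>From M \<le> (t / pi + 1) * L^2 the exponent (L * k)^2 / (2 * M) is at least c *
    k^2, independently of \<open>h\<close>.\<close>
  define c where "c = 1 / (2 * (t / pi + 1))"
  have c: "c > 0" using t by (auto simp: c_def intro!: divide_pos_pos add_pos_pos)
  have g_lim: "(\<lambda>h. infsum (g h) UNIV) \<longlonglongrightarrow> (\<Sum>\<^sub>\<infinity>k::int. complex_of_real (exp (- pi * (of_int k)\<^sup>2 / t) / sqrt t) * cis (2 * pi * k * \<alpha>))"
  proof (rule tendsto_infsum_dominated)
    show "(\<lambda>k::int. B * exp (- c * (of_int k + 0)\<^sup>2)) summable_on UNIV"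
      by (intro summable_on_cmult_right gaussian_shift_summable c)
    fix k :: int
    show "(\<lambda>h. g h k) \<longlonglongrightarrow> complex_of_real (exp (- pi * (of_int k)\<^sup>2 / t) / sqrt t) * cis (2 * pi * k * \<alpha>)"
      unfolding g_def L_def
      by (intro tendsto_mult tendsto_of_real tendsto_const tendsto_binom_weight t Mlim[unfolded L_def])
    fix h
    have Mle: "real (M h) \<le> (t / pi + 1) * (L h)\<^sup>2"
    proof -
      have "t * (L h)\<^sup>2 / pi \<ge> 0" using t by simp
      then have "real (M h) \<le> t * (L h)\<^sup>2 / pi + 1" unfolding M_def by linarith
      moreover have "(L h)\<^sup>2 \<ge> 1" by (simp add: L_def)
      ultimately show ?thesis by (simp add: algebra_simps)
    qed
    have Mpos: "real (M h) > 0" 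
      using Mge[of h] t Lpos[of h] by (smt (verit) divide_pos_pos mult_pos_pos pi_gt_zero zero_less_power)
    have "norm (g h k) = L h * binom_weight (M h) (int (2 * h + 1) * k)"
      using Lpos[of h] binom_weight_nonneg[of "M h" "int (2 * h + 1) * k"] by (simp add: g_def norm_mult)
    also have "\<dots> \<le> L h * (binom_weight (M h) 0 * exp (- (real_of_int (int (2 * h + 1) * k))\<^sup>2 / (2 * real (M h))))"
      using Lpos[of h] by (intro mult_left_mono binom_weight_le) auto
    also have "\<dots> = (L h * binom_weight (M h) 0) * exp (- ((L h * of_int k)\<^sup>2 / (2 * real (M h))))"
      by (simp add: L_def algebra_simps)
    also have "\<dots> \<le> B * exp (- c * (of_int k + 0)\<^sup>2)"
    proof (rule mult_mono)
      have "c * (of_int k)\<^sup>2 = (L h * of_int k)\<^sup>2 / (2 * ((t / pi + 1) * (L h)\<^sup>2))"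
        using Lpos[of h] by (simp add: c_def power_mult_distrib)
      also have "\<dots> \<le> (L h * of_int k)\<^sup>2 / (2 * real (M h))"
        using Mle Mpos by (intro divide_left_mono) auto
      finally show "exp (- ((L h * of_int k)\<^sup>2 / (2 * real (M h)))) \<le> exp (- c * (of_int k + 0)\<^sup>2)"
        by simp
      show "0 \<le> B" using B[of 0] Lpos[of 0] binom_weight_nonneg[of "M 0" 0]
        by (smt (verit) mult_nonneg_nonneg)
    qed (use B in auto)
    finally show "norm (g h k) \<le> B * exp (- c * (of_int k + 0)\<^sup>2)" .
  qed
  show ?thesis
    using LIMSEQ_unique[OF f_lim[unfolded fin] g_lim] .
qed

lemma gaussian_summable:
  fixes c :: real
  assumes "c > 0"
  shows "(\<lambda>k::int. exp (- c * (of_int k)\<^sup>2)) summable_on UNIV"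
  using gaussian_shift_summable[OF assms, of 0] by simp

text \<open>Both sides depend on \<open>a\<close> only modulo 1: on the left the summation index
  absorbs an integer, on the right the phase is unchanged. Subtracting the nearest integer reduces
  to |\<alpha>| \<le> 1/2.\<close>

theorem theta_transformation:
  fixes t a :: real
  assumes t: "t > 0"
  shows "(\<Sum>\<^sub>\<infinity>k::int. complex_of_real (exp (- pi * t * (of_int k + a)\<^sup>2)))
       = of_real (1 / sqrt t) * (\<Sum>\<^sub>\<infinity>k::int. complex_of_real (exp (- pi * (of_int k)\<^sup>2 / t)) * cis (2 * pi * k * a))"
proof -
  define r where "r = round a"
  define \<alpha> where "\<alpha> = a - of_int r"
  have \<alpha>: "\<bar>\<alpha>\<bar> \<le> 1 / 2" using of_int_round_abs_le[of a] by (simp add: \<alpha>_def r_def abs_minus_commute)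
  have "(\<Sum>\<^sub>\<infinity>k::int. complex_of_real (exp (- pi * t * (of_int k + a)\<^sup>2)))
      = (\<Sum>\<^sub>\<infinity>k::int. complex_of_real (exp (- pi * t * (of_int k + \<alpha>)\<^sup>2)))"
    by (rule infsum_reindex_bij_witness[of _ "\<lambda>k. k - r" "\<lambda>k. k + r"]) (auto simp: \<alpha>_def)
  also have "\<dots> = (\<Sum>\<^sub>\<infinity>k::int. complex_of_real (exp (- pi * (of_int k)\<^sup>2 / t) / sqrt t) * cis (2 * pi * k * \<alpha>))"
    by (rule theta_transformation_small[OF t \<alpha>])
  also have "\<dots> = (\<Sum>\<^sub>\<infinity>k::int. of_real (1 / sqrt t) * (complex_of_real (exp (- pi * (of_int k)\<^sup>2 / t)) * cis (2 * pi * k * a)))"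
  proof (rule infsum_cong)
    fix k :: int
    have "2 * pi * k * a = 2 * pi * k * \<alpha> + 2 * pi * of_int (k * r)" by (simp add: \<alpha>_def algebra_simps)
    then have "cis (2 * pi * k * a) = cis (2 * pi * k * \<alpha>) * cis (2 * pi * of_int (k * r))" by (simp only: cis_mult)
    also have "cis (2 * pi * of_int (k * r)) = 1" by (rule cis_multiple_2pi) auto
    finally show "complex_of_real (exp (- pi * (of_int k)\<^sup>2 / t) / sqrt t) * cis (2 * pi * k * \<alpha>)
      = of_real (1 / sqrt t) * (complex_of_real (exp (- pi * (of_int k)\<^sup>2 / t)) * cis (2 * pi * k * a))"
      by (simp add: field_simps)
  qed
  also have "\<dots> = of_real (1 / sqrt t) * (\<Sum>\<^sub>\<infinity>k::int. complex_of_real (exp (- pi * (of_int k)\<^sup>2 / t)) * cis (2 * pi * k * a))"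
    by (rule infsum_cmult_right')
  finally show ?thesis .
qed

section \<open>The nome q = exp (2 pi i z)\<close>

definition qexp :: "complex \<Rightarrow> complex" where
  "qexp z = exp (2 * of_real pi * \<i> * z)"

lemma qexp_add: "qexp (z + w) = qexp z * qexp w"
  by (simp add: qexp_def exp_add[symmetric] algebra_simps)

lemma qexp_of_int [simp]: "qexp (of_int n) = 1"
proof -
  have "2 * of_real pi * \<i> * of_int n = complex_of_real (2 * of_int n * pi) * \<i>" by simp
  then show ?thesis unfolding qexp_def using exp_integer_2pi[of "of_int n"] by (simp add: mult_ac)
qed

lemma qexp_0 [simp]: "qexp 0 = 1"
  by (simp add: qexp_def)

lemma qexp_nonzero [simp]: "qexp z \<noteq> 0"
  by (simp add: qexp_def)

lemma qexp_power: "qexp z ^ n = qexp (of_nat n * z)"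
  by (simp add: qexp_def exp_of_nat_mult[symmetric] algebra_simps)

lemma norm_qexp: "norm (qexp z) = exp (- 2 * pi * Im z)"
  by (simp add: qexp_def norm_exp_eq_Re)

lemma norm_qexp_less_1: "Im z > 0 \<Longrightarrow> norm (qexp z) < 1"
  by (simp add: norm_qexp)

lemma qexp_of_real: "qexp (of_real x) = cis (2 * pi * x)"
  by (simp add: qexp_def cis_conv_exp algebra_simps)

lemma has_field_derivative_qexp:
  "(qexp has_field_derivative 2 * of_real pi * \<i> * qexp z) (at z)"
  unfolding qexp_def[abs_def] by (auto intro!: derivative_eq_intros)

lemma holomorphic_on_qexp [holomorphic_intros]:
  "f holomorphic_on A \<Longrightarrow> (\<lambda>z. qexp (f z)) holomorphic_on A"
  unfolding qexp_def by (intro holomorphic_intros)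

section \<open>The Lipschitz formula in weight 6\<close>

text \<open>The series of n^j q^n, produced from the geometric series by the operator q d/dq. In the
  variable z this operator is differentiation divided by 2 pi i, so the recursion follows the
  successive derivatives of the cotangent.\<close>

fun power_geom :: "nat \<Rightarrow> complex fps" where
  "power_geom 0 = Abs_fps (\<lambda>_. 1)"
| "power_geom (Suc j) = fps_X * fps_deriv (power_geom j)"

lemma fps_nth_power_geom: "j > 0 \<Longrightarrow> fps_nth (power_geom j) n = of_nat n ^ j"
proof (induction j)
  case (Suc j)
  then show ?case by (cases n; cases "j = 0") (simp_all)
qed simp

lemma fps_conv_radius_power_geom: "fps_conv_radius (power_geom j) \<ge> 1"
proof (induction j)
  case 0
  have "conv_radius (\<lambda>n. 1 :: complex) = 1"
    by (rule conv_radius_ratio_limit[of 1]) auto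
  then show ?case by (simp add: fps_conv_radius_def)
next
  case (Suc j)
  have "1 \<le> min (fps_conv_radius (fps_X :: complex fps)) (fps_conv_radius (fps_deriv (power_geom j)))"
    using fps_conv_radius_deriv[of "power_geom j"] Suc by auto
  also have "\<dots> \<le> fps_conv_radius (power_geom (Suc j))"
    using fps_conv_radius_mult[of fps_X "fps_deriv (power_geom j)"] by simp
  finally show ?case .
qed

lemma fps_conv_radius_gt:
  "fps_conv_radius F \<ge> 1 \<Longrightarrow> norm z < 1 \<Longrightarrow> ereal (norm z) < fps_conv_radius F"
  by (metis ereal_less(3) less_le_trans one_ereal_def ereal_less_eq(3) order_less_le_trans less_ereal.simps(1))

lemma eval_power_geom_0:
  assumes "norm w < 1"
  shows "eval_fps (power_geom 0) w = 1 / (1 - w)"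
  using suminf_geometric[OF assms] by (simp add: eval_fps_def)

lemma has_field_derivative_power_geom_qexp:
  assumes "Im z > 0"
  shows "((\<lambda>z. eval_fps (power_geom j) (qexp z)) has_field_derivative
     2 * of_real pi * \<i> * eval_fps (power_geom (Suc j)) (qexp z)) (at z)"
proof -
  have n: "ereal (norm (qexp z)) < fps_conv_radius (power_geom i)" for i
    by (intro fps_conv_radius_gt fps_conv_radius_power_geom norm_qexp_less_1 assms)
  have n': "ereal (norm (qexp z)) < fps_conv_radius (fps_deriv (power_geom j))"
    by (rule less_le_trans[OF n fps_conv_radius_deriv])
  have "((\<lambda>z. eval_fps (power_geom j) (qexp z)) has_field_derivative
     eval_fps (fps_deriv (power_geom j)) (qexp z) * (2 * of_real pi * \<i> * qexp z)) (at z)"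
    by (rule DERIV_chain2[OF has_field_derivative_eval_fps[OF n] has_field_derivative_qexp])
  moreover have "eval_fps (power_geom (Suc j)) (qexp z) = qexp z * eval_fps (fps_deriv (power_geom j)) (qexp z)"
    using eval_fps_mult[of "qexp z" fps_X "fps_deriv (power_geom j)"] n' by simp
  ultimately show ?thesis by (simp add: algebra_simps)
qed

section \<open>Derivatives of the cotangent through polygamma functions\<close>

lemma Digamma_reflection:
  fixes z :: complex
  assumes z: "z \<notin> \<int>"
  shows "Digamma (1 - z) - Digamma z = of_real pi * cot (of_real pi * z)"
proof -
  have z1: "z \<notin> \<int>\<^sub>\<le>\<^sub>0" "1 - z \<notin> \<int>\<^sub>\<le>\<^sub>0"
    using z nonpos_Ints_subset_Ints Ints_diff[of 1 "1 - z"] by auto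
  have s: "sin (of_real pi * z) \<noteq> 0"
  proof
    assume "sin (of_real pi * z) = 0"
    then obtain n :: int where "of_real pi * z = of_real (of_int n * pi)"
      using Complex_Transcendental.sin_eq_0 by auto
    then have "z = of_int n" by simp
    then show False using z by simp
  qed
  \<comment> \<open>Both sides of the reflection formula for Gamma are differentiated; dividing by
    the formula itself leaves the logarithmic derivative, which is the claim.\<close>
  have d1: "((\<lambda>z. Gamma z * Gamma (1 - z)) has_field_derivative
     Gamma z * Digamma z * Gamma (1 - z) - Gamma z * (Gamma (1 - z) * Digamma (1 - z))) (at z)"
    using z1 by (auto intro!: derivative_eq_intros)
  have d2: "((\<lambda>z. of_real pi / sin (of_real pi * z)) has_field_derivative
     - (of_real pi * (of_real pi * cos (of_real pi * z))) / (sin (of_real pi * z))\<^sup>2) (at z)"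
    using s by (auto intro!: derivative_eq_intros simp: power2_eq_square)
  have "(\<lambda>z::complex. Gamma z * Gamma (1 - z)) = (\<lambda>z. of_real pi / sin (of_real pi * z))"
    by (rule ext) (rule Gamma_reflection_complex)
  with d2 have d3: "((\<lambda>z. Gamma z * Gamma (1 - z)) has_field_derivative
     - (of_real pi * (of_real pi * cos (of_real pi * z))) / (sin (of_real pi * z))\<^sup>2) (at z)"
    by simp
  have "Gamma z * Digamma z * Gamma (1 - z) - Gamma z * (Gamma (1 - z) * Digamma (1 - z))
      = - (Gamma z * Gamma (1 - z)) * (Digamma (1 - z) - Digamma z)"
    by (simp add: algebra_simps)
  with DERIV_unique[OF d1 d3] have "- (Gamma z * Gamma (1 - z)) * (Digamma (1 - z) - Digamma z)
     = - (of_real pi * (of_real pi * cos (of_real pi * z))) / (sin (of_real pi * z))\<^sup>2" by simp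
  then have "(of_real pi / sin (of_real pi * z)) * (Digamma (1 - z) - Digamma z)
     = (of_real pi / sin (of_real pi * z)) * (of_real pi * cot (of_real pi * z))"
    unfolding Gamma_reflection_complex by (simp add: cot_def power2_eq_square)
  moreover have "of_real pi / sin (of_real pi * z) \<noteq> 0" using s by simp
  ultimately show ?thesis by (metis mult_left_cancel)
qed

text \<open>Off the integers this is the n-th derivative of pi * cot (pi * z), the sign (-1)^n
  coming from the inner function 1 - z. It links the partial fraction series, contained in
  \<open>Polygamma\<close>, with closed forms for the cotangent.\<close>

definition reflected_polygamma :: "nat \<Rightarrow> complex \<Rightarrow> complex" where
  "reflected_polygamma n z = (-1) ^ n * Polygamma n (1 - z) - Polygamma n z"

lemma has_field_derivative_reflected_polygamma:
  assumes "z \<notin> \<int>"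
  shows "(reflected_polygamma n has_field_derivative reflected_polygamma (Suc n) z) (at z)"
proof -
  have z1: "z \<notin> \<int>\<^sub>\<le>\<^sub>0" "1 - z \<notin> \<int>\<^sub>\<le>\<^sub>0"
    using assms nonpos_Ints_subset_Ints Ints_diff[of 1 "1 - z"] by auto
  show ?thesis
    unfolding reflected_polygamma_def[abs_def] using z1
    by (auto intro!: derivative_eq_intros)
qed

text \<open>An identity on an open set away from the integers may be differentiated. This is the
  induction step for both closed forms: a q-series on the upper half-plane and a polynomial in the
  cotangent off the integers.\<close>

lemma reflected_polygamma_Suc_eq:
  assumes "open S" "S \<inter> \<int> = {}" "z \<in> S"
    and "\<And>w. w \<in> S \<Longrightarrow> reflected_polygamma n w = g w"
    and "(g has_field_derivative g') (at z)"
  shows "reflected_polygamma (Suc n) z = g'"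
proof -
  have "(g has_field_derivative reflected_polygamma (Suc n) z) (at z)"
    by (rule has_field_derivative_transform_within_open[OF has_field_derivative_reflected_polygamma \<open>open S\<close> \<open>z \<in> S\<close>])
       (use assms in auto)
  then show ?thesis using assms(5) DERIV_unique by blast
qed

text \<open>The two polygamma series run over n \<ge> 0 and, through 1 - z, over n \<le> -1; the
  even power 6 removes the sign. The 120 is 5!.\<close>

lemma sum_inverse_power6_reflected:
  assumes z: "z \<notin> \<int>"
  shows "((\<lambda>n::int. 1 / (z + of_int n) ^ 6) has_sum - reflected_polygamma 5 z / 120) UNIV"
proof -
  have nz: "z \<noteq> 0" "1 - z \<noteq> 0" using z by (auto simp: algebra_simps)
  have ps: "((\<lambda>k. inverse ((w + of_nat k) ^ 6)) has_sum Polygamma 5 w / 120) UNIV" if "w \<noteq> 0" for w :: complex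
  proof -
    have s: "summable (\<lambda>k. norm (inverse ((w + of_nat k) ^ 6)))"
    proof (rule summable_comparison_test_ev)
      show "summable (\<lambda>k. inverse (real k / 2) ^ 6)"
        using summable_mult[OF inverse_power_summable[of 6, where ?'a = real], of "2 ^ 6"]
        by (simp add: power_divide field_simps)
      show "\<forall>\<^sub>F k in sequentially. norm (norm (inverse ((w + of_nat k) ^ 6))) \<le> inverse (real k / 2) ^ 6"
        using eventually_gt_at_top[of "nat \<lceil>2 * norm w\<rceil>"]
      proof eventually_elim
        case (elim k)
        then have k: "real k > 2 * norm w" by linarith
        have "norm (of_nat k :: complex) - norm w \<le> norm (of_nat k + w)" by (rule norm_diff_ineq)
        then have "norm (w + of_nat k) \<ge> real k / 2" using k by (simp add: add.commute)
        moreover have "real k > 0" using k norm_ge_zero[of w] by linarith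
        ultimately have "inverse (norm (w + of_nat k)) \<le> inverse (real k / 2)" by (intro le_imp_inverse_le) auto
        then have "inverse (norm (w + of_nat k)) ^ 6 \<le> inverse (real k / 2) ^ 6" by (intro power_mono) auto
        then show ?case by (simp add: norm_inverse norm_power power_inverse)
      qed
    qed
    have "(\<lambda>k. inverse ((w + of_nat k) ^ 6)) sums (Polygamma 5 w / 120)"
      using summable_sums[OF summable_norm_cancel[OF s]] by (simp add: Polygamma_def fact_numeral)
    with s show ?thesis by (rule norm_summable_imp_has_sum)
  qed
  have "((\<lambda>n::int. 1 / (z + of_int n) ^ 6) has_sum Polygamma 5 z / 120) (range int)"
    by (subst has_sum_reindex) (use ps[OF nz(1)] in \<open>auto simp: o_def inverse_eq_divide\<close>)
  moreover have "((\<lambda>n::int. 1 / (z + of_int n) ^ 6) has_sum Polygamma 5 (1 - z) / 120) (range (\<lambda>k. - 1 - int k))"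
  proof (subst has_sum_reindex)
    have "(z + of_int (- 1 - int k)) ^ 6 = (1 - z + of_nat k) ^ 6" for k
    proof -
      have "z + of_int (- 1 - int k) = - (1 - z + of_nat k)" by simp
      then show ?thesis by (simp only: power_minus_even[of 6] even_numeral) 
    qed
    then show "((\<lambda>n::int. 1 / (z + of_int n) ^ 6) \<circ> (\<lambda>k. - 1 - int k) has_sum Polygamma 5 (1 - z) / 120) UNIV"
      using ps[OF nz(2)] by (simp add: o_def inverse_eq_divide)
  qed (auto simp: inj_on_def)
  moreover have "range int \<inter> range (\<lambda>k. - 1 - int k) = {}" by auto
  ultimately have "((\<lambda>n::int. 1 / (z + of_int n) ^ 6) has_sum Polygamma 5 z / 120 + Polygamma 5 (1 - z) / 120)
     (range int \<union> range (\<lambda>k. - 1 - int k))"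
    by (rule has_sum_Un_disjoint)
  moreover have "n \<in> range int \<union> range (\<lambda>k. - 1 - int k)" for n
  proof (cases "n \<ge> 0")
    case True then show ?thesis using nonneg_int_cases by blast
  next
    case False
    then have "n = - 1 - int (nat (- 1 - n))" by simp
    then show ?thesis by blast
  qed
  then have "range int \<union> range (\<lambda>k. - 1 - int k) = UNIV" by blast
  moreover have "Polygamma 5 z / 120 + Polygamma 5 (1 - z) / 120 = - reflected_polygamma 5 z / 120"
    by (simp add: reflected_polygamma_def field_simps)
  ultimately show ?thesis by simp
qed

lemma Im_pos_not_Ints: "Im z > 0 \<Longrightarrow> z \<notin> \<int>"
  by (auto elim!: Ints_cases)

lemma open_upper_half: "open {z. Im z > 0}"
  using open_halfspace_Im_gt[of 0] by simp

lemma cot_pi_eq_geometric: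
  assumes "Im z > 0"
  shows "of_real pi * cot (of_real pi * z) = \<i> * of_real pi - 2 * of_real pi * \<i> * eval_fps (power_geom 0) (qexp z)"
proof -
  define E where "E = exp (\<i> * (of_real pi * z))"
  have E0: "E \<noteq> 0" by (simp add: E_def)
  have q: "qexp z = E * E" by (simp add: qexp_def E_def exp_add[symmetric] algebra_simps)
  have q1: "1 - E * E \<noteq> 0" using norm_qexp_less_1[OF assms] unfolding q by (metis eq_iff_diff_eq_0 less_irrefl norm_one)
  have minus: "exp (- (\<i> * (of_real pi * z))) = 1 / E" by (simp add: E_def exp_minus inverse_eq_divide)
  have "cos (of_real pi * z) = (E + 1 / E) / 2"
    using minus by (simp add: cos_exp_eq E_def)
  moreover have "sin (of_real pi * z) = (E - 1 / E) / (2 * \<i>)"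
    using minus by (simp add: sin_exp_eq E_def)
  ultimately have "cot (of_real pi * z) = ((E + 1 / E) / 2) / ((E - 1 / E) / (2 * \<i>))"
    by (simp only: cot_def)
  also have "(E + 1 / E) / 2 = (1 + E * E) / (2 * E)" using E0 by (simp add: field_simps)
  also have "(E - 1 / E) / (2 * \<i>) = - (1 - E * E) / (2 * \<i> * E)" using E0 by (simp add: field_simps)
  also have "((1 + E * E) / (2 * E)) / (- (1 - E * E) / (2 * \<i> * E)) = - \<i> * ((1 + E * E) / (1 - E * E))"
    using E0 q1 by (simp add: divide_simps) (simp add: algebra_simps)
  also have "(1 + E * E) / (1 - E * E) = 2 / (1 - E * E) - 1"
    using q1 by (simp add: field_simps)
  finally have "cot (of_real pi * z) = - \<i> * (2 / (1 - E * E) - 1)" .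
  moreover have "eval_fps (power_geom 0) (qexp z) = 1 / (1 - E * E)"
    using eval_power_geom_0[OF norm_qexp_less_1[OF assms]] unfolding q .
  ultimately show ?thesis by (simp only:) (simp add: algebra_simps)
qed

text \<open>The index starts at 1 because pi * cot (pi * z) itself has the additional constant i *
  pi, which the first derivative removes. Every derivative contributes one factor 2 pi i.\<close>

lemma reflected_polygamma_qexp:
  assumes "Im z > 0"
  shows "reflected_polygamma (Suc n) z = - ((2 * of_real pi * \<i>) ^ (n + 2)) * eval_fps (power_geom (Suc n)) (qexp z)"
  using assms
proof (induction n arbitrary: z)
  case 0
  show ?case
  proof (rule reflected_polygamma_Suc_eq[OF open_upper_half, where n = 0])
    show "reflected_polygamma 0 w = \<i> * of_real pi - 2 * of_real pi * \<i> * eval_fps (power_geom 0) (qexp w)" if "w \<in> {z. Im z > 0}" for w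
      using that Digamma_reflection[of w] cot_pi_eq_geometric[of w] Im_pos_not_Ints[of w] by (simp add: reflected_polygamma_def)
    show "((\<lambda>w. \<i> * of_real pi - 2 * of_real pi * \<i> * eval_fps (power_geom 0) (qexp w)) has_field_derivative
        - ((2 * of_real pi * \<i>) ^ (0 + 2)) * eval_fps (power_geom (Suc 0)) (qexp z)) (at z)"
      by (rule derivative_eq_intros has_field_derivative_power_geom_qexp 0 refl)+ (simp add: power2_eq_square)
  qed (use 0 Im_pos_not_Ints in auto)
next
  case (Suc n)
  show ?case
  proof (rule reflected_polygamma_Suc_eq[OF open_upper_half, where n = "Suc n"])
    show "reflected_polygamma (Suc n) w = - ((2 * of_real pi * \<i>) ^ (n + 2)) * eval_fps (power_geom (Suc n)) (qexp w)" if "w \<in> {z. Im z > 0}" for w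
      using that Suc.IH by simp
    show "((\<lambda>w. - ((2 * of_real pi * \<i>) ^ (n + 2)) * eval_fps (power_geom (Suc n)) (qexp w)) has_field_derivative
        - ((2 * of_real pi * \<i>) ^ (Suc n + 2)) * eval_fps (power_geom (Suc (Suc n))) (qexp z)) (at z)"
      using DERIV_cmult[OF has_field_derivative_power_geom_qexp[OF Suc.prems, of "Suc n"], of "- ((2 * of_real pi * \<i>) ^ (n + 2))"]
      by (simp add: mult_ac del: power_geom.simps)
  qed (use Suc.prems Im_pos_not_Ints in auto)
qed

text \<open>The constant is (2 pi i)^6 / 5! = - 8 pi^6 / 15.\<close>

lemma lipschitz_6:
  assumes "Im z > 0"
  shows "((\<lambda>n::int. 1 / (z + of_int n) ^ 6) has_sum
    - (8 * of_real pi ^ 6 / 15) * eval_fps (power_geom 5) (qexp z)) UNIV"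
proof -
  have "- reflected_polygamma 5 z / 120 = - (8 * of_real pi ^ 6 / 15) * eval_fps (power_geom 5) (qexp z)"
    using reflected_polygamma_qexp[OF assms, of 4]
    by (simp add: power_mult_distrib numeral_eq_Suc del: power_geom.simps)
  then show ?thesis using sum_inverse_power6_reflected[OF Im_pos_not_Ints[OF assms]] by (simp only:)
qed

text \<open>Since C = cot (pi * z) has derivative - pi * (1 + C^2), the n-th derivative of pi * C is
  pi^(n+1) times a polynomial in C, which obeys this recursion.\<close>

fun cot_deriv_poly :: "nat \<Rightarrow> complex poly" where
  "cot_deriv_poly 0 = [:0, 1:]"
| "cot_deriv_poly (Suc n) = - (pderiv (cot_deriv_poly n) * [:1, 0, 1:])"

text \<open>At 1/2 the cotangent vanishes, so the value is pi^6 times the constant term of the fifth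
  polynomial. It evaluates the sum over the odd integers and thereby zeta (6).\<close>

lemma reflected_polygamma_half: "reflected_polygamma 5 (1 / 2) = - 16 * of_real pi ^ 6"
proof -
  define p where "p = complex_of_real pi"
  define C where "C = (\<lambda>z. cot (p * z))"
  define S where "S = - (\<int> :: complex set)"
  have S: "open S" "S \<inter> \<int> = {}" by (auto simp: S_def closed_Ints)
  have dC: "(C has_field_derivative - p * (1 + (C z)\<^sup>2)) (at z)" if "z \<in> S" for z
  proof -
    have s: "sin (p * z) \<noteq> 0"
    proof
      assume "sin (p * z) = 0"
      then obtain n :: int where "p * z = of_real (of_int n * pi)"
        using Complex_Transcendental.sin_eq_0 by (auto simp: p_def)
      then have "z = of_int n" by (simp add: p_def)
      then show False using that by (simp add: S_def)
    qed
    have "(C has_field_derivative - inverse ((sin (p * z))\<^sup>2) * p) (at z)"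
      unfolding C_def by (rule DERIV_chain2[OF DERIV_cot]) (auto intro!: derivative_eq_intros simp: s)
    moreover have "- inverse ((sin (p * z))\<^sup>2) * p = - p * (1 + (C z)\<^sup>2)"
    proof -
      have "inverse ((sin (p * z))\<^sup>2) = 1 + (C z)\<^sup>2"
        using s sin_cos_squared_add[of "p * z"]
        by (simp add: C_def cot_def power_divide field_simps)
      then show ?thesis by (simp add: algebra_simps)
    qed
    ultimately show ?thesis by (simp only:)
  qed
  have r: "\<forall>z\<in>S. reflected_polygamma n z = p ^ Suc n * poly (cot_deriv_poly n) (C z)" for n
  proof (induction n)
    case 0
    show ?case using Digamma_reflection by (simp add: reflected_polygamma_def S_def C_def p_def)
  next
    case (Suc n)
    show ?case
    proof
      fix z assume z: "z \<in> S"
      show "reflected_polygamma (Suc n) z = p ^ Suc (Suc n) * poly (cot_deriv_poly (Suc n)) (C z)"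
      proof (rule reflected_polygamma_Suc_eq[OF S z])
        show "reflected_polygamma n w = p ^ Suc n * poly (cot_deriv_poly n) (C w)" if "w \<in> S" for w
          using Suc that by blast
        have "((\<lambda>w. p ^ Suc n * poly (cot_deriv_poly n) (C w)) has_field_derivative
          p ^ Suc n * (poly (pderiv (cot_deriv_poly n)) (C z) * (- p * (1 + (C z)\<^sup>2)))) (at z)"
          by (intro DERIV_cmult DERIV_chain2[OF poly_DERIV dC[OF z]])
        moreover have "p ^ Suc n * (poly (pderiv (cot_deriv_poly n)) (C z) * (- p * (1 + (C z)\<^sup>2)))
           = p ^ Suc (Suc n) * poly (cot_deriv_poly (Suc n)) (C z)"
          by (simp add: power2_eq_square algebra_simps)
        ultimately show "((\<lambda>w. p ^ Suc n * poly (cot_deriv_poly n) (C w)) has_field_derivative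
           p ^ Suc (Suc n) * poly (cot_deriv_poly (Suc n)) (C z)) (at z)" by (simp only:)
      qed
    qed
  qed
  have half: "1 / 2 \<in> S"
    using fraction_not_in_Ints[of 2 1, where ?'a = complex] by (simp add: S_def)
  have "cos (p * (1 / 2)) = complex_of_real (cos (pi / 2))" unfolding p_def cos_of_real[symmetric] by simp
  then have "C (1 / 2) = 0" by (simp add: C_def cot_def)
  moreover have "poly (cot_deriv_poly 5) (0 :: complex) = - 16"
  proof -
    have "cot_deriv_poly 1 = [:-1, 0, -1:]" by (simp add: pderiv_pCons)
    then have "cot_deriv_poly 2 = [:0, 2, 0, 2:]"
      unfolding Suc_1[symmetric] cot_deriv_poly.simps(2)[of 1] by (simp add: pderiv_pCons)
    then have "cot_deriv_poly 3 = [:-2, 0, -8, 0, -6:]"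
      using cot_deriv_poly.simps(2)[of 2] by (simp add: pderiv_pCons)
    then have "cot_deriv_poly 4 = [:0, 16, 0, 40, 0, 24:]"
      using cot_deriv_poly.simps(2)[of 3] by (simp add: pderiv_pCons)
    then have "cot_deriv_poly 5 = [:-16, 0, -136, 0, -240, 0, -120:]"
      using cot_deriv_poly.simps(2)[of 4] by (simp add: pderiv_pCons)
    then show ?thesis by simp
  qed
  ultimately show ?thesis using r[of 5] half by (simp add: p_def)
qed

text \<open>The value is 2 * zeta (6), the term at n = 0 being 1 / 0 = 0. Taking z = 1/2 in the
  partial fraction series gives the odd integers, up to a factor 64, and the even integers reproduce
  the total divided by 64, which leaves a linear equation for the total.\<close>

lemma sum_inverse_power6_ints: "((\<lambda>n::int. 1 / (of_int n :: complex) ^ 6) has_sum 2 * of_real pi ^ 6 / 945) UNIV"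
proof -
  have odd: "((\<lambda>n::int. 1 / (of_int (2 * n + 1) :: complex) ^ 6) has_sum of_real pi ^ 6 / 480) UNIV"
  proof -
    have "((\<lambda>n::int. 1 / (1 / 2 + of_int n) ^ 6) has_sum 2 * complex_of_real pi ^ 6 / 15) UNIV"
      using sum_inverse_power6_reflected[OF fraction_not_in_Ints[of 2 1, where ?'a = complex]] reflected_polygamma_half
      by simp
    from has_sum_cmult_right[OF this, of "1 / 64"]
    have "((\<lambda>n::int. 1 / 64 * (1 / (1 / 2 + of_int n) ^ 6)) has_sum complex_of_real pi ^ 6 / 480) UNIV" by simp
    moreover have "1 / 64 * (1 / (1 / 2 + of_int n) ^ 6) = 1 / (of_int (2 * n + 1) :: complex) ^ 6" for n
    proof -
      have "(of_int (2 * n + 1) :: complex) = 2 * (1 / 2 + of_int n)" by simp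
      then show ?thesis by (simp only: power_mult_distrib) simp
    qed
    ultimately show ?thesis by (simp only:)
  qed
  have nn: "(\<lambda>n::int. norm (1 / (of_int n :: complex) ^ 6)) summable_on UNIV"
  proof -
    have s: "(\<lambda>n::nat. 1 / real n ^ 6) summable_on UNIV"
      using inverse_power_summable[of 6, where ?'a = real]
      by (intro norm_summable_imp_summable_on) (simp add: inverse_eq_divide)
    then show ?thesis
      by (intro summable_on_intI) (simp_all add: norm_divide norm_power)
  qed
  define Z where "Z = infsum (\<lambda>n::int. 1 / (of_int n :: complex) ^ 6) UNIV"
  have Z: "((\<lambda>n::int. 1 / (of_int n :: complex) ^ 6) has_sum Z) UNIV"
    unfolding Z_def by (rule has_sum_infsum[OF abs_summable_summable[OF nn]])
  have even: "((\<lambda>n::int. 1 / (of_int n :: complex) ^ 6) has_sum Z / 64) (range (\<lambda>n. 2 * n))"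
    by (subst has_sum_reindex)
       (use has_sum_cmult_right[OF Z, of "1/64"] in \<open>auto simp: o_def inj_on_def power_mult_distrib field_simps\<close>)
  have odd': "((\<lambda>n::int. 1 / (of_int n :: complex) ^ 6) has_sum of_real pi ^ 6 / 480) (range (\<lambda>n. 2 * n + 1))"
    by (subst has_sum_reindex) (use odd in \<open>auto simp: o_def inj_on_def\<close>)
  have disj: "range (\<lambda>n::int. 2 * n) \<inter> range (\<lambda>n. 2 * n + 1) = {}"
  proof -
    have "2 * a \<noteq> 2 * b + 1" for a b :: int by presburger
    then show ?thesis by blast
  qed
  have un: "range (\<lambda>n::int. 2 * n) \<union> range (\<lambda>n. 2 * n + 1) = UNIV"
  proof -
    have "k = 2 * (k div 2) \<or> k = 2 * (k div 2) + 1" for k :: int by presburger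
    then have "k \<in> range (\<lambda>n::int. 2 * n) \<union> range (\<lambda>n. 2 * n + 1)" for k by blast
    then show ?thesis by blast
  qed
  have "((\<lambda>n::int. 1 / (of_int n :: complex) ^ 6) has_sum Z / 64 + of_real pi ^ 6 / 480) UNIV"
    using has_sum_Un_disjoint[OF even odd' disj] unfolding un .
  with Z have "Z = Z / 64 + of_real pi ^ 6 / 480" by (rule has_sum_unique)
  then have "Z = 2 * of_real pi ^ 6 / 945" by (simp add: field_simps)
  with Z show ?thesis by (simp only:)
qed

section \<open>The Eisenstein series of weight 6\<close>

definition cfps :: "int fps \<Rightarrow> complex fps" where
  "cfps F = Abs_fps (\<lambda>n. of_int (fps_nth F n))"

lemma fps_nth_cfps [simp]: "fps_nth (cfps F) n = of_int (fps_nth F n)"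
  by (simp add: cfps_def)

lemma cfps_1 [simp]: "cfps 1 = 1"
  by (simp add: fps_eq_iff)

lemma cfps_mult: "cfps (F * G) = cfps F * cfps G"
  by (simp add: fps_eq_iff fps_mult_nth)

lemma cfps_power: "cfps (F ^ n) = cfps F ^ n"
  by (induction n) (simp_all add: cfps_mult)

lemma has_sum_eval_fps:
  fixes F :: "complex fps"
  assumes "ereal (norm z) < fps_conv_radius F"
  shows "((\<lambda>n. fps_nth F n * z ^ n) has_sum eval_fps F z) UNIV"
  by (rule norm_summable_imp_has_sum[OF norm_summable_fps sums_eval_fps]) (use assms in auto)

section \<open>Lattice sums and Lambert series\<close>

lemma summable_on_Times_product:
  fixes u :: "'a \<Rightarrow> real" and v :: "'b \<Rightarrow> real"
  assumes "u summable_on A" "v summable_on B" "\<And>x. u x \<ge> 0" "\<And>y. v y \<ge> 0"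
  shows "(\<lambda>(x, y). u x * v y) summable_on A \<times> B"
proof (rule summable_on_SigmaI[where g = "\<lambda>x. u x * infsum v B"])
  show "((\<lambda>y. case (x, y) of (x, y) \<Rightarrow> u x * v y) has_sum u x * infsum v B) B" for x
    by (auto intro!: has_sum_cmult_right has_sum_infsum assms)
  show "(\<lambda>x. u x * infsum v B) summable_on A"
    by (intro summable_on_cmult_left assms)
qed (use assms in auto)

text \<open>|m \<tau> + n|^2 is a positive definite quadratic form in (m, n), hence it bounds m^2 +
  n^2 up to a constant. The explicit constant comes from n^2 \<le> 2 (m x + n)^2 + 2 (m x)^2 with x
  = Re \<tau>.\<close>

lemma lattice_norm_bound:
  assumes "Im \<tau> > 0"
  obtains K where "K > 0" "\<And>m n :: int. real_of_int m ^ 2 + real_of_int n ^ 2 \<le> K * norm (of_int m * \<tau> + of_int n) ^ 2"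
proof
  define x y where "x = Re \<tau>" and "y = Im \<tau>"
  have y: "y > 0" using assms by (simp add: y_def)
  show "2 + (1 + 2 * x\<^sup>2) / y\<^sup>2 > 0"
    using y by (intro add_pos_nonneg) auto
  fix m n :: int
  define a b where "a = real_of_int m" and "b = real_of_int n"
  have N: "norm (of_int m * \<tau> + of_int n) ^ 2 = (a * x + b)\<^sup>2 + a\<^sup>2 * y\<^sup>2"
    by (simp add: cmod_power2 x_def y_def a_def b_def power_mult_distrib)
  have "0 \<le> (2 * (a * x) + b)\<^sup>2" by simp
  then have "b\<^sup>2 \<le> 2 * (a * x + b)\<^sup>2 + 2 * (a * x)\<^sup>2"
    by (simp add: power2_eq_square algebra_simps)
  then have "a\<^sup>2 + b\<^sup>2 \<le> 2 * (a * x + b)\<^sup>2 + (1 + 2 * x\<^sup>2) * a\<^sup>2"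
    by (simp add: power_mult_distrib algebra_simps)
  also have "(1 + 2 * x\<^sup>2) * a\<^sup>2 = ((1 + 2 * x\<^sup>2) / y\<^sup>2) * (a\<^sup>2 * y\<^sup>2)"
    using y by simp
  also have "2 * (a * x + b)\<^sup>2 + \<dots> \<le> (2 + (1 + 2 * x\<^sup>2) / y\<^sup>2) * (a * x + b)\<^sup>2 + (2 + (1 + 2 * x\<^sup>2) / y\<^sup>2) * (a\<^sup>2 * y\<^sup>2)"
    by (intro add_mono mult_right_mono) auto
  finally show "real_of_int m ^ 2 + real_of_int n ^ 2 \<le> (2 + (1 + 2 * x\<^sup>2) / y\<^sup>2) * norm (of_int m * \<tau> + of_int n) ^ 2"
    unfolding N a_def[symmetric] b_def[symmetric] by (simp add: distrib_left)
qed

text \<open>The double series is compared with a product of two convergent series of 1 / (1 + n^2).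
  Away from the origin m^2 + n^2 \<ge> 1, so (1 + m^2)(1 + n^2) \<le> 4 (m^2 + n^2)^3, and the norm
  bound turns the cube into the sixth power of |m \<tau> + n|.\<close>

lemma lattice_abs_summable:
  assumes "Im \<tau> > 0"
  shows "(\<lambda>(m::int, n::int). norm (1 / (of_int m * \<tau> + of_int n) ^ 6)) summable_on UNIV"
proof -
  obtain K where K: "K > 0" "\<And>m n :: int. real_of_int m ^ 2 + real_of_int n ^ 2 \<le> K * norm (of_int m * \<tau> + of_int n) ^ 2"
    using lattice_norm_bound[OF assms] by metis
  define u where "u = (\<lambda>n::int. 1 / (1 + (real_of_int n)\<^sup>2))"
  have s: "(\<lambda>n::nat. 1 / (1 + (real n)\<^sup>2)) summable_on UNIV"
  proof (rule norm_summable_imp_summable_on)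
    show "summable (\<lambda>n::nat. norm (1 / (1 + (real n)\<^sup>2)))"
    proof (rule summable_comparison_test_ev)
      show "\<forall>\<^sub>F n in sequentially. norm (norm (1 / (1 + (real n)\<^sup>2))) \<le> inverse ((real n) ^ 2)"
        using eventually_gt_at_top[of 0] by eventually_elim (auto simp: inverse_eq_divide intro!: divide_left_mono mult_pos_pos add_pos_nonneg)
      show "summable (\<lambda>n. inverse ((real n) ^ 2))" by (rule inverse_power_summable) simp
    qed
  qed
  have u: "u summable_on UNIV" unfolding u_def by (rule summable_on_intI) (use s in auto)
  have prod: "(\<lambda>(m, n). (4 * K ^ 3 * u m) * u n) summable_on UNIV \<times> UNIV"
    by (rule summable_on_Times_product[OF summable_on_cmult_right[OF u] u]) (use K in \<open>auto simp: u_def\<close>)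
  show ?thesis
  proof (rule summable_on_comparison_test[of "\<lambda>(m, n). (4 * K ^ 3 * u m) * u n"])
    show "(\<lambda>(m, n). (4 * K ^ 3 * u m) * u n) summable_on UNIV" using prod by simp
    fix p :: "int \<times> int"
    obtain m n where p: "p = (m, n)" by (cases p)
    define N where "N = norm (of_int m * \<tau> + of_int n)"
    define a b where "a = (real_of_int m)\<^sup>2" and "b = (real_of_int n)\<^sup>2"
    have "1 / N ^ 6 \<le> 4 * K ^ 3 * (1 / (1 + a)) * (1 / (1 + b))"
    proof (cases "m = 0 \<and> n = 0")
      case True
      then show ?thesis using K by (simp add: N_def a_def b_def)
    next
      case False
      then have "m\<^sup>2 + n\<^sup>2 > 0" by (simp add: sum_power2_gt_zero_iff)
      then have "m\<^sup>2 + n\<^sup>2 \<ge> 1" by linarith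
      then have ab: "a + b \<ge> 1" unfolding a_def b_def by (metis of_int_1_le_iff of_int_add of_int_power)
      have ge0: "a \<ge> 0" "b \<ge> 0" by (auto simp: a_def b_def)
      have Nab: "a + b \<le> K * N ^ 2" using K(2)[of m n] by (simp add: a_def b_def N_def)
      have Npos: "N > 0" using Nab ab by (auto simp: N_def)
      have "(1 + a) * (1 + b) \<le> (2 * (a + b)) * (2 * (a + b))"
        using ab ge0 by (intro mult_mono) auto
      also have "\<dots> = 4 * ((a + b)\<^sup>2 * 1)" by (simp add: power2_eq_square algebra_simps)
      also have "\<dots> \<le> 4 * ((a + b)\<^sup>2 * (a + b))"
        using ab by (intro mult_left_mono) auto
      also have "\<dots> = 4 * (a + b) ^ 3" by (simp add: power2_eq_square power3_eq_cube)
      also have "\<dots> \<le> 4 * (K * N ^ 2) ^ 3"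
        using Nab ab by (intro mult_left_mono power_mono) auto
      also have "\<dots> = 4 * K ^ 3 * N ^ 6" by (simp add: power_mult_distrib power_mult[symmetric])
      finally have "((1 + a) * (1 + b)) / N ^ 6 \<le> 4 * K ^ 3"
        using Npos by (subst pos_divide_le_eq) auto
      moreover have Y: "(1 + a) * (1 + b) > 0" using ge0 by (intro mult_pos_pos) auto
      ultimately have "((1 + a) * (1 + b)) / N ^ 6 / ((1 + a) * (1 + b)) \<le> 4 * K ^ 3 / ((1 + a) * (1 + b))"
        by (intro divide_right_mono) auto
      also have "((1 + a) * (1 + b)) / N ^ 6 / ((1 + a) * (1 + b)) = 1 / N ^ 6"
        using Y by (simp only: divide_divide_eq_left mult.commute[of "N ^ 6"]) (metis div_by_1 less_irrefl mult.right_neutral mult_divide_mult_cancel_left)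
      finally show ?thesis by simp
    qed
    then show "(case p of (m, n) \<Rightarrow> norm (1 / (of_int m * \<tau> + of_int n) ^ 6)) \<le> (case p of (m, n) \<Rightarrow> (4 * K ^ 3 * u m) * u n)"
      by (simp add: p u_def N_def a_def b_def norm_divide norm_power)
    show "0 \<le> (case p of (m, n) \<Rightarrow> norm (1 / (of_int m * \<tau> + of_int n) ^ 6))" by (simp add: p)
  qed
qed

text \<open>The Eisenstein series G_6. Summing over all pairs includes the origin, where division by
  zero gives the term 0.\<close>

definition lattice_sum6 :: "complex \<Rightarrow> complex" where
  "lattice_sum6 \<tau> = infsum (\<lambda>(m::int, n::int). 1 / (of_int m * \<tau> + of_int n) ^ 6) UNIV"

text \<open>The inversion permutes the lattice by (m, n) -> (n, -m), up to the scaling by \<tau>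
  that yields the factor.\<close>

lemma lattice_sum6_inverse:
  assumes "\<tau> \<noteq> 0"
  shows "lattice_sum6 (- 1 / \<tau>) = \<tau> ^ 6 * lattice_sum6 \<tau>"
proof -
  have "lattice_sum6 (- 1 / \<tau>) = infsum (\<lambda>p. \<tau> ^ 6 * (case p of (m::int, n::int) \<Rightarrow> 1 / (of_int m * \<tau> + of_int n) ^ 6)) UNIV"
    unfolding lattice_sum6_def
  proof (rule infsum_reindex_bij_witness[of _ "\<lambda>(a, b). (- b, a)" "\<lambda>(m, n). (n, - m)"])
    fix p :: "int \<times> int"
    obtain m n where p: "p = (m, n)" by (cases p)
    have "of_int m * (- 1 / \<tau>) + of_int n = (of_int n * \<tau> + of_int (- m)) / \<tau>"
      using assms by (simp add: field_simps)
    then show "\<tau> ^ 6 * (case (case p of (m, n) \<Rightarrow> (n, - m)) of (m::int, n::int) \<Rightarrow> 1 / (of_int m * \<tau> + of_int n) ^ 6)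
      = (case p of (m, n) \<Rightarrow> 1 / (of_int m * (- 1 / \<tau>) + of_int n) ^ 6)"
      unfolding p prod.case by (simp only: power_divide) simp
  qed auto
  also have "\<dots> = \<tau> ^ 6 * lattice_sum6 \<tau>"
    unfolding lattice_sum6_def by (rule infsum_cmult_right')
  finally show ?thesis .
qed

text \<open>The sum of k^5 X^(m k) over m, k \<ge> 1 is evaluated by rows, which gives the Lambert
  series, and along m k = n, which collects the divisors of n. Absolute convergence rests on m k + 1
  \<ge> m + k, which bounds the terms by a product; hence the quotient \<open>r ^ m / r\<close> in
  the majorant.\<close>

lemma has_sum_sigma5_double:
  fixes X :: complex
  assumes X: "X \<noteq> 0" "norm X < 1"
  shows "((\<lambda>m. eval_fps (power_geom 5) (X ^ m)) has_sum (\<Sum>\<^sub>\<infinity>n\<in>{1..}. of_nat (sigma5 n) * X ^ n)) {1..}"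
    and "((\<lambda>n. of_nat (sigma5 n) * X ^ n) has_sum (\<Sum>\<^sub>\<infinity>n\<in>{1..}. of_nat (sigma5 n) * X ^ n)) {1..}"
proof -
  define r where "r = norm X"
  have r: "0 < r" "r < 1" using X by (auto simp: r_def)
  define f where "f = (\<lambda>(m::nat, k::nat). of_nat k ^ 5 * X ^ (m * k))"
  have geo: "(\<lambda>m::nat. r ^ m / r) summable_on {1..}"
  proof -
    have "(\<lambda>m::nat. r ^ m * (1 / r)) summable_on UNIV"
      using r by (intro summable_on_cmult_left norm_summable_imp_summable_on) (auto intro!: summable_geometric)
    then show ?thesis by (auto intro: summable_on_subset)
  qed
  have pg: "(\<lambda>k::nat. real k ^ 5 * r ^ k) summable_on {1..}"
  proof -
    have "ereal (norm X) < fps_conv_radius (power_geom 5)"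
      by (intro fps_conv_radius_gt fps_conv_radius_power_geom X)
    then have "summable (\<lambda>k. norm (fps_nth (power_geom 5) k * X ^ k))" by (rule norm_summable_fps)
    then have "summable (\<lambda>k. norm (real k ^ 5 * r ^ k))"
      by (simp add: fps_nth_power_geom norm_mult norm_power r_def)
    then have "(\<lambda>k::nat. real k ^ 5 * r ^ k) summable_on UNIV" by (rule norm_summable_imp_summable_on)
    then show ?thesis by (auto intro: summable_on_subset)
  qed
  have abs: "(\<lambda>p. norm (f p)) summable_on {1..} \<times> {1..}"
  proof (rule summable_on_comparison_test)
    show "(\<lambda>(m, k). (r ^ m / r) * (real k ^ 5 * r ^ k)) summable_on {1..} \<times> {1..}"
      by (rule summable_on_Times_product[OF geo pg]) (use r in auto)
    fix p :: "nat \<times> nat" assume p: "p \<in> {1..} \<times> {1..}"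
    obtain m k where mk: "p = (m, k)" by (cases p)
    have "m * k + 1 \<ge> m + k"
    proof -
      obtain a b where "m = Suc a" "k = Suc b" using p mk by (metis Suc_le_D SigmaE atLeast_iff One_nat_def prod.inject)
      then show ?thesis by simp
    qed
    then have "r ^ (m * k + 1) \<le> r ^ (m + k)" using r by (intro power_decreasing) auto
    then have "r ^ (m * k) \<le> r ^ m / r * r ^ k" using r by (simp add: power_add field_simps)
    then have "real k ^ 5 * r ^ (m * k) \<le> real k ^ 5 * (r ^ m / r * r ^ k)"
      by (rule mult_left_mono) simp
    then show "norm (f p) \<le> (case p of (m, k) \<Rightarrow> (r ^ m / r) * (real k ^ 5 * r ^ k))"
      by (simp add: f_def mk norm_mult norm_power r_def mult_ac)
  qed auto
  have sum: "f summable_on {1..} \<times> {1..}" using abs by (rule abs_summable_summable)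
  have inner: "((\<lambda>k. f (m, k)) has_sum eval_fps (power_geom 5) (X ^ m)) {1..}" if m: "m \<in> {1..}" for m
  proof -
    have "norm (X ^ m) < 1" using X m by (simp add: norm_power power_less_one_iff)
    then have "ereal (norm (X ^ m)) < fps_conv_radius (power_geom 5)"
      by (intro fps_conv_radius_gt fps_conv_radius_power_geom)
    then have "((\<lambda>k. fps_nth (power_geom 5) k * (X ^ m) ^ k) has_sum eval_fps (power_geom 5) (X ^ m)) UNIV"
      by (rule has_sum_eval_fps)
    also have "?this \<longleftrightarrow> ?thesis"
      by (rule has_sum_cong_neutral) (auto simp: fps_nth_power_geom f_def power_mult not_le)
    finally show ?thesis .
  qed
  have 1: "(f has_sum infsum f ({1..} \<times> {1..})) ({1..} \<times> {1..})" using sum by (rule has_sum_infsum)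
  have A: "((\<lambda>m. eval_fps (power_geom 5) (X ^ m)) has_sum infsum f ({1..} \<times> {1..})) {1..}"
    by (rule has_sum_SigmaD[OF 1 inner])
  have 2: "((\<lambda>(n, d). of_nat d ^ 5 * X ^ n) has_sum infsum f ({1..} \<times> {1..})) (Sigma {1..} (\<lambda>n. {d. d dvd n}))"
  proof -
    have "(f has_sum infsum f ({1..} \<times> {1..})) ({1..} \<times> {1..}) \<longleftrightarrow>
      ((\<lambda>(n, d). of_nat d ^ 5 * X ^ n) has_sum infsum f ({1..} \<times> {1..})) (Sigma {1..} (\<lambda>n. {d. d dvd n}))"
      by (rule has_sum_reindex_bij_witness[of _ "\<lambda>(n, d). (n div d, d)" "\<lambda>(m, k). (m * k, k)"])
         (auto simp: f_def elim!: dvdE intro!: Suc_leI Nat.gr0I)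
    then show ?thesis using 1 by blast
  qed
  have 3: "((\<lambda>n. of_nat (sigma5 n) * X ^ n) has_sum infsum f ({1..} \<times> {1..})) {1..}"
  proof (rule has_sum_SigmaD[OF 2])
    fix n :: nat assume n: "n \<in> {1..}"
    show "((\<lambda>d. case (n, d) of (n, d) \<Rightarrow> of_nat d ^ 5 * X ^ n) has_sum of_nat (sigma5 n) * X ^ n) {d. d dvd n}"
      by (rule has_sum_finiteI) (use n in \<open>auto simp: sigma5_def sum_distrib_right\<close>)
  qed
  then have eq: "infsum f ({1..} \<times> {1..}) = (\<Sum>\<^sub>\<infinity>n\<in>{1..}. of_nat (sigma5 n) * X ^ n)"
    using infsumI by metis
  show "((\<lambda>m. eval_fps (power_geom 5) (X ^ m)) has_sum (\<Sum>\<^sub>\<infinity>n\<in>{1..}. of_nat (sigma5 n) * X ^ n)) {1..}"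
    using A unfolding eq .
  show "((\<lambda>n. of_nat (sigma5 n) * X ^ n) has_sum (\<Sum>\<^sub>\<infinity>n\<in>{1..}. of_nat (sigma5 n) * X ^ n)) {1..}"
    using 3 unfolding eq .
qed

lemma has_sum_E6:
  fixes X :: complex
  assumes X: "X \<noteq> 0" "norm X < 1"
  shows "((\<lambda>n. fps_nth (cfps E6) n * X ^ n) has_sum 1 - 504 * (\<Sum>\<^sub>\<infinity>n\<in>{1..}. of_nat (sigma5 n) * X ^ n)) UNIV"
proof -
  have "((\<lambda>n. - 504 * (of_nat (sigma5 n) * X ^ n)) has_sum - 504 * (\<Sum>\<^sub>\<infinity>n\<in>{1..}. of_nat (sigma5 n) * X ^ n)) {1..}"
    by (intro has_sum_cmult_right has_sum_sigma5_double[OF X])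
  also have "?this \<longleftrightarrow> ((\<lambda>n. fps_nth (cfps E6) n * X ^ n) has_sum - 504 * (\<Sum>\<^sub>\<infinity>n\<in>{1..}. of_nat (sigma5 n) * X ^ n)) {1..}"
    by (rule has_sum_cong) (simp add: E6_def)
  finally have "((\<lambda>n. fps_nth (cfps E6) n * X ^ n) has_sum fps_nth (cfps E6) 0 * X ^ 0 + - 504 * (\<Sum>\<^sub>\<infinity>n\<in>{1..}. of_nat (sigma5 n) * X ^ n)) (insert 0 {1..})"
    by (intro has_sum_insert) auto
  moreover have "insert 0 {1..} = (UNIV :: nat set)" by auto
  ultimately show ?thesis by (simp add: E6_def)
qed

lemma fps_conv_radius_E6: "fps_conv_radius (cfps E6) \<ge> 1"
  unfolding fps_conv_radius_def
proof (rule conv_radius_geI_ex')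
  fix r :: real assume "0 < r" "ereal r < 1"
  then have "complex_of_real r \<noteq> 0" "norm (complex_of_real r) < 1" by auto
  from has_sum_imp_sums[OF has_sum_E6[OF this]]
  show "summable (\<lambda>n. fps_nth (cfps E6) n * complex_of_real r ^ n)" by (simp add: sums_iff)
qed

definition eis6 :: "complex \<Rightarrow> complex" where
  "eis6 \<tau> = eval_fps (cfps E6) (qexp \<tau>)"

text \<open>The row m = 0 is 2 zeta (6), each row m > 0 is a Lipschitz series, and m < 0 repeats m >
  0. The 504 of \<open>E6\<close> arises as 2 (8 pi^6 / 15) / (2 pi^6 / 945).\<close>

lemma lattice_sum6_eq:
  assumes "Im \<tau> > 0"
  shows "lattice_sum6 \<tau> = 2 * of_real pi ^ 6 / 945 * eis6 \<tau>"
proof -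
  define T where "T = (\<Sum>\<^sub>\<infinity>n\<in>{1..}. of_nat (sigma5 n) * qexp \<tau> ^ n)"
  define c where "c = 8 * complex_of_real pi ^ 6 / 15"
  define h where "h = (\<lambda>m::int. \<Sum>\<^sub>\<infinity>n::int. 1 / (of_int m * \<tau> + of_int n) ^ 6)"
  have abs: "(\<lambda>p. norm (case p of (m::int, n::int) \<Rightarrow> 1 / (of_int m * \<tau> + of_int n) ^ 6)) summable_on UNIV"
    using lattice_abs_summable[OF assms] by (simp add: case_prod_unfold)
  have sum: "(\<lambda>(m::int, n::int). 1 / (of_int m * \<tau> + of_int n) ^ 6) summable_on UNIV \<times> UNIV"
    using abs_summable_summable[OF abs] by simp
  have hs: "lattice_sum6 \<tau> = infsum h UNIV"
    using infsum_Sigma'_banach[OF sum] by (simp add: h_def lattice_sum6_def)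
  have h_summable: "h summable_on UNIV" using summable_on_Sigma_banach[OF sum] by (simp add: h_def)
  have h0: "h 0 = 2 * of_real pi ^ 6 / 945"
    using sum_inverse_power6_ints by (simp add: h_def infsumI)
  have h_pos: "h (int m) = - c * eval_fps (power_geom 5) (qexp \<tau> ^ m)" if "m \<ge> 1" for m
  proof -
    have "Im (of_nat m * \<tau>) > 0" using assms that by simp
    from lipschitz_6[OF this] show ?thesis by (simp add: h_def qexp_power infsumI c_def)
  qed
  have h_neg: "h (- m) = h m" for m
    unfolding h_def
  proof (rule infsum_reindex_bij_witness[of _ uminus uminus])
    fix n :: int
    have "of_int (- m) * \<tau> + of_int n = - (of_int m * \<tau> + of_int (- n))" by simp
    then show "1 / (of_int m * \<tau> + of_int (- n)) ^ 6 = 1 / (of_int (- m) * \<tau> + of_int n) ^ 6"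
      by (simp only: power_minus_even[of 6] even_numeral)
  qed auto
  have pos: "(h has_sum - c * T) {1..}"
  proof -
    have "((\<lambda>m. - c * eval_fps (power_geom 5) (qexp \<tau> ^ m)) has_sum - c * T) {1..}"
      unfolding T_def by (intro has_sum_cmult_right has_sum_sigma5_double) (use assms in \<open>auto simp: norm_qexp_less_1\<close>)
    also have "?this \<longleftrightarrow> ((\<lambda>m. h (int m)) has_sum - c * T) {1..}"
      by (rule has_sum_cong) (simp add: h_pos)
    also have "\<dots> \<longleftrightarrow> (h has_sum - c * T) {1..}"
      by (rule has_sum_reindex_bij_witness[of _ nat int]) auto
    finally show ?thesis .
  qed
  have neg: "(h has_sum - c * T) {..-1}"
  proof -
    have "(h has_sum - c * T) {1..} \<longleftrightarrow> (h has_sum - c * T) {..-1}"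
      by (rule has_sum_reindex_bij_witness[of _ uminus uminus]) (auto simp: h_neg)
    then show ?thesis using pos by blast
  qed
  have "(h has_sum (- c * T) + (- c * T)) ({1..} \<union> {..-1})"
    by (rule has_sum_Un_disjoint[OF pos neg]) auto
  then have "(h has_sum h 0 + ((- c * T) + (- c * T))) (insert 0 ({1..} \<union> {..-1}))"
    by (intro has_sum_insert) auto
  moreover have "insert 0 ({1..} \<union> {..-1}) = (UNIV :: int set)" by auto
  ultimately have "infsum h UNIV = h 0 + ((- c * T) + (- c * T))" using infsumI by metis
  then have "lattice_sum6 \<tau> = 2 * of_real pi ^ 6 / 945 * (1 - 504 * T)"
    unfolding hs h0 c_def by (simp add: algebra_simps)
  moreover have "eis6 \<tau> = 1 - 504 * T"
  proof -
    have "((\<lambda>n. fps_nth (cfps E6) n * qexp \<tau> ^ n) has_sum eis6 \<tau>) UNIV"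
      unfolding eis6_def
      by (intro has_sum_eval_fps fps_conv_radius_gt fps_conv_radius_E6 norm_qexp_less_1 assms)
    moreover have "((\<lambda>n. fps_nth (cfps E6) n * qexp \<tau> ^ n) has_sum 1 - 504 * T) UNIV"
      unfolding T_def by (rule has_sum_E6) (use assms in \<open>auto simp: norm_qexp_less_1\<close>)
    ultimately show ?thesis by (rule has_sum_unique)
  qed
  ultimately show ?thesis by simp
qed

lemma Im_minus_inverse_pos: "Im \<tau> > 0 \<Longrightarrow> Im (- 1 / \<tau>) > 0"
  by (simp add: Im_divide sum_power2_gt_zero_iff)

theorem eis6_inverse:
  assumes "Im \<tau> > 0"
  shows "eis6 (- 1 / \<tau>) = \<tau> ^ 6 * eis6 \<tau>"
proof -
  have "\<tau> \<noteq> 0" using assms by auto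
  then have "2 * of_real pi ^ 6 / 945 * eis6 (- 1 / \<tau>) = \<tau> ^ 6 * (2 * of_real pi ^ 6 / 945 * eis6 \<tau>)"
    using lattice_sum6_inverse[of \<tau>] lattice_sum6_eq[OF assms] lattice_sum6_eq[OF Im_minus_inverse_pos[OF assms]] by simp
  then show ?thesis by (simp add: field_simps)
qed

section \<open>The eta function as a theta series\<close>

text \<open>The primitive even quadratic character modulo 12, the Kronecker symbol (12/n). It
  carries the signs of the pentagonal number series.\<close>

definition chi12 :: "int \<Rightarrow> int" where
  "chi12 n = (if n mod 12 \<in> {1, 11} then 1 else if n mod 12 \<in> {5, 7} then -1 else 0)"

lemma chi12_mod: "chi12 (n mod 12) = chi12 n"
  by (simp add: chi12_def)

lemma chi12_cong: "[n = n'] (mod 12) \<Longrightarrow> chi12 n = chi12 n'"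
  by (metis chi12_mod cong_def)

lemma mod_12_cases:
  fixes n :: int
  shows "n mod 12 = 0 \<or> n mod 12 = 1 \<or> n mod 12 = 2 \<or> n mod 12 = 3 \<or> n mod 12 = 4 \<or> n mod 12 = 5
    \<or> n mod 12 = 6 \<or> n mod 12 = 7 \<or> n mod 12 = 8 \<or> n mod 12 = 9 \<or> n mod 12 = 10 \<or> n mod 12 = 11"
  by presburger

lemma chi12_mult: "chi12 (a * b) = chi12 a * chi12 b"
proof -
  have *: "chi12 (a * b) = chi12 ((a mod 12) * (b mod 12))"
    by (rule chi12_cong) (simp add: cong_def mod_mult_eq)
  show ?thesis
    unfolding * using mod_12_cases[of a] mod_12_cases[of b] by (elim disjE) (simp_all add: chi12_def)
qed

lemma chi12_uminus: "chi12 (- n) = chi12 n"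
  using chi12_mult[of "-1" n] by (simp add: chi12_def)

lemma chi12_square:
  assumes "chi12 n \<noteq> 0"
  shows "24 * ((n\<^sup>2 - 1) div 24) = n\<^sup>2 - 1"
proof -
  have "n mod 12 \<in> {1, 5, 7, 11}" using assms by (auto simp: chi12_def split: if_splits)
  then obtain r where r: "r \<in> {1, 5, 7, 11}" "n mod 12 = r" by blast
  define k where "k = n div 12"
  have n: "n = 12 * k + r" using r(2) unfolding k_def by (metis mult_div_mod_eq)
  have "n\<^sup>2 - 1 = 24 * (6 * k\<^sup>2 + k * r) + (r\<^sup>2 - 1)" unfolding n by (simp add: power2_eq_square algebra_simps)
  moreover have "24 dvd r\<^sup>2 - 1" using r(1) by auto
  ultimately have "24 dvd n\<^sup>2 - 1" by (metis dvd_add dvd_triv_left)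
  then show ?thesis by simp
qed

text \<open>The generalised pentagonal number k (3k - 1) / 2 is indexed by r = |6k - 1|, which turns
  q^(1/24) q^(pent r) into q^(r^2/24). For the other r the value always comes with the factor
  \<open>chi12 r\<close>, which is 0.\<close>

definition pent :: "nat \<Rightarrow> nat" where
  "pent r = (r\<^sup>2 - 1) div 24"

lemma pent_eq: "chi12 (int r) \<noteq> 0 \<Longrightarrow> 24 * pent r + 1 = r\<^sup>2"
proof -
  assume c: "chi12 (int r) \<noteq> 0"
  have r: "r \<ge> 1" using c by (cases r) (auto simp: chi12_def)
  then have "int (r\<^sup>2 - 1) = (int r)\<^sup>2 - 1" by (simp add: of_nat_diff)
  then have "int (24 * pent r) = int (r\<^sup>2 - 1)"
    using chi12_square[OF c] by (simp add: pent_def zdiv_int)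
  then have "24 * pent r = r\<^sup>2 - 1" by (simp only: of_nat_eq_iff)
  then show ?thesis using r by simp
qed

lemma pent_inj: "chi12 (int r) \<noteq> 0 \<Longrightarrow> chi12 (int s) \<noteq> 0 \<Longrightarrow> pent r = pent s \<Longrightarrow> r = s"
  using pent_eq[of r] pent_eq[of s] by (metis power2_eq_iff_nonneg zero_le)

text \<open>Shanks' finite form of Euler's pentagonal number theorem.\<close>

lemma finite_pentagonal:
  fixes x :: "'a :: comm_ring_1"
  shows "(\<Sum>s\<le>N. (-1) ^ s * (\<Prod>i\<in>{s<..N}. 1 - x ^ i) * x ^ (s * N + (\<Sum>i\<le>s. i)))
       = (\<Sum>r<6 * N + 2. of_int (chi12 (int r)) * x ^ pent r)"
proof (induction N)
  case 0
  show ?case by (simp add: numeral_2_eq_2 chi12_def pent_def)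
next
  case (Suc N)
  define t :: "nat \<Rightarrow> nat" where "t = (\<lambda>s. \<Sum>i\<le>s. i)"
  define P where "P = (\<lambda>s. \<Prod>i\<in>{s<..N}. 1 - x ^ i)"
  \<comment> \<open>The telescoping quantity: passing from N to N + 1 changes the s-th summand by a
    difference of consecutive signed values of \<open>A\<close>. As \<open>A 0\<close> is set to 0,
    the value at N + 1 is what remains.\<close>
  define A where "A = (\<lambda>s. if s = 0 then 0 else P (s - 1) * x ^ (s * N + t s))"
  have t_Suc: "t (Suc s) = t s + Suc s" for s by (simp add: t_def)
  have two_t: "2 * t s = s * (s + 1)" for s by (induction s) (simp_all add: t_def)
  have P_Suc: "(\<Prod>i\<in>{s<..Suc N}. 1 - x ^ i) = P s * (1 - x ^ Suc N)" if "s \<le> N" for s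
  proof -
    have "{s<..Suc N} = insert (Suc N) {s<..N}" using that by auto
    then show ?thesis by (simp add: P_def mult.commute)
  qed
  have step: "(-1) ^ s * (P s * (1 - x ^ Suc N)) * x ^ (s * Suc N + t s) - (-1) ^ s * P s * x ^ (s * N + t s)
      = (-1) ^ Suc s * A s - (-1) ^ Suc (Suc s) * A (Suc s)" if s: "s \<le> N" for s
  proof -
    have As: "A s = P s * (1 - x ^ s) * x ^ (s * N + t s)"
    proof (cases s)
      case (Suc s')
      have "{s'<..N} = insert s {s<..N}" using s Suc by auto
      then have "P s' = (1 - x ^ s) * P s" by (simp add: P_def)
      then show ?thesis by (simp add: A_def Suc)
    qed (simp add: A_def)
    have "A (Suc s) = P s * (x ^ (s * N + t s) * x ^ s * x ^ Suc N)"
      by (simp only: A_def t_Suc power_add[symmetric]) (simp add: algebra_simps)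
    moreover have "x ^ (s * Suc N + t s) = x ^ (s * N + t s) * x ^ s"
      by (simp only: power_add[symmetric]) (simp add: algebra_simps)
    ultimately show ?thesis unfolding As by (simp add: algebra_simps)
  qed
  have "(\<Sum>s\<le>Suc N. (-1) ^ s * (\<Prod>i\<in>{s<..Suc N}. 1 - x ^ i) * x ^ (s * Suc N + t s))
     = (\<Sum>s\<le>N. (-1) ^ s * (P s * (1 - x ^ Suc N)) * x ^ (s * Suc N + t s)) + (-1) ^ Suc N * x ^ (Suc N * Suc N + t (Suc N))"
    by (simp add: P_Suc)
  also have "(\<Sum>s\<le>N. (-1) ^ s * (P s * (1 - x ^ Suc N)) * x ^ (s * Suc N + t s))
     = (\<Sum>s\<le>N. (-1) ^ s * P s * x ^ (s * N + t s)) + (\<Sum>s\<le>N. (-1) ^ Suc s * A s - (-1) ^ Suc (Suc s) * A (Suc s))"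
    unfolding sum.distrib[symmetric] by (rule sum.cong) (use step in \<open>auto simp: algebra_simps\<close>)
  also have "(\<Sum>s\<le>N. (-1) ^ Suc s * A s - (-1) ^ Suc (Suc s) * A (Suc s)) = - ((-1) ^ Suc (Suc N) * A (Suc N))"
    by (subst sum_telescope) (simp add: A_def)
  also have "A (Suc N) = x ^ (Suc N * N + t (Suc N))"
    by (simp add: A_def P_def)
  also have "(\<Sum>s\<le>N. (-1) ^ s * P s * x ^ (s * N + t s)) = (\<Sum>r<6 * N + 2. of_int (chi12 (int r)) * x ^ pent r)"
    using Suc unfolding P_def t_def .
  finally have *: "(\<Sum>s\<le>Suc N. (-1) ^ s * (\<Prod>i\<in>{s<..Suc N}. 1 - x ^ i) * x ^ (s * Suc N + t s))
     = (\<Sum>r<6 * N + 2. of_int (chi12 (int r)) * x ^ pent r) + (-1) ^ Suc N * (x ^ (Suc N * N + t (Suc N)) + x ^ (Suc N * Suc N + t (Suc N)))"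
    by (simp add: algebra_simps)
  \<comment> \<open>Among the six new indices only 6N + 5 and 6N + 7 are prime to 12; they match the
    two monomials left by the telescoping and by the new summand s = N + 1.\<close>
  have "{..<6 * Suc N + 2} = {..<6 * N + 2} \<union> {6 * N + 2, 6 * N + 3, 6 * N + 4, 6 * N + 5, 6 * N + 6, 6 * N + 7}"
    by auto
  then have "(\<Sum>r<6 * Suc N + 2. of_int (chi12 (int r)) * x ^ pent r) = (\<Sum>r<6 * N + 2. of_int (chi12 (int r)) * x ^ pent r) +
     (\<Sum>r\<in>{6 * N + 2, 6 * N + 3, 6 * N + 4, 6 * N + 5, 6 * N + 6, 6 * N + 7}. of_int (chi12 (int r)) * x ^ pent r)"
    by (simp only:) (rule sum.union_disjoint; auto)
  also have "(\<Sum>r\<in>{6 * N + 2, 6 * N + 3, 6 * N + 4, 6 * N + 5, 6 * N + 6, 6 * N + 7}. of_int (chi12 (int r)) * x ^ pent r)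
    = (-1) ^ Suc N * (x ^ (Suc N * N + t (Suc N)) + x ^ (Suc N * Suc N + t (Suc N)))"
  proof -
    have z: "chi12 (int (6 * N + 2)) = 0" "chi12 (int (6 * N + 3)) = 0" "chi12 (int (6 * N + 4)) = 0" "chi12 (int (6 * N + 6)) = 0"
      unfolding chi12_def by (auto; presburger)+
    have o: "chi12 (int (6 * N + 5)) = (-1) ^ Suc N" "chi12 (int (6 * N + 7)) = (-1) ^ Suc N"
    proof -
      have "int (6 * N + 5) mod 12 = 5 \<and> int (6 * N + 7) mod 12 = 7" if "even N" using that by presburger
      moreover have "int (6 * N + 5) mod 12 = 11 \<and> int (6 * N + 7) mod 12 = 1" if "odd N" using that by presburger
      ultimately show "chi12 (int (6 * N + 5)) = (-1) ^ Suc N" "chi12 (int (6 * N + 7)) = (-1) ^ Suc N"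
        by (cases "even N"; simp add: chi12_def)+
    qed
    have p5: "pent (6 * N + 5) = Suc N * N + t (Suc N)"
    proof -
      have "24 * (Suc N * N + t (Suc N)) + 1 = 24 * (Suc N * N) + 12 * (2 * t (Suc N)) + 1" by simp
      also have "\<dots> = (6 * N + 5)\<^sup>2" unfolding two_t by (simp add: power2_eq_square algebra_simps)
      finally have "(6 * N + 5)\<^sup>2 - 1 = 24 * (Suc N * N + t (Suc N))" by simp
      then show ?thesis unfolding pent_def by simp
    qed
    have p7: "pent (6 * N + 7) = Suc N * Suc N + t (Suc N)"
    proof -
      have "24 * (Suc N * Suc N + t (Suc N)) + 1 = 24 * (Suc N * Suc N) + 12 * (2 * t (Suc N)) + 1" by simp
      also have "\<dots> = (6 * N + 7)\<^sup>2" unfolding two_t by (simp add: power2_eq_square algebra_simps)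
      finally have "(6 * N + 7)\<^sup>2 - 1 = 24 * (Suc N * Suc N + t (Suc N))" by simp
      then show ?thesis unfolding pent_def by simp
    qed
    show ?thesis using z o by (simp add: p5 p7 distrib_left)
  qed
  finally show ?case using * unfolding t_def by simp
qed

text \<open>In the finite identity with N = n + 1 every summand s \<ge> 1 carries at least the power
  s (n + 1), beyond degree n, so the coefficient comes from the product at s = 0.\<close>

lemma fps_nth_euler_product:
  "fps_nth euler_product n = (\<Sum>r<6 * Suc n + 2. if pent r = n then chi12 (int r) else 0)"
proof -
  have "(\<Prod>i\<le>n. 1 - fps_X ^ Suc i :: int fps) = (\<Prod>i\<in>{0<..Suc n}. 1 - fps_X ^ i)"
    by (rule prod.reindex_bij_witness[of _ "\<lambda>i. i - 1" Suc]) auto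
  then have "fps_nth euler_product n = fps_nth (\<Prod>i\<in>{0<..Suc n}. 1 - fps_X ^ i :: int fps) n"
    by (simp add: euler_product_nth)
  also have "\<dots> = fps_nth (\<Sum>s\<le>Suc n. (-1) ^ s * (\<Prod>i\<in>{s<..Suc n}. 1 - fps_X ^ i) * fps_X ^ (s * Suc n + (\<Sum>i\<le>s. i)) :: int fps) n"
  proof -
    have "fps_nth ((-1) ^ s * (\<Prod>i\<in>{s<..Suc n}. 1 - fps_X ^ i) * fps_X ^ (s * Suc n + (\<Sum>i\<le>s. i)) :: int fps) n = 0" if "s \<noteq> 0" for s
    proof -
      have "n < s * Suc n" using that by (cases s) auto
      then show ?thesis by (subst fps_X_power_mult_right_nth) auto
    qed
    then have "(\<Sum>s\<le>Suc n. fps_nth ((-1) ^ s * (\<Prod>i\<in>{s<..Suc n}. 1 - fps_X ^ i) * fps_X ^ (s * Suc n + (\<Sum>i\<le>s. i)) :: int fps) n)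
       = (\<Sum>s\<in>{0}. fps_nth ((-1) ^ s * (\<Prod>i\<in>{s<..Suc n}. 1 - fps_X ^ i) * fps_X ^ (s * Suc n + (\<Sum>i\<le>s. i)) :: int fps) n)"
      by (intro sum.mono_neutral_right) auto
    then show ?thesis by (simp add: fps_sum_nth)
  qed
  also have "\<dots> = (\<Sum>r<6 * Suc n + 2. fps_nth (of_int (chi12 (int r)) * fps_X ^ pent r) n)"
    by (subst finite_pentagonal) (simp only: fps_sum_nth)
  also have "\<dots> = (\<Sum>r<6 * Suc n + 2. if pent r = n then chi12 (int r) else 0)"
    by (rule sum.cong) (auto simp: fps_X_power_mult_right_nth fps_of_int[symmetric])
  finally show ?thesis .
qed

lemma fps_nth_euler_product_pent:
  assumes "chi12 (int r) \<noteq> 0"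
  shows "fps_nth euler_product (pent r) = chi12 (int r)"
proof -
  \<comment> \<open>r^2 = 24 pent r + 1 keeps r inside the finite range of the coefficient
    formula.\<close>
  have "r < 6 * Suc (pent r) + 2"
  proof (rule ccontr)
    assume "\<not> ?thesis"
    then have "(6 * Suc (pent r) + 2)\<^sup>2 \<le> r\<^sup>2" by (intro power_mono) auto
    then show False using pent_eq[OF assms] by (simp add: power2_eq_square algebra_simps)
  qed
  moreover have "(if pent s = pent r then chi12 (int s) else 0) = (if s = r then chi12 (int s) else 0)" for s
    using pent_inj[OF _ assms, of s] by auto
  ultimately show ?thesis by (simp add: fps_nth_euler_product)
qed

lemma fps_nth_euler_product_0:
  assumes "\<And>r. pent r = n \<Longrightarrow> chi12 (int r) = 0"
  shows "fps_nth euler_product n = 0"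
  using assms by (auto simp: fps_nth_euler_product intro!: sum.neutral)

lemma abs_fps_nth_euler_product_le: "\<bar>fps_nth euler_product n\<bar> \<le> 1"
proof (cases "\<exists>r. pent r = n \<and> chi12 (int r) \<noteq> 0")
  case True
  then show ?thesis using fps_nth_euler_product_pent by (auto simp: chi12_def)
next
  case False
  then show ?thesis by (subst fps_nth_euler_product_0) auto
qed

lemma fps_conv_radius_geI_bounded:
  fixes F :: "complex fps"
  assumes "\<And>n. norm (fps_nth F n) \<le> B"
  shows "fps_conv_radius F \<ge> 1"
  unfolding fps_conv_radius_def
proof (rule conv_radius_geI_ex')
  fix r :: real assume r: "0 < r" "ereal r < 1"
  show "summable (\<lambda>n. fps_nth F n * complex_of_real r ^ n)"
  proof (rule summable_comparison_test[of _ "\<lambda>n. B * r ^ n"])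
    show "summable (\<lambda>n. B * r ^ n)" using r by (auto intro!: summable_mult summable_geometric)
    show "\<exists>N. \<forall>n\<ge>N. norm (fps_nth F n * complex_of_real r ^ n) \<le> B * r ^ n"
      using assms r by (auto simp: norm_mult norm_power intro!: mult_right_mono)
  qed
qed

lemma fps_conv_radius_euler_product: "fps_conv_radius (cfps euler_product) \<ge> 1"
proof (rule fps_conv_radius_geI_bounded[of _ 1])
  fix n
  have "norm (complex_of_int (fps_nth euler_product n)) = of_int \<bar>fps_nth euler_product n\<bar>" by simp
  also have "\<dots> \<le> 1" using abs_fps_nth_euler_product_le[of n] by linarith
  finally show "norm (fps_nth (cfps euler_product) n) \<le> 1" by simp
qed

lemma has_sum_euler_product:
  fixes z :: complex
  assumes "norm z < 1"
  shows "((\<lambda>r. of_int (chi12 (int r)) * z ^ pent r) has_sum eval_fps (cfps euler_product) z) UNIV"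
proof -
  define S where "S = {r. chi12 (int r) \<noteq> 0}"
  have inj: "inj_on pent S" by (auto simp: inj_on_def S_def intro: pent_inj)
  have "((\<lambda>n. fps_nth (cfps euler_product) n * z ^ n) has_sum eval_fps (cfps euler_product) z) UNIV"
    by (intro has_sum_eval_fps fps_conv_radius_gt fps_conv_radius_euler_product assms)
  also have "?this \<longleftrightarrow> ((\<lambda>n. fps_nth (cfps euler_product) n * z ^ n) has_sum eval_fps (cfps euler_product) z) (pent ` S)"
    by (rule has_sum_cong_neutral) (auto simp: S_def intro!: fps_nth_euler_product_0)
  also have "\<dots> \<longleftrightarrow> ((\<lambda>r. of_int (chi12 (int r)) * z ^ pent r) has_sum eval_fps (cfps euler_product) z) S"
    by (subst has_sum_reindex[OF inj]) (auto simp: o_def S_def fps_nth_euler_product_pent intro!: has_sum_cong)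
  also have "\<dots> \<longleftrightarrow> ((\<lambda>r. of_int (chi12 (int r)) * z ^ pent r) has_sum eval_fps (cfps euler_product) z) UNIV"
    by (rule has_sum_cong_neutral) (auto simp: S_def)
  finally show ?thesis .
qed

text \<open>Letting N tend to infinity in the finite identity identifies the power series with the
  infinite product, which converges absolutely with nonzero factors. The terms s \<ge> 1 are N in
  number and each is at most C * r^N.\<close>

lemma eval_euler_product_nonzero:
  fixes z :: complex
  assumes z: "norm z < 1"
  shows "eval_fps (cfps euler_product) z \<noteq> 0"
proof -
  define r where "r = norm z"
  have r: "0 \<le> r" "r < 1" using z by (auto simp: r_def)
  define P where "P = (\<lambda>s N. \<Prod>i\<in>{s<..N}. 1 - z ^ i)"
  define C where "C = exp (1 / (1 - r))"
  have P_le: "norm (P s N) \<le> C" for s N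
  proof -
    have "norm (P s N) \<le> (\<Prod>i\<in>{s<..N}. exp (r ^ i))"
      unfolding P_def prod_norm[symmetric]
    proof (rule prod_mono, safe)
      fix i
      have "norm (1 - z ^ i) \<le> 1 + r ^ i" using norm_triangle_ineq4[of 1 "z ^ i"] by (simp add: r_def norm_power)
      also have "\<dots> \<le> exp (r ^ i)" by (rule exp_ge_add_one_self)
      finally show "norm (1 - z ^ i) \<le> exp (r ^ i)" .
    qed auto
    also have "\<dots> = exp (\<Sum>i\<in>{s<..N}. r ^ i)" by (simp add: exp_sum)
    also have "\<dots> \<le> exp (\<Sum>i. r ^ i)"
      using r by (simp only: exp_le_cancel_iff) (intro sum_le_suminf summable_geometric; simp)
    also have "\<dots> = C" using r by (simp add: C_def suminf_geometric)
    finally show ?thesis .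
  qed
  have conv: "convergent_prod (\<lambda>n. 1 - z ^ Suc n)"
  proof -
    have "abs_convergent_prod (\<lambda>n. 1 + - (z ^ Suc n))"
      by (rule summable_imp_abs_convergent_prod) 
         (use r in \<open>auto simp: norm_mult norm_power r_def[symmetric] intro!: summable_mult summable_geometric\<close>)
    then have "abs_convergent_prod (\<lambda>n. 1 - z ^ Suc n)" by simp
    then show ?thesis by (rule abs_convergent_prod_imp_convergent_prod)
  qed
  have "1 - z ^ Suc n \<noteq> 0" for n
  proof -
    have "norm (z ^ Suc n) < 1"
      using z power_less_one_iff[of "norm z" "Suc n"] by (simp only: norm_power) simp
    then show ?thesis by (metis eq_iff_diff_eq_0 less_irrefl norm_one)
  qed
  then have L0: "prodinf (\<lambda>n. 1 - z ^ Suc n) \<noteq> 0" using prodinf_nonzero[OF conv] by blast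
  have "(\<lambda>N. \<Prod>i\<le>N. 1 - z ^ Suc i) \<longlonglongrightarrow> prodinf (\<lambda>n. 1 - z ^ Suc n)"
    by (rule convergent_prod_LIMSEQ[OF conv])
  moreover have "(\<Prod>i\<le>N. 1 - z ^ Suc i) = P 0 (Suc N)" for N
    unfolding P_def by (rule prod.reindex_bij_witness[of _ "\<lambda>i. i - 1" Suc]) auto
  ultimately have limP: "(\<lambda>N. P 0 (Suc N)) \<longlonglongrightarrow> prodinf (\<lambda>n. 1 - z ^ Suc n)" by (simp only:)
  define D where "D = (\<lambda>N. \<Sum>s\<in>{1..N}. (-1) ^ s * P s N * z ^ (s * N + (\<Sum>i\<le>s. i)))"
  have fin: "P 0 N + D N = (\<Sum>r<6 * N + 2. of_int (chi12 (int r)) * z ^ pent r)" for N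
  proof -
    have "{..N} = insert 0 {1..N}" by auto
    then have "(\<Sum>s\<le>N. (-1) ^ s * (\<Prod>i\<in>{s<..N}. 1 - z ^ i) * z ^ (s * N + (\<Sum>i\<le>s. i))) = P 0 N + D N"
      by (simp add: P_def D_def)
    then show ?thesis using finite_pentagonal[where x = z and N = N] by simp
  qed
  have D_le: "norm (D N) \<le> C * (real N * r ^ N)" for N
  proof -
    have "norm (D N) \<le> (\<Sum>s\<in>{1..N}. C * r ^ N)"
      unfolding D_def
    proof (rule sum_norm_le)
      fix s assume s: "s \<in> {1..N}"
      have "N \<le> s * N + (\<Sum>i\<le>s. i)" using s by (simp add: mult_le_mono1 trans_le_add1)
      then have "r ^ (s * N + (\<Sum>i\<le>s. i)) \<le> r ^ N" using r by (intro power_decreasing) auto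
      then have "norm (P s N) * r ^ (s * N + (\<Sum>i\<le>s. i)) \<le> C * r ^ N"
        using P_le r by (intro mult_mono) (auto simp: C_def)
      then show "norm ((-1) ^ s * P s N * z ^ (s * N + (\<Sum>i\<le>s. i))) \<le> C * r ^ N"
        by (simp add: norm_mult norm_power r_def)
    qed
    then show ?thesis by (simp add: mult_ac)
  qed
  have limD: "D \<longlonglongrightarrow> 0"
  proof (rule Lim_null_comparison)
    show "\<forall>\<^sub>F N in sequentially. norm (D N) \<le> C * (real N * r ^ N)" using D_le by auto
    have "(\<lambda>N. real N * r ^ N) \<longlonglongrightarrow> 0"
      using r powser_times_n_limit_0[of r] by simp
    then show "(\<lambda>N. C * (real N * r ^ N)) \<longlonglongrightarrow> 0" by (rule tendsto_mult_right_zero)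
  qed
  have "(\<lambda>N. \<Sum>r<N. of_int (chi12 (int r)) * z ^ pent r) \<longlonglongrightarrow> eval_fps (cfps euler_product) z"
    using has_sum_imp_sums[OF has_sum_euler_product[OF z]] by (simp add: sums_def)
  moreover have "strict_mono (\<lambda>N. 6 * Suc N + 2)" by (simp add: strict_mono_def)
  ultimately have "((\<lambda>N. \<Sum>r<N. of_int (chi12 (int r)) * z ^ pent r) \<circ> (\<lambda>N. 6 * Suc N + 2)) \<longlonglongrightarrow> eval_fps (cfps euler_product) z"
    by (rule LIMSEQ_subseq_LIMSEQ)
  then have "(\<lambda>N. P 0 (Suc N) + D (Suc N)) \<longlonglongrightarrow> eval_fps (cfps euler_product) z"
    by (simp only: o_def fin)
  moreover have "(\<lambda>N. P 0 (Suc N) + D (Suc N)) \<longlonglongrightarrow> prodinf (\<lambda>n. 1 - z ^ Suc n) + 0"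
    by (intro tendsto_add limP LIMSEQ_Suc limD)
  ultimately have "eval_fps (cfps euler_product) z = prodinf (\<lambda>n. 1 - z ^ Suc n) + 0"
    by (rule LIMSEQ_unique)
  then show ?thesis using L0 by simp
qed

definition eta :: "complex \<Rightarrow> complex" where
  "eta \<tau> = qexp (\<tau> / 24) * eval_fps (cfps euler_product) (qexp \<tau>)"

lemma eta_nonzero: "Im \<tau> > 0 \<Longrightarrow> eta \<tau> \<noteq> 0"
  by (simp add: eta_def eval_euler_product_nonzero norm_qexp_less_1)

lemma holomorphic_eval_qexp:
  fixes F :: "complex fps"
  assumes "fps_conv_radius F \<ge> 1"
  shows "(\<lambda>\<tau>. eval_fps F (qexp \<tau>)) holomorphic_on {\<tau>. Im \<tau> > 0}"
proof -
  have "(eval_fps F \<circ> qexp) holomorphic_on {\<tau>. Im \<tau> > 0}"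
  proof (rule holomorphic_on_compose_gen)
    show "qexp holomorphic_on {\<tau>. Im \<tau> > 0}" by (intro holomorphic_intros)
    show "eval_fps F holomorphic_on ball 0 1"
    proof (rule holomorphic_on_eval_fps)
      show "ball (0 :: complex) 1 \<subseteq> eball 0 (fps_conv_radius F)"
      proof
        fix x :: complex assume "x \<in> ball 0 1"
        then have "norm x < 1" by simp
        from fps_conv_radius_gt[OF assms this] show "x \<in> eball 0 (fps_conv_radius F)" by simp
      qed
    qed
  qed (auto simp: norm_qexp_less_1)
  then show ?thesis by (simp add: o_def)
qed

lemma holomorphic_eta: "eta holomorphic_on {\<tau>. Im \<tau> > 0}"
  unfolding eta_def[abs_def]
  by (intro holomorphic_intros holomorphic_eval_qexp fps_conv_radius_euler_product) auto

lemma holomorphic_eis6: "eis6 holomorphic_on {\<tau>. Im \<tau> > 0}"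
  unfolding eis6_def[abs_def] by (intro holomorphic_eval_qexp fps_conv_radius_E6)

text \<open>With r^2 = 24 pent r + 1 the prefactor q^(1/24) is absorbed into the exponent. Each r >
  0 occurs again as -r because the character is even, whence the factor 2.\<close>

lemma has_sum_eta:
  assumes "Im \<tau> > 0"
  shows "((\<lambda>n::int. of_int (chi12 n) * qexp (of_int (n\<^sup>2) * \<tau> / 24)) has_sum 2 * eta \<tau>) UNIV"
proof -
  define f where "f = (\<lambda>n::int. of_int (chi12 n) * qexp (of_int (n\<^sup>2) * \<tau> / 24))"
  have "((\<lambda>r. qexp (\<tau> / 24) * (of_int (chi12 (int r)) * qexp \<tau> ^ pent r)) has_sum eta \<tau>) UNIV"
    unfolding eta_def by (intro has_sum_cmult_right has_sum_euler_product norm_qexp_less_1 assms)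
  also have "(\<lambda>r. qexp (\<tau> / 24) * (of_int (chi12 (int r)) * qexp \<tau> ^ pent r)) = (\<lambda>r. f (int r))"
  proof
    fix r
    show "qexp (\<tau> / 24) * (of_int (chi12 (int r)) * qexp \<tau> ^ pent r) = f (int r)"
    proof (cases "chi12 (int r) = 0")
      case False
      have "of_int ((int r)\<^sup>2) = (of_nat (24 * pent r + 1) :: complex)"
        by (simp only: pent_eq[OF False] of_int_of_nat_eq of_nat_power[symmetric])
      then have "(of_int ((int r)\<^sup>2) :: complex) = 24 * of_nat (pent r) + 1"
        by (simp only: of_nat_add of_nat_mult of_nat_numeral of_nat_1)
      then have e: "of_int ((int r)\<^sup>2) * \<tau> / 24 = \<tau> / 24 + of_nat (pent r) * \<tau>"
        by (simp only:) (simp add: field_simps)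
      show ?thesis unfolding f_def e qexp_power qexp_add by simp
    qed (simp add: f_def)
  qed
  also have "((\<lambda>r. f (int r)) has_sum eta \<tau>) UNIV \<longleftrightarrow> ((\<lambda>r. f (int r)) has_sum eta \<tau>) {1..}"
    by (rule has_sum_cong_neutral) (auto simp: f_def chi12_def not_le)
  also have "\<dots> \<longleftrightarrow> (f has_sum eta \<tau>) {1..}"
    by (rule has_sum_reindex_bij_witness[of _ nat int]) auto
  finally have pos: "(f has_sum eta \<tau>) {1..}" .
  have "(f has_sum eta \<tau>) {1..} \<longleftrightarrow> (f has_sum eta \<tau>) {..-1}"
    by (rule has_sum_reindex_bij_witness[of _ uminus uminus]) (auto simp: f_def chi12_uminus)
  then have neg: "(f has_sum eta \<tau>) {..-1}" using pos by blast
  have "(f has_sum eta \<tau> + eta \<tau>) ({1..} \<union> {..-1})"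
    by (rule has_sum_Un_disjoint[OF pos neg]) auto
  also have "?this \<longleftrightarrow> (f has_sum eta \<tau> + eta \<tau>) UNIV"
    by (rule has_sum_cong_neutral) (auto simp: f_def chi12_def intro!: antisym)
  finally show ?thesis by (simp add: f_def)
qed

section \<open>Gauss sums and the eta function at rational points\<close>

definition echar :: "nat \<Rightarrow> int \<Rightarrow> complex" where
  "echar c n = cis (2 * pi * of_int n / of_nat c)"

lemma echar_add: "echar c (m + n) = echar c m * echar c n"
  by (simp add: echar_def cis_mult add_divide_distrib algebra_simps)

lemma echar_cong:
  assumes "c > 0" "[n = n'] (mod int c)"
  shows "echar c n = echar c n'"
proof -
  obtain k where k: "n = n' + int c * k"
    using assms(2) by (metis cong_iff_lin cong_sym)
  have "2 * pi * of_int n / of_nat c = 2 * pi * of_int n' / of_nat c + 2 * pi * of_int k"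
    using assms(1) by (simp add: k field_simps)
  then have "echar c n = echar c n' * cis (2 * pi * of_int k)"
    unfolding echar_def by (simp only: cis_mult)
  also have "cis (2 * pi * of_int k) = 1" by (rule cis_multiple_2pi) auto
  finally show ?thesis by simp
qed

lemma qexp_of_int_divide: "qexp (of_int n / of_nat c) = echar c n"
proof -
  have "of_int n / of_nat c = complex_of_real (of_int n / of_nat c)" by simp
  then show ?thesis by (simp only: qexp_of_real echar_def) (simp add: mult.assoc)
qed

text \<open>Common form of the substitutions in the character sums below (affine changes of
  variable, Chinese remainders, digits to base l): c pairwise incongruent integers represent every
  class.\<close>

lemma sum_residues:
  fixes f :: "int \<Rightarrow> complex" and h :: "'a \<Rightarrow> int"
  assumes "c > 0" "finite I" "card I = c"
    and inj: "\<And>i j. i \<in> I \<Longrightarrow> j \<in> I \<Longrightarrow> [h i = h j] (mod int c) \<Longrightarrow> i = j"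
    and f: "\<And>n n'. [n = n'] (mod int c) \<Longrightarrow> f n = f n'"
  shows "(\<Sum>i\<in>I. f (h i)) = (\<Sum>n\<in>{0..<int c}. f n)"
proof -
  have i: "inj_on (\<lambda>i. h i mod int c) I" by (rule inj_onI) (auto intro: inj simp: cong_def)
  have "(\<lambda>i. h i mod int c) ` I = {0..<int c}"
  proof (rule card_subset_eq)
    show "card ((\<lambda>i. h i mod int c) ` I) = card {0..<int c}"
      using assms by (simp add: card_image[OF i])
  qed (use assms in auto)
  then have "bij_betw (\<lambda>i. h i mod int c) I {0..<int c}" using i by (simp add: bij_betw_def)
  then have "(\<Sum>i\<in>I. f (h i mod int c)) = (\<Sum>n\<in>{0..<int c}. f n)"
    by (rule sum.reindex_bij_betw)
  moreover have "f (h i mod int c) = f (h i)" for i by (rule f) (simp add: cong_def)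
  ultimately show ?thesis by simp
qed

definition gauss_sum :: "nat \<Rightarrow> int \<Rightarrow> complex" where
  "gauss_sum c b = (\<Sum>v\<in>{0..<int c}. echar c (b * v\<^sup>2))"

lemma cong_range_eq:
  fixes a b :: int
  assumes "[a = b] (mod n)" "a \<in> {0..<n}" "b \<in> {0..<n}"
  shows "a = b"
  using assms by (simp add: cong_def)

text \<open>The shift s = -24 b' m satisfies 24 b s = m modulo c, so b (12 v + s)^2 has the right
  linear term; its constant term b s^2 is congruent to - b' m^2, which explains the
  prefactor.\<close>

lemma gauss_sum_complete_square:
  assumes c: "c > 0" "coprime (int c) 12" and b: "[576 * b * b' = -1] (mod int c)"
  shows "(\<Sum>v\<in>{0..<int c}. echar c (144 * b * v\<^sup>2 + m * v)) = echar c (b' * m\<^sup>2) * gauss_sum c b"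
proof -
  define s where "s = - 24 * b' * m"
  have "echar c (144 * b * v\<^sup>2 + m * v) = echar c (b' * m\<^sup>2) * echar c (b * (12 * v + s)\<^sup>2)" for v
  proof -
    have "(b' * m\<^sup>2 + b * (12 * v + s)\<^sup>2) - (144 * b * v\<^sup>2 + m * v) = (576 * b * b' + 1) * (b' * m\<^sup>2 - m * v)"
      by (simp add: s_def power2_eq_square algebra_simps)
    moreover have "int c dvd 576 * b * b' + 1" using b by (simp add: cong_iff_dvd_diff)
    ultimately have "[b' * m\<^sup>2 + b * (12 * v + s)\<^sup>2 = 144 * b * v\<^sup>2 + m * v] (mod int c)"
      by (simp add: cong_iff_dvd_diff)
    from echar_cong[OF c(1) this] show ?thesis by (simp add: echar_add)
  qed
  then have "(\<Sum>v\<in>{0..<int c}. echar c (144 * b * v\<^sup>2 + m * v))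
     = echar c (b' * m\<^sup>2) * (\<Sum>v\<in>{0..<int c}. echar c (b * (12 * v + s)\<^sup>2))"
    by (simp add: sum_distrib_left)
  also have "(\<Sum>v\<in>{0..<int c}. echar c (b * (12 * v + s)\<^sup>2)) = (\<Sum>n\<in>{0..<int c}. echar c (b * n\<^sup>2))"
  proof (rule sum_residues)
    fix i j assume ij: "i \<in> {0..<int c}" "j \<in> {0..<int c}" "[12 * i + s = 12 * j + s] (mod int c)"
    then have "[12 * i = 12 * j] (mod int c)" by (simp add: cong_add_rcancel)
    then have "[i = j] (mod int c)" using c(2) by (simp add: cong_mult_lcancel coprime_commute)
    then show "i = j" using ij(1,2) by (rule cong_range_eq)
  next
    fix n n' assume "[n = n'] (mod int c)"
    then show "echar c (b * n\<^sup>2) = echar c (b * n'\<^sup>2)"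
      by (intro echar_cong c cong_mult cong_pow cong_refl)
  qed (use c in auto)
  finally show ?thesis unfolding gauss_sum_def .
qed

text \<open>The units modulo 12 pair up as 1, -1 and 5, -5, leaving 2 cos (2 pi m / 12) - 2 cos (10
  pi m / 12), which is tabulated over the twelve residues of m. Primitivity shows in the vanishing
  at m not prime to 12.\<close>

lemma gauss_sum_chi12: "(\<Sum>u\<in>{0..<12}. of_int (chi12 u) * echar 12 (m * u)) = of_real (sqrt 12) * of_int (chi12 m)"
proof -
  define C where "C = (\<lambda>k::int. Re (echar 12 k))"
  have C_mod: "C k = C (k mod 12)" for k
    unfolding C_def by (subst echar_cong[of 12 k "k mod 12"]) (auto simp: cong_def)
  have C_uminus: "C (- k) = C k" for k by (simp add: C_def echar_def)
  have C_val: "C 0 = 1" "C 1 = sqrt 3 / 2" "C 2 = 1 / 2" "C 3 = 0" "C 4 = - 1 / 2" "C 5 = - (sqrt 3) / 2" "C 6 = - 1"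
  proof -
    show "C 0 = 1" "C 6 = - 1" by (simp_all add: C_def echar_def)
    show "C 1 = sqrt 3 / 2" using cos_30 by (simp add: C_def echar_def)
    show "C 2 = 1 / 2" using cos_60 by (simp add: C_def echar_def)
    have C: "C k = cos (2 * pi * of_int k / 12)" for k by (simp add: C_def echar_def)
    have "2 * pi * of_int 3 / 12 = pi / 2" by simp
    then show "C 3 = 0" unfolding C by (simp only: cos_pi_half)
    have "2 * pi * of_int 4 / 12 = pi - pi / 3" by simp
    then show "C 4 = - 1 / 2" unfolding C by (simp only: cos_pi_minus cos_60)
    have "2 * pi * of_int 5 / 12 = pi - pi / 6" by simp
    then show "C 5 = - (sqrt 3) / 2" unfolding C by (simp only: cos_pi_minus cos_30)
  qed
  have C_val': "C 7 = - (sqrt 3) / 2" "C 8 = - 1 / 2" "C 9 = 0" "C 10 = 1 / 2" "C 11 = sqrt 3 / 2"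
    using C_uminus[of 5] C_mod[of "-5"] C_uminus[of 4] C_mod[of "-4"] C_uminus[of 3] C_mod[of "-3"]
      C_uminus[of 2] C_mod[of "-2"] C_uminus[of 1] C_mod[of "-1"] C_val by simp_all
  have pair: "echar 12 k + echar 12 (- k) = of_real (2 * C k)" for k
    by (simp add: C_def echar_def complex_eq_iff)
  have "{0..<12::int} = {0, 1, 2, 3, 4, 5, 6, 7, 8, 9, 10, 11}" by (auto, presburger)
  then have "(\<Sum>u\<in>{0..<12}. of_int (chi12 u) * echar 12 (m * u))
     = (echar 12 (m * 1) + echar 12 (m * 11)) - (echar 12 (m * 5) + echar 12 (m * 7))"
    by (simp add: chi12_def)
  also have "echar 12 (m * 11) = echar 12 (- m)" by (rule echar_cong) (auto simp: cong_iff_dvd_diff)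
  also have "echar 12 (m * 7) = echar 12 (- (5 * m))" by (rule echar_cong) (auto simp: cong_iff_dvd_diff)
  also have "(echar 12 (m * 1) + echar 12 (- m)) - (echar 12 (m * 5) + echar 12 (- (5 * m))) = of_real (2 * C m - 2 * C (5 * m))"
    using pair[of m] pair[of "5 * m"] by (simp add: mult.commute)
  also have "2 * C m - 2 * C (5 * m) = sqrt 12 * of_int (chi12 m)"
  proof -
    have m5: "C (5 * m) = C ((5 * (m mod 12)) mod 12)" by (subst C_mod) (simp add: mod_mult_right_eq)
    have "sqrt 12 = 2 * sqrt 3" by (rule real_sqrt_unique) (simp_all add: power_mult_distrib)
    then show ?thesis unfolding m5 C_mod[of m] using mod_12_cases[of m]
      by (elim disjE) (simp_all add: chi12_def C_val C_val')
  qed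
  finally show ?thesis by simp
qed

text \<open>Chinese remainder theorem with r = c u + 12 v: the character sees c u modulo 12, the
  quadratic phase sees 12 v modulo c, and the linear phase splits additively. The sum becomes the
  product of the two preceding evaluations, and \<open>chi12 (int c)\<close> comes from the
  character at c u.\<close>

lemma twisted_gauss_sum:
  assumes c: "c > 0" "coprime (int c) 12" and b: "[576 * b * b' = -1] (mod int c)"
  shows "(\<Sum>r\<in>{0..<int (12 * c)}. of_int (chi12 r) * echar c (b * r\<^sup>2) * echar (12 * c) (m * r))
    = of_real (sqrt 12) * of_int (chi12 m) * of_int (chi12 (int c)) * echar c (b' * m\<^sup>2) * gauss_sum c b"
proof -
  define f where "f = (\<lambda>r. of_int (chi12 r) * echar c (b * r\<^sup>2) * echar (12 * c) (m * r))"
  define h where "h = (\<lambda>(u, v). int c * u + 12 * v)"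
  have cong_c: "[n = n'] (mod int c)" and cong_12: "[n = n'] (mod 12)" if "[n = n'] (mod int (12 * c))" for n n'
    using that by (auto simp: cong_iff_dvd_diff elim: dvd_mult_left dvd_mult_right)
  have "(\<Sum>p\<in>{0..<12} \<times> {0..<int c}. f (h p)) = (\<Sum>r\<in>{0..<int (12 * c)}. f r)"
  proof (rule sum_residues)
    show "12 * c > 0" using c by simp
    show "card ({0..<12::int} \<times> {0..<int c}) = 12 * c" by simp
    fix i j assume ij: "i \<in> {0..<12} \<times> {0..<int c}" "j \<in> {0..<12} \<times> {0..<int c}" "[h i = h j] (mod int (12 * c))"
    obtain u v u' v' where uv: "i = (u, v)" "j = (u', v')" by (cases i, cases j)
    have "[int c * u + 12 * v = int c * u' + 12 * v'] (mod 12)"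
      using cong_12[OF ij(3)] by (simp add: h_def uv)
    then have "[int c * u = int c * u'] (mod 12)"
      by (simp add: cong_def mod_add_eq[symmetric]) 
    then have "[u = u'] (mod 12)" using c(2) by (simp add: cong_mult_lcancel)
    moreover have "[int c * u + 12 * v = int c * u' + 12 * v'] (mod int c)"
      using cong_c[OF ij(3)] by (simp add: h_def uv)
    then have "[12 * v = 12 * v'] (mod int c)" by (simp add: cong_def)
    then have "[v = v'] (mod int c)" using c(2) by (simp add: cong_mult_lcancel coprime_commute)
    ultimately show "i = j" using ij(1,2) uv cong_range_eq by (metis SigmaD1 SigmaD2)
  next
    fix n n' assume nn: "[n = n'] (mod int (12 * c))"
    have "chi12 n = chi12 n'" by (rule chi12_cong[OF cong_12[OF nn]])
    moreover have "echar c (b * n\<^sup>2) = echar c (b * n'\<^sup>2)"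
      by (intro echar_cong c cong_mult cong_pow cong_refl cong_c[OF nn])
    moreover have "echar (12 * c) (m * n) = echar (12 * c) (m * n')"
      using c by (intro echar_cong cong_mult cong_refl nn) auto
    ultimately show "f n = f n'" by (simp add: f_def)
  qed auto
  also have "(\<Sum>p\<in>{0..<12} \<times> {0..<int c}. f (h p)) = (\<Sum>(u, v)\<in>{0..<12} \<times> {0..<int c}.
     of_int (chi12 (int c)) * ((of_int (chi12 u) * echar 12 (m * u)) * echar c (144 * b * v\<^sup>2 + m * v)))"
  proof (rule sum.cong[OF refl], safe)
    fix u v :: int
    have 1: "chi12 (int c * u + 12 * v) = chi12 (int c) * chi12 u"
      unfolding chi12_mult[symmetric] by (rule chi12_cong) (simp add: cong_def)
    have 2: "echar c (b * (int c * u + 12 * v)\<^sup>2) = echar c (144 * b * v\<^sup>2)"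
    proof (rule echar_cong[OF c(1)])
      have "b * (int c * u + 12 * v)\<^sup>2 - 144 * b * v\<^sup>2 = int c * (b * (int c * u\<^sup>2 + 24 * u * v))"
        by (simp add: power2_eq_square algebra_simps)
      then show "[b * (int c * u + 12 * v)\<^sup>2 = 144 * b * v\<^sup>2] (mod int c)"
        by (simp add: cong_iff_dvd_diff)
    qed
    have 3: "echar (12 * c) (m * (int c * u + 12 * v)) = echar 12 (m * u) * echar c (m * v)"
    proof -
      have "2 * pi * of_int (m * (int c * u + 12 * v)) / of_nat (12 * c)
          = 2 * pi * of_int (m * u) / of_nat 12 + 2 * pi * of_int (m * v) / of_nat c"
        using c(1) by (simp add: field_simps)
      then show ?thesis unfolding echar_def by (simp only: cis_mult)
    qed
    show "f (h (u, v)) = of_int (chi12 (int c)) * ((of_int (chi12 u) * echar 12 (m * u)) * echar c (144 * b * v\<^sup>2 + m * v))"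
      unfolding f_def h_def prod.case 1 2 3 by (simp add: echar_add)
  qed
  also have "\<dots> = of_int (chi12 (int c)) * ((\<Sum>u\<in>{0..<12}. of_int (chi12 u) * echar 12 (m * u)) *
      (\<Sum>v\<in>{0..<int c}. echar c (144 * b * v\<^sup>2 + m * v)))"
  proof -
    have "(\<Sum>(u, v)\<in>A \<times> B. k * (f u * g v)) = k * (sum f A * sum g B)"
      for A B :: "int set" and f g :: "int \<Rightarrow> complex" and k
      by (simp only: sum.cartesian_product[symmetric] sum_distrib_left[symmetric] sum_distrib_right[symmetric])
    then show ?thesis .
  qed
  also have "\<dots> = of_real (sqrt 12) * of_int (chi12 m) * of_int (chi12 (int c)) * echar c (b' * m\<^sup>2) * gauss_sum c b"
    unfolding gauss_sum_chi12 gauss_sum_complete_square[OF assms] by simp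
  finally show ?thesis unfolding f_def by simp
qed

lemma has_sum_sum:
  fixes f :: "'i \<Rightarrow> 'a \<Rightarrow> 'b :: topological_comm_monoid_add"
  assumes "finite I" "\<And>i. i \<in> I \<Longrightarrow> (f i has_sum s i) A"
  shows "((\<lambda>x. \<Sum>i\<in>I. f i x) has_sum (\<Sum>i\<in>I. s i)) A"
  using assms by (induction I rule: finite_induct) (auto intro!: has_sum_add)

text \<open>The coefficients of the theta series are periodic modulo 12 c. Once each class is
  transformed, the dual index m carries a twisted Gauss sum, whose values \<open>chi12 m\<close> and
  exp (2 pi i b' m^2 / c) reassemble to the theta series of \<open>eta\<close>, now shifted by 24 b'
  / c.\<close>

lemma eta_rational_imaginary:
  fixes y :: real
  assumes c: "c > 0" "coprime (int c) 12" and b: "[576 * b * b' = -1] (mod int c)" and y: "y > 0"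
  shows "eta (24 * of_int b / of_nat c + \<i> / of_real (c\<^sup>2 * y))
    = of_real (sqrt y) * of_int (chi12 (int c)) * gauss_sum c b * eta (\<i> * of_real y + 24 * of_int b' / of_nat c)"
proof -
  \<comment> \<open>Chosen so that the Gaussian factor exp (- 2 pi n^2 / (24 c^2 y)) is exp (- pi t
    (n / N)^2) with N = 12 c.\<close>
  define t where "t = 12 / y"
  have t: "t > 0" using y by (simp add: t_def)
  define N where "N = 12 * c"
  have N: "N > 0" using c by (simp add: N_def)
  define w where "w = (\<lambda>r. of_int (chi12 r) * echar c (b * r\<^sup>2))"
  define E where "E = (\<lambda>x::real. exp (- pi * t * x\<^sup>2))"
  have Im1: "Im (24 * of_int b / of_nat c + \<i> / of_real (c\<^sup>2 * y)) > 0"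
  proof -
    have "\<i> / complex_of_real (c\<^sup>2 * y) = \<i> * complex_of_real (1 / (c\<^sup>2 * y))" by simp
    moreover have "24 * of_int b / of_nat c = complex_of_real (24 * of_int b / of_nat c)" by simp
    ultimately show ?thesis using c y by (simp only: plus_complex.sel Im_complex_of_real Im_i_times Re_complex_of_real) simp
  qed
  have "((\<lambda>n::int. of_int (chi12 n) * qexp (of_int (n\<^sup>2) * (24 * of_int b / of_nat c + \<i> / of_real (c\<^sup>2 * y)) / 24))
     has_sum 2 * eta (24 * of_int b / of_nat c + \<i> / of_real (c\<^sup>2 * y))) UNIV"
    by (rule has_sum_eta[OF Im1])
  also have "(\<lambda>n::int. of_int (chi12 n) * qexp (of_int (n\<^sup>2) * (24 * of_int b / of_nat c + \<i> / of_real (c\<^sup>2 * y)) / 24))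
      = (\<lambda>n. w n * of_real (E (of_int n / N)))"
  proof
    fix n :: int
    have "of_int (n\<^sup>2) * (24 * of_int b / of_nat c + \<i> / of_real (c\<^sup>2 * y)) / 24
       = of_int (b * n\<^sup>2) / of_nat c + of_int (n\<^sup>2) * \<i> / of_real (24 * (c\<^sup>2 * y))"
      by (simp add: field_simps)
    moreover have "qexp (of_int (n\<^sup>2) * \<i> / of_real (24 * (c\<^sup>2 * y))) = of_real (E (of_int n / N))"
    proof -
      have "2 * of_real pi * \<i> * (of_int (n\<^sup>2) * \<i> / of_real (24 * (c\<^sup>2 * y))) = complex_of_real (- 2 * pi * (of_int n)\<^sup>2 / (24 * (c\<^sup>2 * y)))"
        by simp
      moreover have "- 2 * pi * (of_int n)\<^sup>2 / (24 * (c\<^sup>2 * y)) = - pi * t * (of_int n / N)\<^sup>2"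
        using c y by (simp add: t_def N_def power_divide power_mult_distrib)
      ultimately show ?thesis unfolding qexp_def E_def by (simp only: exp_of_real)
    qed
    ultimately show "of_int (chi12 n) * qexp (of_int (n\<^sup>2) * (24 * of_int b / of_nat c + \<i> / of_real (c\<^sup>2 * y)) / 24)
       = w n * of_real (E (of_int n / N))"
      by (simp only: qexp_add qexp_of_int_divide w_def mult.assoc)
  qed
  finally have 1: "((\<lambda>n. w n * of_real (E (of_int n / N))) has_sum 2 * eta (24 * of_int b / of_nat c + \<i> / of_real (c\<^sup>2 * y))) UNIV" .
  have w_periodic: "w (r + int N * k) = w r" for r k
  proof -
    have "[r + int N * k = r] (mod 12)" "[r + int N * k = r] (mod int c)"
      by (auto simp: N_def cong_iff_dvd_diff)
    then show ?thesis unfolding w_def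
      by (metis chi12_cong echar_cong c(1) cong_mult cong_pow cong_refl)
  qed
  have "((\<lambda>(r, k). w r * of_real (E (of_int k + of_int r / N))) has_sum 2 * eta (24 * of_int b / of_nat c + \<i> / of_real (c\<^sup>2 * y)))
     ({0..<int N} \<times> UNIV)"
  proof -
    have "((\<lambda>n. w n * of_real (E (of_int n / N))) has_sum 2 * eta (24 * of_int b / of_nat c + \<i> / of_real (c\<^sup>2 * y))) UNIV \<longleftrightarrow>
      ((\<lambda>(r, k). w r * of_real (E (of_int k + of_int r / N))) has_sum 2 * eta (24 * of_int b / of_nat c + \<i> / of_real (c\<^sup>2 * y)))
       ({0..<int N} \<times> UNIV)"
    proof (rule has_sum_reindex_bij_witness[of _ "\<lambda>(r, k). r + int N * k" "\<lambda>n. (n mod int N, n div int N)"])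
      fix n :: int
      have n: "n = n mod int N + int N * (n div int N)" by simp
      have "real_of_int n = of_int (n mod int N) + real N * of_int (n div int N)"
        by (subst n) (simp only: of_int_add of_int_mult of_int_of_nat_eq)
      then have "of_int (n div int N) + of_int (n mod int N) / real N = of_int n / N"
        using N by (simp add: field_simps)
      moreover have "w (n mod int N) = w n" using w_periodic[of "n mod int N" "n div int N"] by simp
      ultimately show "(case (n mod int N, n div int N) of (r, k) \<Rightarrow> w r * of_real (E (of_int k + of_int r / N))) = w n * of_real (E (of_int n / N))"
        by simp
    qed (use N in auto)
    then show ?thesis using 1 by blast
  qed
  note 2 = this
  have sw: "((\<lambda>(r, k). w r * of_real (E (of_int k + of_int r / N))) summable_on ({0..<int N} \<times> UNIV))"
    using 2 by (auto simp: summable_on_def)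
  define G where "G = (\<lambda>m::int. complex_of_real (exp (- pi * (of_int m)\<^sup>2 / t)))"
  define \<theta> where "\<theta> = (\<lambda>r::int. \<Sum>\<^sub>\<infinity>m::int. G m * echar N (m * r))"
  have inner: "(\<Sum>\<^sub>\<infinity>k::int. w r * of_real (E (of_int k + of_int r / N))) = of_real (1 / sqrt t) * (w r * \<theta> r)" for r
  proof -
    have "(\<Sum>\<^sub>\<infinity>k::int. w r * of_real (E (of_int k + of_int r / N))) = w r * (\<Sum>\<^sub>\<infinity>k::int. of_real (E (of_int k + of_int r / N)))"
      by (rule infsum_cmult_right')
    also have "(\<Sum>\<^sub>\<infinity>k::int. complex_of_real (E (of_int k + of_int r / N))) = of_real (1 / sqrt t) * \<theta> r"
    proof -
      have "2 * pi * of_int k * (of_int r / real N) = 2 * pi * of_int (k * r) / real N" for k by simp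
      then show ?thesis unfolding E_def \<theta>_def G_def echar_def by (simp only: theta_transformation[OF t])
    qed
    finally show ?thesis by simp
  qed
  have G_abs: "(\<lambda>m. norm (G m * echar N (m * r))) summable_on UNIV" for r
    using gaussian_summable[of "pi / t"] t by (simp add: G_def norm_mult echar_def)
  have \<theta>: "((\<lambda>m. G m * echar N (m * r)) has_sum \<theta> r) UNIV" for r
    unfolding \<theta>_def by (rule has_sum_infsum[OF abs_summable_summable[OF G_abs]])
  have "2 * eta (24 * of_int b / of_nat c + \<i> / of_real (c\<^sup>2 * y)) = (\<Sum>r\<in>{0..<int N}. of_real (1 / sqrt t) * (w r * \<theta> r))"
    using infsum_Sigma'_banach[OF sw] infsumI[OF 2] by (simp add: inner)
  also have "\<dots> = of_real (1 / sqrt t) * (\<Sum>r\<in>{0..<int N}. w r * \<theta> r)"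
    by (simp add: sum_distrib_left)
  also have "(\<Sum>r\<in>{0..<int N}. w r * \<theta> r) =
     of_real (sqrt 12) * of_int (chi12 (int c)) * gauss_sum c b * (2 * eta (\<i> * of_real y + 24 * of_int b' / of_nat c))"
  proof -
    have A: "((\<lambda>m. \<Sum>r\<in>{0..<int N}. w r * (G m * echar N (m * r))) has_sum (\<Sum>r\<in>{0..<int N}. w r * \<theta> r)) UNIV"
      by (intro has_sum_sum has_sum_cmult_right \<theta>) auto
    have Im2: "Im (\<i> * of_real y + 24 * of_int b' / of_nat c) > 0"
    proof -
      have "24 * of_int b' / of_nat c = complex_of_real (24 * of_int b' / of_nat c)" by simp
      then show ?thesis using y by (simp only: plus_complex.sel Im_complex_of_real Im_i_times Re_complex_of_real add_0_right)
    qed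
    have "((\<lambda>m::int. of_real (sqrt 12) * of_int (chi12 (int c)) * gauss_sum c b *
        (of_int (chi12 m) * qexp (of_int (m\<^sup>2) * (\<i> * of_real y + 24 * of_int b' / of_nat c) / 24))) has_sum
        of_real (sqrt 12) * of_int (chi12 (int c)) * gauss_sum c b * (2 * eta (\<i> * of_real y + 24 * of_int b' / of_nat c))) UNIV"
      by (intro has_sum_cmult_right has_sum_eta Im2)
    also have "(\<lambda>m::int. of_real (sqrt 12) * of_int (chi12 (int c)) * gauss_sum c b *
        (of_int (chi12 m) * qexp (of_int (m\<^sup>2) * (\<i> * of_real y + 24 * of_int b' / of_nat c) / 24)))
       = (\<lambda>m. \<Sum>r\<in>{0..<int N}. w r * (G m * echar N (m * r)))"
    proof
      fix m :: int
      have "of_int (m\<^sup>2) * (\<i> * of_real y + 24 * of_int b' / of_nat c) / 24 = of_int (b' * m\<^sup>2) / of_nat c + of_int (m\<^sup>2) * \<i> * of_real y / 24"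
        by (simp add: field_simps)
      moreover have "qexp (of_int (m\<^sup>2) * \<i> * of_real y / 24) = G m"
      proof -
        have "2 * of_real pi * \<i> * (of_int (m\<^sup>2) * \<i> * of_real y / 24) = complex_of_real (- pi * (of_int m)\<^sup>2 / t)"
          using y by (simp add: t_def)
        then show ?thesis unfolding qexp_def G_def by (simp only: exp_of_real)
      qed
      ultimately have q: "qexp (of_int (m\<^sup>2) * (\<i> * of_real y + 24 * of_int b' / of_nat c) / 24) = echar c (b' * m\<^sup>2) * G m"
        by (simp only: qexp_add qexp_of_int_divide)
      have "(\<Sum>r\<in>{0..<int N}. w r * (G m * echar N (m * r))) = G m * (\<Sum>r\<in>{0..<int N}. w r * echar N (m * r))"
        by (simp add: sum_distrib_left mult_ac)
      also have "(\<Sum>r\<in>{0..<int N}. w r * echar N (m * r)) = of_real (sqrt 12) * of_int (chi12 m) * of_int (chi12 (int c)) * echar c (b' * m\<^sup>2) * gauss_sum c b"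
        unfolding w_def N_def by (rule twisted_gauss_sum[OF c b])
      finally show "of_real (sqrt 12) * of_int (chi12 (int c)) * gauss_sum c b *
        (of_int (chi12 m) * qexp (of_int (m\<^sup>2) * (\<i> * of_real y + 24 * of_int b' / of_nat c) / 24))
        = (\<Sum>r\<in>{0..<int N}. w r * (G m * echar N (m * r)))"
        unfolding q by (simp add: mult_ac)
    qed
    finally show ?thesis using A has_sum_unique by blast
  qed
  also have "of_real (1 / sqrt t) * (of_real (sqrt 12) * of_int (chi12 (int c)) * gauss_sum c b * (2 * eta (\<i> * of_real y + 24 * of_int b' / of_nat c)))
     = complex_of_real (1 / sqrt t * sqrt 12) * (of_int (chi12 (int c)) * gauss_sum c b * (2 * eta (\<i> * of_real y + 24 * of_int b' / of_nat c)))"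
    by (simp only: of_real_mult mult.assoc)
  \<comment> \<open>The scaling of the theta formula and the absolute value of the Gauss sum modulo
    12 combine to the automorphy factor.\<close>
  also have "1 / sqrt t * sqrt 12 = sqrt y" using y by (simp add: t_def real_sqrt_divide)
  finally show ?thesis by simp
qed

lemma Im_rational_minus:
  assumes "c > 0" "Im z > 0"
  shows "Im (of_int a / of_nat c - 1 / ((of_nat c)\<^sup>2 * z)) > 0"
proof -
  have "of_int a / of_nat c = complex_of_real (of_int a / of_nat c)" by simp
  moreover have "1 / ((of_nat c)\<^sup>2 * z) = complex_of_real (- 1 / (real c)\<^sup>2) * (- 1 / z)" by simp
  ultimately show ?thesis using Im_minus_inverse_pos[OF assms(2)] assms(1)
    by (simp only: minus_complex.sel Im_complex_of_real Im_complex_of_real times_complex.sel Re_complex_of_real) (simp add: divide_neg_pos)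
qed

text \<open>Both sides are holomorphic in z, the root because - i z lies in the right half-plane,
  and they agree on the imaginary axis; the identity theorem extends the law. It is the modular law
  for a matrix with lower row (c, d), d = - 24 b', written in z = \<tau> + d / c so that c z = c
  \<tau> + d.\<close>

theorem eta_rational:
  assumes c: "c > 0" "coprime (int c) 12" and b: "[576 * b * b' = -1] (mod int c)" and z: "Im z > 0"
  shows "eta (24 * of_int b / of_nat c - 1 / ((of_nat c)\<^sup>2 * z))
    = csqrt (- \<i> * z) * of_int (chi12 (int c)) * gauss_sum c b * eta (z + 24 * of_int b' / of_nat c)"
proof -
  define H where "H = {z. Im z > 0}"
  define L where "L = (\<lambda>z. eta (24 * of_int b / of_nat c - 1 / ((of_nat c)\<^sup>2 * z)))"
  define R where "R = (\<lambda>z. csqrt (- \<i> * z) * of_int (chi12 (int c)) * gauss_sum c b * eta (z + 24 * of_int b' / of_nat c))"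
  have H: "open H" "connected H"
    unfolding H_def using open_upper_half convex_connected convex_halfspace_Im_gt by auto
  have eta_hol: "(\<lambda>z. eta (f z)) holomorphic_on H" if "f holomorphic_on H" "\<And>z. z \<in> H \<Longrightarrow> Im (f z) > 0" for f
    using holomorphic_on_compose_gen[OF that(1) holomorphic_eta] that(2) by (auto simp: o_def)
  have hL: "L holomorphic_on H"
    unfolding L_def
  proof (rule eta_hol)
    show "(\<lambda>z. 24 * of_int b / of_nat c - 1 / ((of_nat c)\<^sup>2 * z)) holomorphic_on H"
      using c by (intro holomorphic_intros) (auto simp: H_def)
    fix z assume "z \<in> H"
    then show "Im (24 * of_int b / of_nat c - 1 / ((of_nat c)\<^sup>2 * z)) > 0"
      using Im_rational_minus[OF c(1), of z "24 * b"] by (simp add: H_def)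
  qed
  have Im_b': "Im (24 * of_int b' / of_nat c) = 0"
  proof -
    have "24 * of_int b' / of_nat c = complex_of_real (24 * of_int b' / of_nat c)" by simp
    then show ?thesis by (simp only: Im_complex_of_real)
  qed
  have hR: "R holomorphic_on H"
    unfolding R_def
    by (intro holomorphic_intros eta_hol) (auto simp: H_def complex_nonpos_Reals_iff Im_b')
  have eq: "L (\<i> * of_real y) = R (\<i> * of_real y)" if y: "y > 0" for y :: real
  proof -
    have "- 1 / ((of_nat c)\<^sup>2 * (\<i> * of_real y)) = \<i> / complex_of_real ((real c)\<^sup>2 * y)"
      using c y by (simp add: field_simps)
    then have e: "24 * of_int b / of_nat c - 1 / ((of_nat c)\<^sup>2 * (\<i> * of_real y)) = 24 * of_int b / of_nat c + \<i> / complex_of_real ((real c)\<^sup>2 * y)"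
      by (simp only: diff_conv_add_uminus minus_divide_left)
    have s: "csqrt (- \<i> * (\<i> * of_real y)) = of_real (sqrt y)"
      using y by (simp add: csqrt_of_real_nonneg)
    show ?thesis unfolding L_def R_def e s by (rule eta_rational_imaginary[OF c b y])
  qed
  have "L z - R z = 0"
  proof (rule analytic_continuation[of "\<lambda>z. L z - R z" H "(\<lambda>y. \<i> * of_real y) ` {0<..}" \<i> z])
    show "(\<lambda>z. L z - R z) holomorphic_on H" by (intro holomorphic_intros hL hR)
    show "(\<lambda>y. \<i> * complex_of_real y) ` {0<..} \<subseteq> H" by (auto simp: H_def)
    show "\<i> islimpt (\<lambda>y. \<i> * complex_of_real y) ` {0<..}"
      unfolding islimpt_approachable
    proof (intro allI impI)
      fix e :: real assume e: "e > 0"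
      have "dist (\<i> * complex_of_real (1 + e / 2)) \<i> = norm (complex_of_real (e / 2))"
        by (simp add: dist_norm algebra_simps norm_mult norm_divide)
      also have "\<dots> < e" using e by simp
      finally show "\<exists>x'\<in>(\<lambda>y. \<i> * complex_of_real y) ` {0<..}. x' \<noteq> \<i> \<and> dist x' \<i> < e"
        using e by (intro bexI[of _ "\<i> * complex_of_real (1 + e / 2)"]) (auto simp: complex_eq_iff)
    qed
  qed (use H z eq in \<open>auto simp: H_def\<close>)
  then show ?thesis unfolding L_def R_def by simp
qed

text \<open>Modulus 1, where b = b' = 0 satisfies the congruence and the Gauss sum is 1.\<close>

lemma eta_inverse:
  assumes "Im z > 0"
  shows "eta (- 1 / z) = csqrt (- \<i> * z) * eta z"
  using eta_rational[of 1 0 0 z] assms by (simp add: gauss_sum_def echar_def chi12_def)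

lemma eta_plus_1: "eta (\<tau> + 1) = qexp (1 / 24) * eta \<tau>"
  using qexp_of_int[of 1] by (simp add: eta_def qexp_add add_divide_distrib)

lemma csqrt_nonzero: "Im z > 0 \<Longrightarrow> csqrt (- \<i> * z) \<noteq> 0"
  by auto

section \<open>Weakly holomorphic forms with the multiplier system of \<open>1 / \<eta>\<close>\<close>

text \<open>
  The coefficient \<open>a n\<close> belongs to \<open>q\<^bsup>n/24\<^esup>\<close>. The last clause is the transformation law of weight
  \<open>11/2\<close>, written with the automorphy factor of \<open>\<eta>\<close>.
\<close>

definition represents :: "(int \<Rightarrow> int) \<Rightarrow> (complex \<Rightarrow> complex) \<Rightarrow> bool" where
  "represents a D \<longleftrightarrow> D holomorphic_on {\<tau>. Im \<tau> > 0} \<and>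
     (\<forall>\<tau>. Im \<tau> > 0 \<longrightarrow> ((\<lambda>n. of_int (a n) * qexp (of_int n * \<tau> / 24)) has_sum D \<tau>) UNIV) \<and>
     (\<forall>\<tau>. Im \<tau> > 0 \<longrightarrow> csqrt (- \<i> * \<tau>) * D (- 1 / \<tau>) = \<tau> ^ 6 * D \<tau>)"

definition weak_form :: "(int \<Rightarrow> int) \<Rightarrow> bool" where
  "weak_form a \<longleftrightarrow> (\<exists>B. \<forall>n<B. a n = 0) \<and> (\<forall>n. a n \<noteq> 0 \<longrightarrow> n mod 24 = 23) \<and> (\<exists>D. represents a D)"

lemma represents_linear:
  assumes "represents a D" "represents b E"
  shows "represents (\<lambda>n. u * a n + v * b n) (\<lambda>\<tau>. of_int u * D \<tau> + of_int v * E \<tau>)"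
  unfolding represents_def
proof (intro conjI allI impI)
  show "(\<lambda>\<tau>. of_int u * D \<tau> + of_int v * E \<tau>) holomorphic_on {\<tau>. Im \<tau> > 0}"
    using assms by (auto simp: represents_def intro!: holomorphic_intros)
  fix \<tau> :: complex assume \<tau>: "Im \<tau> > 0"
  have "((\<lambda>n. of_int u * (of_int (a n) * qexp (of_int n * \<tau> / 24)) + of_int v * (of_int (b n) * qexp (of_int n * \<tau> / 24)))
     has_sum of_int u * D \<tau> + of_int v * E \<tau>) UNIV"
    using assms \<tau> by (intro has_sum_add has_sum_cmult_right) (auto simp: represents_def)
  then show "((\<lambda>n. of_int (u * a n + v * b n) * qexp (of_int n * \<tau> / 24)) has_sum of_int u * D \<tau> + of_int v * E \<tau>) UNIV"
    by (simp add: algebra_simps)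
  have "csqrt (- \<i> * \<tau>) * D (- 1 / \<tau>) = \<tau> ^ 6 * D \<tau>" "csqrt (- \<i> * \<tau>) * E (- 1 / \<tau>) = \<tau> ^ 6 * E \<tau>"
    using assms \<tau> by (auto simp: represents_def)
  moreover have "csqrt (- \<i> * \<tau>) * (of_int u * D (- 1 / \<tau>) + of_int v * E (- 1 / \<tau>))
      = of_int u * (csqrt (- \<i> * \<tau>) * D (- 1 / \<tau>)) + of_int v * (csqrt (- \<i> * \<tau>) * E (- 1 / \<tau>))"
    by (simp only: distrib_left mult.left_commute)
  ultimately show "csqrt (- \<i> * \<tau>) * (of_int u * D (- 1 / \<tau>) + of_int v * E (- 1 / \<tau>)) = \<tau> ^ 6 * (of_int u * D \<tau> + of_int v * E \<tau>)"
    by (simp only: distrib_left mult.left_commute)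
qed

lemma weak_form_linear:
  assumes "weak_form a" "weak_form b"
  shows "weak_form (\<lambda>n. u * a n + v * b n)"
proof -
  obtain A B D E where AB: "\<forall>n<A. a n = 0" "\<forall>n<B. b n = 0" and "represents a D" "represents b E"
    using assms by (auto simp: weak_form_def)
  then have "represents (\<lambda>n. u * a n + v * b n) (\<lambda>\<tau>. of_int u * D \<tau> + of_int v * E \<tau>)"
    by (intro represents_linear)
  moreover have "\<forall>n<min A B. u * a n + v * b n = 0" using AB by simp
  moreover have "n mod 24 = 23" if "u * a n + v * b n \<noteq> 0" for n
    using assms that by (cases "a n = 0") (auto simp: weak_form_def)
  ultimately show ?thesis unfolding weak_form_def by blast
qed

text \<open>All exponents are congruent to -1/24 modulo 1, so the translation multiplies every term
  by the same phase, inverse to that of \<open>eta\<close>.\<close>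

lemma represents_plus_1:
  assumes "represents a D" "\<And>n. a n \<noteq> 0 \<Longrightarrow> n mod 24 = 23" "Im \<tau> > 0"
  shows "D (\<tau> + 1) = qexp (- 1 / 24) * D \<tau>"
proof -
  have "((\<lambda>n. qexp (- 1 / 24) * (of_int (a n) * qexp (of_int n * \<tau> / 24))) has_sum qexp (- 1 / 24) * D \<tau>) UNIV"
    using assms by (intro has_sum_cmult_right) (auto simp: represents_def)
  also have "(\<lambda>n. qexp (- 1 / 24) * (of_int (a n) * qexp (of_int n * \<tau> / 24))) = (\<lambda>n. of_int (a n) * qexp (of_int n * (\<tau> + 1) / 24))"
  proof
    fix n
    show "qexp (- 1 / 24) * (of_int (a n) * qexp (of_int n * \<tau> / 24)) = of_int (a n) * qexp (of_int n * (\<tau> + 1) / 24)"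
    proof (cases "a n = 0")
      case False
      define k where "k = n div 24 + 1"
      have "n = 24 * k - 1" using assms(2)[OF False] unfolding k_def by presburger
      then have "of_int n = 24 * of_int k - (1 :: complex)" by simp
      then have "of_int n * (\<tau> + 1) / 24 = (- 1 / 24 + of_int n * \<tau> / 24) + of_int k"
        by (simp only:) (simp add: field_simps)
      then show ?thesis by (simp only: qexp_add qexp_of_int) simp
    qed simp
  qed
  finally have "((\<lambda>n. of_int (a n) * qexp (of_int n * (\<tau> + 1) / 24)) has_sum qexp (- 1 / 24) * D \<tau>) UNIV" .
  moreover have "((\<lambda>n. of_int (a n) * qexp (of_int n * (\<tau> + 1) / 24)) has_sum D (\<tau> + 1)) UNIV"
    using assms by (auto simp: represents_def)
  ultimately show ?thesis using has_sum_unique by blast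
qed

section \<open>Uniqueness of a form with given principal part\<close>

lemma fourier_bound:
  assumes D: "\<And>\<tau>. Im \<tau> > 0 \<Longrightarrow> ((\<lambda>n. of_int (a n) * qexp (of_int n * \<tau> / 24)) has_sum D \<tau>) UNIV"
    and a: "\<And>n. n < N \<Longrightarrow> a n = (0::int)"
  obtains M where "M \<ge> 0" "\<And>\<tau>. Im \<tau> \<ge> 1 \<Longrightarrow> norm (D \<tau>) \<le> M * exp (- (pi * of_int N * (Im \<tau> - 1) / 12))"
proof
  define t where "t = (\<lambda>\<tau> n. complex_of_int (a n) * qexp (of_int n * \<tau> / 24))"
  have nt: "norm (t \<tau> n) = of_int \<bar>a n\<bar> * exp (- (pi * of_int n * Im \<tau> / 12))" for \<tau> n
    by (simp add: t_def norm_mult norm_qexp)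
  have abs: "(\<lambda>n. norm (t \<tau> n)) summable_on UNIV" if "Im \<tau> > 0" for \<tau>
    unfolding t_def by (rule iffD1[OF summable_on_iff_abs_summable_on_complex has_sum_imp_summable[OF D[OF that]]])
  \<comment> \<open>The absolute sum at the point i. Moving up to height y multiplies the n-th term
    by exp (- pi n (y - 1) / 12), which for n \<ge> N is at most its value at n = N, so
    \<open>M\<close> serves all heights at least 1.\<close>
  define M where "M = (\<Sum>\<^sub>\<infinity>n. norm (t \<i> n))"
  show "M \<ge> 0" unfolding M_def by (intro infsum_nonneg) auto
  fix \<tau> assume \<tau>: "Im \<tau> \<ge> 1"
  then have \<tau>0: "Im \<tau> > 0" by simp
  have "norm (D \<tau>) \<le> (\<Sum>\<^sub>\<infinity>n. norm (t \<tau> n))"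
    using norm_infsum_bound[OF abs[OF \<tau>0]] infsumI[OF D[OF \<tau>0]] by (simp add: t_def)
  also have "\<dots> \<le> (\<Sum>\<^sub>\<infinity>n. norm (t \<i> n) * exp (- (pi * of_int N * (Im \<tau> - 1) / 12)))"
  proof (rule infsum_mono)
    show "(\<lambda>n. norm (t \<tau> n)) summable_on UNIV" by (rule abs[OF \<tau>0])
    show "(\<lambda>n. norm (t \<i> n) * exp (- (pi * of_int N * (Im \<tau> - 1) / 12))) summable_on UNIV"
      by (intro summable_on_cmult_left abs) simp
    fix n :: int
    show "norm (t \<tau> n) \<le> norm (t \<i> n) * exp (- (pi * of_int N * (Im \<tau> - 1) / 12))"
    proof (cases "n < N")
      case True then show ?thesis by (simp add: t_def a)
    next
      case False
      then have "real_of_int N * (Im \<tau> - 1) \<le> of_int n * (Im \<tau> - 1)"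
        using \<tau> by (intro mult_right_mono) auto
      then have "pi * (real_of_int N * (Im \<tau> - 1)) \<le> pi * (of_int n * (Im \<tau> - 1))"
        by (intro mult_left_mono) auto
      then have "- (pi * of_int n * Im \<tau> / 12) \<le> - (pi * of_int n / 12) + - (pi * of_int N * (Im \<tau> - 1) / 12)"
      proof -
        have "pi * of_int n * Im \<tau> / 12 = pi * of_int n / 12 + pi * (of_int n * (Im \<tau> - 1)) / 12"
          by (simp add: field_simps)
        moreover have "pi * of_int N * (Im \<tau> - 1) / 12 = pi * (of_int N * (Im \<tau> - 1)) / 12" by simp
        ultimately show ?thesis using \<open>pi * (real_of_int N * (Im \<tau> - 1)) \<le> pi * (of_int n * (Im \<tau> - 1))\<close> by linarith
      qed
      then have "exp (- (pi * of_int n * Im \<tau> / 12)) \<le> exp (- (pi * of_int n / 12)) * exp (- (pi * of_int N * (Im \<tau> - 1) / 12))"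
        by (simp only: exp_add[symmetric] exp_le_cancel_iff)
      then have "of_int \<bar>a n\<bar> * exp (- (pi * of_int n * Im \<tau> / 12)) \<le> of_int \<bar>a n\<bar> * (exp (- (pi * of_int n / 12)) * exp (- (pi * of_int N * (Im \<tau> - 1) / 12)))"
        by (rule mult_left_mono) simp
      then show ?thesis unfolding nt by simp
    qed
  qed
  also have "\<dots> = M * exp (- (pi * of_int N * (Im \<tau> - 1) / 12))"
    unfolding M_def by (rule infsum_cmult_left')
  finally show "norm (D \<tau>) \<le> M * exp (- (pi * of_int N * (Im \<tau> - 1) / 12))" .
qed

text \<open>The lowest nonzero term, of index N, equals minus the remaining series, which is O(exp
  (- pi (N + 1) y / 12)). A nonzero integer coefficient has absolute value at least 1, so this fails
  for large y.\<close>

lemma fourier_coeffs_zero: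
  assumes D: "\<And>\<tau>. Im \<tau> > 0 \<Longrightarrow> ((\<lambda>n. of_int (a n) * qexp (of_int n * \<tau> / 24)) has_sum 0) UNIV"
    and a: "\<And>n. n < B \<Longrightarrow> a n = (0::int)"
  shows "a n = 0"
proof (rule ccontr)
  assume "a n \<noteq> 0"
  then have ex: "\<exists>m::nat. a (B + int m) \<noteq> 0" using a[of n] by (intro exI[of _ "nat (n - B)"]) force
  define m where "m = (LEAST m. a (B + int m) \<noteq> 0)"
  define N where "N = B + int m"
  have N: "a N \<noteq> 0" using LeastI_ex[OF ex] by (simp add: N_def m_def)
  have below: "a k = 0" if "k < N" for k
  proof (cases "k < B")
    case False
    then have "nat (k - B) < m" using that by (simp add: N_def)
    from not_less_Least[OF this[unfolded m_def]] show ?thesis using False by simp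
  qed (rule a)
  define a' where "a' = (\<lambda>k. if k = N then 0 else a k)"
  have "((\<lambda>k. of_int (a' k) * qexp (of_int k * \<tau> / 24)) has_sum - (of_int (a N) * qexp (of_int N * \<tau> / 24))) UNIV"
    if "Im \<tau> > 0" for \<tau>
  proof -
    have "((\<lambda>k. if k = N then - (of_int (a N) * qexp (of_int N * \<tau> / 24)) else 0) has_sum - (of_int (a N) * qexp (of_int N * \<tau> / 24))) UNIV"
      by (rule has_sum_finite_neutralI[of "{N}"]) auto
    from has_sum_add[OF D[OF that] this]
    have "((\<lambda>k. of_int (a k) * qexp (of_int k * \<tau> / 24) + (if k = N then - (of_int (a N) * qexp (of_int N * \<tau> / 24)) else 0))
      has_sum - (of_int (a N) * qexp (of_int N * \<tau> / 24))) UNIV" by simp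
    then show ?thesis by (rule has_sum_cong[THEN iffD1, rotated]) (simp add: a'_def)
  qed
  then obtain M where M: "M \<ge> 0" "\<And>\<tau>. Im \<tau> \<ge> 1 \<Longrightarrow> norm (- (of_int (a N) * qexp (of_int N * \<tau> / 24))) \<le> M * exp (- (pi * of_int (N + 1) * (Im \<tau> - 1) / 12))"
    by (rule fourier_bound[of a' _ "N + 1"]) (auto simp: a'_def below)
  define K where "K = M * exp (pi * of_int (N + 1) / 12)"
  have bound: "1 \<le> K * exp (- (pi * y / 12))" if y: "y \<ge> 1" for y :: real
  proof -
    have "of_int \<bar>a N\<bar> * exp (- (pi * of_int N * y / 12)) \<le> M * exp (- (pi * of_int (N + 1) * (y - 1) / 12))"
      using M(2)[of "\<i> * of_real y"] y by (simp add: norm_mult norm_qexp mult_ac)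
    moreover have "exp (- (pi * of_int N * y / 12)) \<le> of_int \<bar>a N\<bar> * exp (- (pi * of_int N * y / 12))"
    proof -
      have "(1::real) \<le> of_int \<bar>a N\<bar>" using N by linarith
      from mult_right_mono[OF this, of "exp (- (pi * of_int N * y / 12))"] show ?thesis by simp
    qed
    ultimately have "exp (- (pi * of_int N * y / 12)) \<le> M * exp (- (pi * of_int (N + 1) * (y - 1) / 12))" by linarith
    then have "exp (- (pi * of_int N * y / 12)) * exp (pi * of_int N * y / 12) \<le> M * exp (- (pi * of_int (N + 1) * (y - 1) / 12)) * exp (pi * of_int N * y / 12)"
      by (rule mult_right_mono) simp
    moreover have "exp (- (pi * of_int N * y / 12)) * exp (pi * of_int N * y / 12) = 1"
      by (simp only: exp_add[symmetric]) simp
    moreover have "M * exp (- (pi * of_int (N + 1) * (y - 1) / 12)) * exp (pi * of_int N * y / 12) = K * exp (- (pi * y / 12))"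
      unfolding K_def mult.assoc exp_add[symmetric] by (rule arg_cong[of _ _ "\<lambda>x. M * exp x"]) (simp add: field_simps)
    ultimately show ?thesis by linarith
  qed
  have "((\<lambda>y. K * exp (- (pi * y / 12))) \<longlongrightarrow> K * 0) at_top"
    by (intro tendsto_mult tendsto_const) real_asymp
  then have "\<forall>\<^sub>F y in at_top. K * exp (- (pi * y / 12)) < 1"
    by (rule order_tendstoD) simp
  then have "\<forall>\<^sub>F y in at_top. K * exp (- (pi * y / 12)) < 1 \<and> y \<ge> 1"
    using eventually_ge_at_top[of 1] by (rule eventually_conj)
  then obtain y where "K * exp (- (pi * y / 12)) < 1" "y \<ge> 1"
    unfolding eventually_at_top_linorder by blast
  then show False using bound[of y] by linarith
qed

lemma shift_invariant_int:
  assumes "\<And>\<tau>. Im \<tau> > 0 \<Longrightarrow> f (\<tau> + 1) = f \<tau>" "Im \<tau> > 0"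
  shows "f (\<tau> + of_int n) = f \<tau>"
proof -
  have nat: "f (\<sigma> + of_nat k) = f \<sigma>" if "Im \<sigma> > 0" for \<sigma> k
  proof (induction k)
    case (Suc k)
    have "f (\<sigma> + of_nat k + 1) = f (\<sigma> + of_nat k)" using that by (intro assms) simp
    then show ?case using Suc by (simp add: add_ac)
  qed simp
  show ?thesis
  proof (cases n rule: int_cases2)
    case (nonneg k) then show ?thesis using nat[OF assms(2), of k] by simp
  next
    case (nonpos k) then show ?thesis using nat[of "\<tau> - of_nat k" k] assms(2) by simp
  qed
qed

text \<open>Repeating a translation into \<open>|Re| \<le> 1/2\<close> and the inversion at least doubles the imaginary
  part until it exceeds \<open>1/2\<close>.\<close>

lemma reduction_to_strip:
  assumes f1: "\<And>\<tau>. Im \<tau> > 0 \<Longrightarrow> f (\<tau> + 1) = f \<tau>"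
    and fS: "\<And>\<tau>. Im \<tau> > 0 \<Longrightarrow> f (- 1 / \<tau>) = f \<tau>"
    and \<tau>: "Im \<tau> > 0"
  obtains \<sigma> where "\<bar>Re \<sigma>\<bar> \<le> 1 / 2" "Im \<sigma> \<ge> 1 / 2" "f \<sigma> = f \<tau>"
proof -
  have "\<exists>\<sigma>. \<bar>Re \<sigma>\<bar> \<le> 1 / 2 \<and> Im \<sigma> \<ge> 1 / 2 \<and> f \<sigma> = f \<tau>" if "Im \<tau> \<ge> (1 / 2) ^ Suc n" for n \<tau>
    using that
  proof (induction n arbitrary: \<tau>)
    case 0
    then have "Im \<tau> \<ge> 1 / 2" by simp
    moreover have "f (\<tau> + of_int (- round (Re \<tau>))) = f \<tau>"
      using calculation by (intro shift_invariant_int f1) auto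
    moreover have "\<bar>Re (\<tau> + of_int (- round (Re \<tau>)))\<bar> \<le> 1 / 2"
      using of_int_round_abs_le[of "Re \<tau>"] by (simp add: abs_minus_commute)
    ultimately show ?case by (intro exI[of _ "\<tau> + of_int (- round (Re \<tau>))"]) simp
  next
    case (Suc n)
    have pos: "Im \<tau> > 0" using Suc.prems by (smt (verit) half_gt_zero zero_less_one zero_less_power)
    define \<sigma> where "\<sigma> = \<tau> + of_int (- round (Re \<tau>))"
    have f\<sigma>: "f \<sigma> = f \<tau>" unfolding \<sigma>_def by (intro shift_invariant_int f1 pos) auto
    have Re: "\<bar>Re \<sigma>\<bar> \<le> 1 / 2"
      using of_int_round_abs_le[of "Re \<tau>"] by (simp add: abs_minus_commute \<sigma>_def)
    have Im: "Im \<sigma> = Im \<tau>" by (simp add: \<sigma>_def)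
    show ?case
    proof (cases "Im \<sigma> \<ge> 1 / 2")
      case True
      then show ?thesis using Re f\<sigma> by blast
    next
      case False
      define y where "y = Im \<sigma>"
      have y: "0 < y" "y < 1 / 2" using False pos Im by (auto simp: y_def)
      have "\<bar>Re \<sigma>\<bar>\<^sup>2 \<le> (1 / 2)\<^sup>2" using Re by (intro power_mono) auto
      moreover have "y\<^sup>2 \<le> (1 / 2)\<^sup>2" using y by (intro power_mono) auto
      ultimately have le: "(Re \<sigma>)\<^sup>2 + y\<^sup>2 \<le> 1 / 2" by (simp add: power2_eq_square)
      have pos': "(Re \<sigma>)\<^sup>2 + y\<^sup>2 > 0" using y by (simp add: sum_power2_gt_zero_iff)
      have "Im (- 1 / \<sigma>) = y / ((Re \<sigma>)\<^sup>2 + y\<^sup>2)" by (simp add: Im_divide y_def)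
      also have "\<dots> \<ge> y / (1 / 2)" using le pos' y by (intro divide_left_mono) auto
      finally have "Im (- 1 / \<sigma>) \<ge> 2 * y" by simp
      moreover have "2 * y \<ge> (1 / 2) ^ Suc n" using Suc.prems Im by (simp add: y_def)
      ultimately have "Im (- 1 / \<sigma>) \<ge> (1 / 2) ^ Suc n" by linarith
      then obtain \<rho> where "\<bar>Re \<rho>\<bar> \<le> 1 / 2" "Im \<rho> \<ge> 1 / 2" "f \<rho> = f (- 1 / \<sigma>)"
        using Suc.IH by blast
      moreover have "f (- 1 / \<sigma>) = f \<sigma>" using y by (intro fS) (simp add: y_def)
      ultimately show ?thesis using f\<sigma> by metis
    qed
  qed
  note strip = this
  obtain n where "(1 / 2) ^ n < Im \<tau>" using real_arch_pow_inv[OF \<tau>, of "1 / 2"] by auto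
  moreover have "(1 / 2 :: real) ^ Suc n \<le> (1 / 2) ^ n" by simp
  ultimately have "(1 / 2) ^ Suc n \<le> Im \<tau>" by linarith
  from strip[OF this] show thesis using that by blast
qed

text \<open>The half-strip |Re| \<le> 1/2, Im \<ge> 1/2 stands in for a fundamental domain. Above
  height Y the function is smaller than at the given point, and the part below is compact, so
  |\<phi>| attains its maximum over the half-plane. The maximum principle makes \<phi> constant,
  against the decay.\<close>

lemma invariant_vanishing_at_infinity_imp_zero:
  assumes hol: "\<phi> holomorphic_on {\<tau>. Im \<tau> > 0}"
    and f1: "\<And>\<tau>. Im \<tau> > 0 \<Longrightarrow> norm (\<phi> (\<tau> + 1)) = norm (\<phi> \<tau>)"
    and fS: "\<And>\<tau>. Im \<tau> > 0 \<Longrightarrow> norm (\<phi> (- 1 / \<tau>)) = norm (\<phi> \<tau>)"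
    and lim: "\<And>e. e > 0 \<Longrightarrow> \<exists>Y. \<forall>\<tau>. Im \<tau> \<ge> Y \<longrightarrow> norm (\<phi> \<tau>) < e"
    and \<tau>0: "Im \<tau>0 > 0"
  shows "\<phi> \<tau>0 = 0"
proof (rule ccontr)
  assume nz: "\<phi> \<tau>0 \<noteq> 0"
  then obtain Y0 where Y0: "\<And>\<tau>. Im \<tau> \<ge> Y0 \<Longrightarrow> norm (\<phi> \<tau>) < norm (\<phi> \<tau>0)"
    using lim[of "norm (\<phi> \<tau>0)"] by auto
  define Y where "Y = max 1 Y0"
  have Y: "norm (\<phi> \<tau>) < norm (\<phi> \<tau>0)" if "Im \<tau> \<ge> Y" for \<tau> using Y0[of \<tau>] that by (simp add: Y_def)
  define K where "K = cbox (Complex (- 1 / 2) (1 / 2)) (Complex (1 / 2) Y)"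
  have K: "\<tau> \<in> K \<longleftrightarrow> \<bar>Re \<tau>\<bar> \<le> 1 / 2 \<and> 1 / 2 \<le> Im \<tau> \<and> Im \<tau> \<le> Y" for \<tau>
    by (auto simp: K_def in_cbox_complex_iff)
  have "compact K" by (simp add: K_def)
  moreover have "Complex 0 1 \<in> K" by (simp add: K Y_def)
  then have "K \<noteq> {}" by blast
  moreover have "continuous_on K (\<lambda>\<tau>. norm (\<phi> \<tau>))"
    by (intro continuous_intros continuous_on_subset[OF holomorphic_on_imp_continuous_on[OF hol]]) (auto simp: K)
  ultimately obtain p where p: "p \<in> K" "\<And>\<tau>. \<tau> \<in> K \<Longrightarrow> norm (\<phi> \<tau>) \<le> norm (\<phi> p)"
    using continuous_attains_sup by metis
  have red: "\<exists>\<sigma>. \<bar>Re \<sigma>\<bar> \<le> 1 / 2 \<and> Im \<sigma> \<ge> 1 / 2 \<and> norm (\<phi> \<sigma>) = norm (\<phi> \<tau>)" if "Im \<tau> > 0" for \<tau>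
    using reduction_to_strip[of "\<lambda>\<tau>. norm (\<phi> \<tau>)" \<tau>] f1 fS that by metis
  have p0: "norm (\<phi> \<tau>0) \<le> norm (\<phi> p)"
  proof -
    obtain \<sigma> where \<sigma>: "\<bar>Re \<sigma>\<bar> \<le> 1 / 2" "Im \<sigma> \<ge> 1 / 2" "norm (\<phi> \<sigma>) = norm (\<phi> \<tau>0)" using red[OF \<tau>0] by blast
    then have "\<not> Im \<sigma> \<ge> Y" using Y by fastforce
    then have "\<sigma> \<in> K" using \<sigma> by (simp add: K)
    then show ?thesis using p(2) \<sigma>(3) by metis
  qed
  have max: "norm (\<phi> \<tau>) \<le> norm (\<phi> p)" if \<tau>: "Im \<tau> > 0" for \<tau>
  proof -
    obtain \<sigma> where \<sigma>: "\<bar>Re \<sigma>\<bar> \<le> 1 / 2" "Im \<sigma> \<ge> 1 / 2" "norm (\<phi> \<sigma>) = norm (\<phi> \<tau>)" using red[OF \<tau>] by blast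
    show ?thesis
    proof (cases "Im \<sigma> \<ge> Y")
      case True then show ?thesis using Y[of \<sigma>] p0 \<sigma>(3) by linarith
    next
      case False
      then have "\<sigma> \<in> K" using \<sigma> by (simp add: K)
      then show ?thesis using p(2) \<sigma>(3) by metis
    qed
  qed
  have "\<phi> constant_on {\<tau>. Im \<tau> > 0}"
  proof (rule maximum_modulus_principle[OF hol])
    show "connected {\<tau>. Im \<tau> > 0}" using convex_connected convex_halfspace_Im_gt by auto
    show "p \<in> {\<tau>. Im \<tau> > 0}" using p(1) by (simp add: K)
  qed (use max open_upper_half in auto)
  then have "\<phi> (Complex 0 (max 1 Y)) = \<phi> \<tau>0" using \<tau>0 by (auto simp: constant_on_def)
  then show False using Y[of "Complex 0 (max 1 Y)"] by simp
qed

lemma weak_form_eq_0: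
  assumes a: "weak_form a" and neg: "\<And>n. n < 0 \<Longrightarrow> a n = 0"
  shows "a n = 0"
proof -
  obtain D where D: "represents a D" using a by (auto simp: weak_form_def)
  have a24: "k mod 24 = 23" if "a k \<noteq> 0" for k using a that by (auto simp: weak_form_def)
  \<comment> \<open>Nonnegative indices congruent to 23 modulo 24 start at 23, so D =
    O(q^(23/24)).\<close>
  have low: "a k = 0" if "k < 23" for k
  proof (rule ccontr)
    assume "a k \<noteq> 0"
    then have "k mod 24 = 23" "k \<ge> 0" using a24 neg[of k] by force+
    then show False using that by presburger
  qed
  have hol: "D holomorphic_on {\<tau>. Im \<tau> > 0}"
    and sum: "\<And>\<tau>. Im \<tau> > 0 \<Longrightarrow> ((\<lambda>n. of_int (a n) * qexp (of_int n * \<tau> / 24)) has_sum D \<tau>) UNIV"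
    and S: "\<And>\<tau>. Im \<tau> > 0 \<Longrightarrow> csqrt (- \<i> * \<tau>) * D (- 1 / \<tau>) = \<tau> ^ 6 * D \<tau>"
    using D by (auto simp: represents_def)
  \<comment> \<open>The weights 2 * 11/2 and 22 * 1/2 cancel, and the order at the cusp is at least
    46/24 - 22/24 = 1.\<close>
  define \<phi> where "\<phi> = (\<lambda>\<tau>. D \<tau> ^ 2 / eta \<tau> ^ 22)"
  obtain M where M: "M \<ge> 0" "\<And>\<tau>. Im \<tau> \<ge> 1 \<Longrightarrow> norm (D \<tau>) \<le> M * exp (- (pi * of_int 23 * (Im \<tau> - 1) / 12))"
    by (rule fourier_bound[of a D 23]) (use sum low in auto)
  have zero: "\<phi> \<tau> = 0" if \<tau>: "Im \<tau> > 0" for \<tau>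
  proof (rule invariant_vanishing_at_infinity_imp_zero[OF _ _ _ _ \<tau>])
    show "\<phi> holomorphic_on {\<tau>. Im \<tau> > 0}"
      unfolding \<phi>_def by (intro holomorphic_intros hol holomorphic_eta) (auto simp: eta_nonzero)
    fix \<tau> :: complex assume \<tau>: "Im \<tau> > 0"
    show "norm (\<phi> (\<tau> + 1)) = norm (\<phi> \<tau>)"
      using represents_plus_1[OF D a24 \<tau>] by (simp add: \<phi>_def eta_plus_1 norm_divide norm_power norm_mult norm_qexp)
    show "norm (\<phi> (- 1 / \<tau>)) = norm (\<phi> \<tau>)"
    proof -
      have t: "norm \<tau> > 0" using \<tau> by auto
      define s where "s = norm (csqrt (- \<i> * \<tau>))"
      have s: "s ^ 2 = norm \<tau>" by (simp add: s_def norm_mult)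
      have "(s * norm (D (- 1 / \<tau>)))\<^sup>2 = (norm \<tau> ^ 6 * norm (D \<tau>))\<^sup>2"
        using arg_cong[OF S[OF \<tau>], of norm] by (simp add: norm_mult norm_power s_def)
      moreover have "(norm \<tau> ^ 6)\<^sup>2 = norm \<tau> * norm \<tau> ^ 11" by (simp flip: power_mult power_Suc)
      ultimately have "norm \<tau> * norm (D (- 1 / \<tau>)) ^ 2 = norm \<tau> * (norm \<tau> ^ 11 * norm (D \<tau>) ^ 2)"
        by (simp only: power_mult_distrib s mult.assoc)
      then have 1: "norm (D (- 1 / \<tau>)) ^ 2 = norm \<tau> ^ 11 * norm (D \<tau>) ^ 2" using t by simp
      have "norm (eta (- 1 / \<tau>)) ^ 22 = (s ^ 2) ^ 11 * norm (eta \<tau>) ^ 22"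
        unfolding eta_inverse[OF \<tau>] norm_mult s_def[symmetric] power_mult_distrib by (simp flip: power_mult)
      then have 2: "norm (eta (- 1 / \<tau>)) ^ 22 = norm \<tau> ^ 11 * norm (eta \<tau>) ^ 22" unfolding s .
      show ?thesis unfolding \<phi>_def norm_divide norm_power 1 2 using t by simp
    qed
  next
    fix e :: real assume e: "e > 0"
    \<comment> \<open>Near q = 0 the Euler product exceeds 1/2 in absolute value, which bounds |eta|
      from below by half of |q|^(1/24) high in the half-plane.\<close>
    have "continuous (at 0) (eval_fps (cfps euler_product))"
      by (rule continuous_eval_fps) (use fps_conv_radius_gt[OF fps_conv_radius_euler_product, of "0 :: complex"] in auto)
    moreover have "eval_fps (cfps euler_product) 0 = 1"
      using fps_nth_euler_product_pent[of 1] by (simp add: eval_fps_at_0 chi12_def pent_def)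
    ultimately have "((\<lambda>z. norm (eval_fps (cfps euler_product) z)) \<longlongrightarrow> 1) (at 0)"
      using tendsto_norm[of "eval_fps (cfps euler_product)"] by (force simp: continuous_at)
    then have "\<forall>\<^sub>F z in at 0. norm (eval_fps (cfps euler_product) z) > 1 / 2"
      by (rule order_tendstoD) simp
    then obtain d where d: "d > 0" "\<And>z. z \<noteq> 0 \<Longrightarrow> norm z < d \<Longrightarrow> norm (eval_fps (cfps euler_product) z) > 1 / 2"
      unfolding eventually_at by auto
    have "((\<lambda>y. exp (- 2 * pi * y)) \<longlongrightarrow> 0) at_top" by real_asymp
    then have ev1: "\<forall>\<^sub>F y in at_top. exp (- 2 * pi * y) < d" using d by (intro order_tendstoD)
    have "((\<lambda>y. M\<^sup>2 * 2 ^ 22 * exp (pi * 46 / 12 - 2 * pi * y)) \<longlongrightarrow> M\<^sup>2 * 2 ^ 22 * 0) at_top"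
      by (intro tendsto_mult tendsto_const) real_asymp
    then have ev2: "\<forall>\<^sub>F y in at_top. M\<^sup>2 * 2 ^ 22 * exp (pi * 46 / 12 - 2 * pi * y) < e" using e by (intro order_tendstoD) auto
    have "\<forall>\<^sub>F y in at_top. exp (- 2 * pi * y) < d \<and> M\<^sup>2 * 2 ^ 22 * exp (pi * 46 / 12 - 2 * pi * y) < e \<and> y \<ge> 1"
      using ev1 ev2 eventually_ge_at_top[of 1] by eventually_elim auto
    then obtain Y where Y: "\<And>y. y \<ge> Y \<Longrightarrow> exp (- 2 * pi * y) < d \<and> M\<^sup>2 * 2 ^ 22 * exp (pi * 46 / 12 - 2 * pi * y) < e \<and> y \<ge> 1"
      unfolding eventually_at_top_linorder by blast
    have "norm (\<phi> \<tau>) < e" if "Im \<tau> \<ge> Y" for \<tau>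
    proof -
      define y where "y = Im \<tau>"
      have y: "exp (- 2 * pi * y) < d" "M\<^sup>2 * 2 ^ 22 * exp (pi * 46 / 12 - 2 * pi * y) < e" "y \<ge> 1" using Y[of y] that by (auto simp: y_def)
      have "norm (eval_fps (cfps euler_product) (qexp \<tau>)) > 1 / 2"
        using y by (intro d) (auto simp: norm_qexp y_def)
      then have "norm (eta \<tau>) \<ge> exp (- (pi * y / 12)) * (1 / 2)"
        unfolding eta_def norm_mult by (intro mult_mono) (auto simp: norm_qexp y_def)
      then have "norm (eta \<tau>) ^ 22 \<ge> (exp (- (pi * y / 12)) * (1 / 2)) ^ 22" by (intro power_mono) auto
      moreover have "(exp (- (pi * y / 12)) * (1 / 2)) ^ 22 = exp (- (22 * (pi * y / 12))) / 2 ^ 22"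
        by (simp only: power_mult_distrib exp_of_nat_mult[symmetric] power_one_over) simp
      ultimately have eta_ge: "norm (eta \<tau>) ^ 22 \<ge> exp (- (22 * (pi * y / 12))) / 2 ^ 22" by (simp only:)
      have "norm (D \<tau>) ^ 2 \<le> (M * exp (- (pi * of_int 23 * (y - 1) / 12))) ^ 2"
        using M(2)[of \<tau>] y by (intro power_mono) (auto simp: y_def)
      also have "\<dots> = M\<^sup>2 * exp (- (46 * (pi * (y - 1) / 12)))"
        by (simp only: power_mult_distrib exp_of_nat_mult[symmetric]) simp
      finally have D_le: "norm (D \<tau>) ^ 2 \<le> M\<^sup>2 * exp (- (46 * (pi * (y - 1) / 12)))" .
      have "norm (\<phi> \<tau>) = norm (D \<tau>) ^ 2 / norm (eta \<tau>) ^ 22" by (simp add: \<phi>_def norm_divide norm_power)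
      also have "\<dots> \<le> M\<^sup>2 * exp (- (46 * (pi * (y - 1) / 12))) / (exp (- (22 * (pi * y / 12))) / 2 ^ 22)"
        by (rule frac_le[OF _ D_le _ eta_ge]) auto
      also have "\<dots> = M\<^sup>2 * 2 ^ 22 * (exp (- (46 * (pi * (y - 1) / 12))) / exp (- (22 * (pi * y / 12))))"
        by simp
      also have "exp (- (46 * (pi * (y - 1) / 12))) / exp (- (22 * (pi * y / 12))) = exp (pi * 46 / 12 - 2 * pi * y)"
        unfolding exp_diff[symmetric] by (rule arg_cong[of _ _ exp]) (simp add: field_simps)
      finally show ?thesis using y by linarith
    qed
    then show "\<exists>Y. \<forall>\<tau>. Im \<tau> \<ge> Y \<longrightarrow> norm (\<phi> \<tau>) < e" by blast
  qed
  have "D \<tau> = 0" if "Im \<tau> > 0" for \<tau>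
    using zero[OF that] eta_nonzero[OF that] by (simp add: \<phi>_def)
  then show ?thesis
    using fourier_coeffs_zero[of a 23 n] sum low by auto
qed

lemma csqrt_scale: 
  assumes "l > 0"
  shows "csqrt ((of_nat l)\<^sup>2 * w) = of_nat l * csqrt w"
proof (rule csqrt_unique)
  show "(of_nat l * csqrt w)\<^sup>2 = (of_nat l)\<^sup>2 * w" by (simp add: power_mult_distrib)
  show "0 < Re (of_nat l * csqrt w) \<or> Re (of_nat l * csqrt w) = 0 \<and> 0 \<le> Im (of_nat l * csqrt w)"
    using csqrt_principal[of w] assms by auto
qed

text \<open>- i (-1/\<tau>) is the inverse of - i \<tau>, and the principal root commutes with
  inverses off the negative real axis. This allows a transformation law to be read
  backwards.\<close>

lemma csqrt_involution:
  assumes "Im \<tau> > 0"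
  shows "csqrt (- \<i> * \<tau>) * csqrt (- \<i> * (- 1 / \<tau>)) = 1"
proof -
  have "\<tau> \<noteq> 0" using assms by auto
  then have "- \<i> * (- 1 / \<tau>) = inverse (- \<i> * \<tau>)" by (simp add: field_simps)
  moreover have "- \<i> * \<tau> \<notin> \<real>\<^sub>\<le>\<^sub>0" using assms by (auto simp: complex_nonpos_Reals_iff)
  ultimately show ?thesis using csqrt_nonzero[OF assms] by (simp only: csqrt_inverse right_inverse not_False_eq_True)
qed

section \<open>Hecke operators\<close>

text \<open>Induction along the continued fraction of \<open>a / c\<close>.\<close>

lemma weight6_rational:
  fixes h :: "complex \<Rightarrow> complex"
  assumes h1: "\<And>\<tau>. Im \<tau> > 0 \<Longrightarrow> h (\<tau> + 1) = h \<tau>"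
    and hS: "\<And>\<tau>. Im \<tau> > 0 \<Longrightarrow> h (- 1 / \<tau>) = \<tau> ^ 6 * h \<tau>"
    and c: "c > 0" and ad: "[a * d = 1] (mod int c)" and z: "Im z > 0"
  shows "h (of_int a / of_nat c - 1 / ((of_nat c)\<^sup>2 * z)) = (of_nat c * z) ^ 6 * h (z - of_int d / of_nat c)"
  using c ad z
proof (induction c arbitrary: a d z rule: less_induct)
  case (less c)
  note c = \<open>c > 0\<close> and ad = \<open>[a * d = 1] (mod int c)\<close> and z = \<open>Im z > 0\<close>
  \<comment> \<open>With \<tau> = z - d / c the left argument is the image of \<tau> under a modular
    matrix with first column (a, c) and lower right entry d, and c z is its automorphy factor c
    \<tau> + d. Reducing a modulo c is a translation; the inversion replaces the denominator c by
    the smaller a0.\<close>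
  define a0 where "a0 = nat (a mod int c)"
  have a0: "int a0 = a mod int c" using c by (simp add: a0_def)
  have a: "a = int a0 + int c * (a div int c)" using a0 by simp
  have a0c: "a0 < c" using c a0 by (metis of_nat_0_less_iff of_nat_less_iff pos_mod_bound)
  define w where "w = of_nat a0 / of_nat c - 1 / ((of_nat c)\<^sup>2 * z)"
  have z0: "z \<noteq> 0" using z by auto
  have w: "Im w > 0" using Im_rational_minus[OF c z, of "int a0"] by (simp add: w_def)
  have "of_int a = of_nat a0 + of_nat c * (of_int (a div int c) :: complex)"
    by (subst a) simp
  then have "of_int a / of_nat c - 1 / ((of_nat c)\<^sup>2 * z) = w + of_int (a div int c)"
    using c by (simp add: w_def field_simps)
  then have red: "h (of_int a / of_nat c - 1 / ((of_nat c)\<^sup>2 * z)) = h w"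
    using shift_invariant_int[of h, OF h1 w] by simp
  have ad0: "[int a0 * d = 1] (mod int c)" using ad unfolding a0 by (simp add: cong_def mod_mult_left_eq)
  show ?case
  proof (cases "a0 = 0")
    case True
    then have "int c dvd 1" using ad0 by (simp add: cong_iff_dvd_diff)
    then have c1: "c = 1" by simp
    have "h (z + of_int (- d)) = h z" by (rule shift_invariant_int[of h, OF h1 z])
    then show ?thesis unfolding red using hS[OF z] by (simp add: w_def True c1)
  next
    case False
    obtain m where m: "int a0 * d = 1 + int c * m"
      using ad0 by (metis cong_iff_lin cong_sym)
    define z' where "z' = z - 1 / (of_nat a0 * of_nat c)"
    have "1 / (of_nat a0 * of_nat c) = complex_of_real (1 / (real a0 * real c))" by simp
    then have z': "Im z' > 0" using z unfolding z'_def by (simp only: minus_complex.sel Im_complex_of_real diff_0_right)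
    have z'0: "z' \<noteq> 0" using z' by auto
    have az': "of_nat a0 * z' = of_nat a0 * z - 1 / of_nat c" using False by (simp add: z'_def right_diff_distrib)
    have weq: "w = of_nat a0 * z' / (of_nat c * z)"
      unfolding az' w_def using c z0 by (simp add: diff_divide_distrib power2_eq_square)
    have winv: "- 1 / w = of_int (- int c) / of_nat a0 - 1 / ((of_nat a0)\<^sup>2 * z')"
    proof -
      have "of_nat c * (of_nat a0 * z') + 1 = of_nat a0 * (of_nat c * z)"
        unfolding az' using c by (simp add: right_diff_distrib)
      then have cz: "of_nat c * z = (of_nat c * (of_nat a0 * z') + 1) / of_nat a0" using False by simp
      have "- 1 / w = - (of_nat c * z) / (of_nat a0 * z')" unfolding weq by simp
      moreover have "- ((C * (A * Z) + 1) / A) / (A * Z) = - C / A - 1 / (A\<^sup>2 * Z)" if "A \<noteq> 0" "Z \<noteq> 0" for A C Z :: complex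
        using that by (simp add: field_simps power2_eq_square)
      ultimately show ?thesis using False z'0 unfolding cz by simp
    qed
    \<comment> \<open>After the inversion the fraction is - c / a0, and a0 d - c m = 1 shows that m
      is the inverse required by the induction hypothesis.\<close>
    have "[- int c * m = 1] (mod int a0)"
    proof -
      have "- int c * m - 1 = int a0 * (- d)" using m by simp
      then show ?thesis by (metis cong_iff_dvd_diff dvd_triv_left)
    qed
    from less.IH[OF a0c _ this z'] False
    have "h (- 1 / w) = (of_nat a0 * z') ^ 6 * h (z' - of_int m / of_nat a0)" unfolding winv by simp
    moreover have "z' - of_int m / of_nat a0 = z - of_int d / of_nat c"
    proof -
      have "of_nat a0 * of_int d = 1 + of_nat c * (of_int m :: complex)"
        using arg_cong[OF m, of "of_int :: int \<Rightarrow> complex"] by simp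
      moreover have "of_int d / of_nat c = (of_nat a0 * of_int d) / (of_nat a0 * of_nat c :: complex)" using False by simp
      ultimately have "of_int d / of_nat c = (1 + of_nat c * of_int m) / (of_nat a0 * of_nat c :: complex)" by (simp only:)
      then have "of_int d / of_nat c = 1 / (of_nat a0 * of_nat c) + of_int m / (of_nat a0 :: complex)"
        using c by (simp add: add_divide_distrib)
      then show ?thesis by (simp add: z'_def)
    qed
    ultimately have "w ^ 6 * h w = (of_nat a0 * z') ^ 6 * h (z - of_int d / of_nat c)"
      using hS[OF w] by simp
    moreover have "(of_nat a0 * z') ^ 6 = w ^ 6 * (of_nat c * z) ^ 6"
      using c z0 by (simp add: weq power_mult_distrib[symmetric])
    moreover have "w \<noteq> 0" using w by auto
    ultimately show ?thesis unfolding red by simp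
  qed
qed

text \<open>The product of \<open>D\<close> and \<open>eta\<close> satisfies the weight 6 law with a
  = 24 b and d = - 24 b', for which a d is congruent to 1. Dividing by the law of \<open>eta\<close>
  moves its root, Gauss sum and character value to the left-hand side.\<close>

lemma represents_rational:
  assumes D: "represents a D" and a: "\<And>n. a n \<noteq> 0 \<Longrightarrow> n mod 24 = 23"
    and c: "c > 0" "coprime (int c) 12" and b: "[576 * b * b' = -1] (mod int c)" and z: "Im z > 0"
  shows "csqrt (- \<i> * z) * of_int (chi12 (int c)) * gauss_sum c b * D (24 * of_int b / of_nat c - 1 / ((of_nat c)\<^sup>2 * z))
    = (of_nat c * z) ^ 6 * D (z + 24 * of_int b' / of_nat c)"
proof -
  define h where "h = (\<lambda>\<tau>. D \<tau> * eta \<tau>)"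
  define y where "y = z + 24 * of_int b' / of_nat c"
  have "24 * of_int b' / of_nat c = complex_of_real (24 * of_int b' / of_nat c)" by simp
  then have "Im y > 0" using z unfolding y_def by (simp only: plus_complex.sel Im_complex_of_real add_0_right)
  then have y: "eta y \<noteq> 0" by (rule eta_nonzero)
  have "h (of_int (24 * b) / of_nat c - 1 / ((of_nat c)\<^sup>2 * z)) = (of_nat c * z) ^ 6 * h (z - of_int (- 24 * b') / of_nat c)"
  proof (rule weight6_rational[OF _ _ c(1) _ z])
    show "h (\<tau> + 1) = h \<tau>" if "Im \<tau> > 0" for \<tau>
    proof -
      have q: "qexp (- 1 / 24) * qexp (1 / 24) = 1" by (simp flip: qexp_add)
      have r: "D (\<tau> + 1) = qexp (- 1 / 24) * D \<tau>" by (rule represents_plus_1[OF D _ that]) (rule a)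
      have "D (\<tau> + 1) * eta (\<tau> + 1) = (qexp (- 1 / 24) * qexp (1 / 24)) * (D \<tau> * eta \<tau>)"
        unfolding r eta_plus_1 by (simp only: mult_ac)
      then show ?thesis unfolding h_def by (simp only: q mult_1_left)
    qed
    show "h (- 1 / \<tau>) = \<tau> ^ 6 * h \<tau>" if "Im \<tau> > 0" for \<tau>
    proof -
      have "csqrt (- \<i> * \<tau>) * D (- 1 / \<tau>) = \<tau> ^ 6 * D \<tau>" using D that by (simp add: represents_def)
      moreover have "D (- 1 / \<tau>) * (csqrt (- \<i> * \<tau>) * eta \<tau>) = (csqrt (- \<i> * \<tau>) * D (- 1 / \<tau>)) * eta \<tau>"
        by (simp only: mult_ac)
      ultimately show ?thesis unfolding h_def eta_inverse[OF that] by (simp only: mult.assoc)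
    qed
    have "24 * b * (- 24 * b') - 1 = - (576 * b * b' - - 1)" by simp
    then show "[24 * b * (- 24 * b') = 1] (mod int c)" using b by (metis cong_iff_dvd_diff dvd_minus_iff)
  qed
  then have "D (24 * of_int b / of_nat c - 1 / ((of_nat c)\<^sup>2 * z)) * (csqrt (- \<i> * z) * of_int (chi12 (int c)) * gauss_sum c b * eta y)
     = (of_nat c * z) ^ 6 * (D y * eta y)"
    unfolding h_def y_def by (simp add: eta_rational[OF c b z])
  then have "(csqrt (- \<i> * z) * of_int (chi12 (int c)) * gauss_sum c b * D (24 * of_int b / of_nat c - 1 / ((of_nat c)\<^sup>2 * z))) * eta y
     = ((of_nat c * z) ^ 6 * D y) * eta y"
    by (simp only: mult_ac)
  then show ?thesis using y unfolding y_def by simp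
qed

section \<open>Dual residues and the Gauss sums at l and l^2\<close>

definition residue_units :: "nat \<Rightarrow> int set" where
  "residue_units c = {b\<in>{0..<int c}. coprime b (int c)}"

text \<open>
  \<open>(24b)(24b') \<equiv> -1\<close> modulo \<open>c\<close> says that the modular matrix with first column \<open>(24b, c)\<close> can be
  chosen to send the cusp \<open>24b'/c\<close> to infinity.
\<close>

definition hecke_dual :: "nat \<Rightarrow> int \<Rightarrow> int" where
  "hecke_dual c b = (SOME b'. b' \<in> {0..<int c} \<and> [576 * b * b' = -1] (mod int c))"

lemma finite_residue_units [simp]: "finite (residue_units c)"
  by (rule finite_subset[of _ "{0..<int c}"]) (auto simp: residue_units_def)

text \<open>The defining congruence is symmetric in b and b', which makes the dual an involution on
  the units. Reindexing by it is how the inversion permutes the terms of the Hecke operator.\<close>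

lemma hecke_dual:
  assumes c: "c > 0" "coprime (int c) 12" and b: "b \<in> residue_units c"
  shows "[576 * b * hecke_dual c b = -1] (mod int c)" and "hecke_dual c b \<in> residue_units c"
    and "hecke_dual c (hecke_dual c b) = b"
proof -
  have ex: "\<exists>b'. b' \<in> {0..<int c} \<and> [576 * b * b' = -1] (mod int c)" if b: "coprime b (int c)" for b
  proof -
    \<comment> \<open>12^3 = 3 * 576 transfers coprimality from 12 to 576.\<close>
    have "coprime (12 * 12 * 12) (int c)" using c(2) by (intro coprime_mult_left_iff[THEN iffD2] conjI) (simp_all add: coprime_commute)
    then have "coprime (3 * 576) (int c)" by simp
    then have "coprime 576 (int c)" by (simp only: coprime_mult_left_iff)
    then have "coprime (576 * b) (int c)" using b by (simp add: coprime_mult_left_iff)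
    then obtain x where x: "[576 * b * x = 1] (mod int c)" using cong_solve_coprime_int by blast
    have "[576 * b * ((- x) mod int c) = 576 * b * (- x)] (mod int c)"
      by (intro cong_mult cong_refl) (simp add: cong_def)
    also have "576 * b * (- x) = - (576 * b * x)" by simp
    also have "[- (576 * b * x) = - 1] (mod int c)" using x by (simp add: cong_minus_minus_iff)
    finally have "[576 * b * ((- x) mod int c) = - 1] (mod int c)" .
    then show ?thesis using c(1) by (intro exI[of _ "(- x) mod int c"]) auto
  qed
  have spec: "hecke_dual c b \<in> {0..<int c} \<and> [576 * b * hecke_dual c b = -1] (mod int c)" if "coprime b (int c)" for b
    unfolding hecke_dual_def by (rule someI_ex[OF ex[OF that]])
  have cop: "coprime (hecke_dual c b) (int c)" if "coprime b (int c)" for b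
  proof (rule coprimeI)
    fix d assume d: "d dvd hecke_dual c b" "d dvd int c"
    have "int c dvd 576 * b * hecke_dual c b + 1" using spec[OF that] by (simp add: cong_iff_dvd_diff)
    then have "d dvd 576 * b * hecke_dual c b + 1" using d(2) dvd_trans by blast
    moreover have "d dvd 576 * b * hecke_dual c b" using d(1) by simp
    ultimately show "is_unit d" using dvd_add_right_iff by blast
  qed
  have b': "coprime b (int c)" "b \<in> {0..<int c}" using b by (auto simp: residue_units_def)
  show 1: "[576 * b * hecke_dual c b = -1] (mod int c)" using spec b' by blast
  show "hecke_dual c b \<in> residue_units c" using spec[OF b'(1)] cop[OF b'(1)] by (simp add: residue_units_def)
  define b1 b2 where "b1 = hecke_dual c b" and "b2 = hecke_dual c b1"
  have 2: "[576 * b1 * b2 = -1] (mod int c)" "b2 \<in> {0..<int c}"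
    using spec[OF cop[OF b'(1)]] by (auto simp: b1_def b2_def)
  have "[b2 * (576 * b * b1) = b2 * (- 1)] (mod int c)" by (intro cong_mult cong_refl 1[folded b1_def])
  moreover have "[b * (576 * b1 * b2) = b * (- 1)] (mod int c)" by (intro cong_mult cong_refl 2)
  moreover have "b2 * (576 * b * b1) = b * (576 * b1 * b2)" by simp
  ultimately have "[b2 * (- 1) = b * (- 1)] (mod int c)" by (metis cong_sym cong_trans)
  then have "[b2 = b] (mod int c)" by (simp add: cong_minus_minus_iff)
  then show "hecke_dual c (hecke_dual c b) = b" using cong_range_eq[of b2 b "int c"] 2(2) b'(2) by (simp add: b1_def b2_def)
qed

lemma sum_residue_units_dual:
  assumes "c > 0" "coprime (int c) 12"
  shows "(\<Sum>b\<in>residue_units c. f (hecke_dual c b)) = (\<Sum>b\<in>residue_units c. f b)"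
  by (rule sum.reindex_bij_witness[of _ "hecke_dual c" "hecke_dual c"]) (use hecke_dual[OF assms] in auto)

lemma sum_echar:
  assumes "c > 0"
  shows "(\<Sum>b\<in>{0..<int c}. echar c (n * b)) = (if int c dvd n then of_nat c else 0)"
proof -
  have "(\<Sum>b\<in>{0..<int c}. echar c (n * b)) = (\<Sum>j<c. cis (2 * pi * real j * n / c))"
    by (rule sum.reindex_bij_witness[of _ int nat]) (auto simp: echar_def mult_ac)
  then show ?thesis using sum_roots_of_unity[OF assms, of n] by simp
qed

lemma echar_0 [simp]: "echar c 0 = 1"
  by (simp add: echar_def)

context
  fixes l :: nat
  assumes prime: "prime l" and l: "l > 3"
begin

lemma l_pos: "l > 0" using l by simp

lemma prime_l_int: "prime (int l)" using prime by simp

lemma not_dvd_small: "0 < k \<Longrightarrow> k < int l \<Longrightarrow> \<not> int l dvd k"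
  using zdvd_imp_le by fastforce

lemma coprime_l_12: "coprime (int l) 12"
proof -
  have "\<not> int l dvd 2" "\<not> int l dvd 3" using l by (auto dest: zdvd_imp_le)
  then have "\<not> int l dvd 2 * 2 * 3" using prime_l_int by (simp only: prime_dvd_mult_iff simp_thms)
  then show ?thesis using prime_l_int by (simp add: prime_imp_coprime)
qed

lemma coprime_sq_12: "coprime (int (l\<^sup>2)) 12"
  using coprime_l_12 by simp

lemma l_dvd_2_mult: "int l dvd 2 * k \<longleftrightarrow> int l dvd k"
  using not_dvd_small[of 2] l by (simp add: prime_dvd_mult_iff[OF prime_l_int])

lemma chi12_l_sq: "chi12 (int l) * chi12 (int l) = 1"
proof -
  have "chi12 (int l) \<noteq> 0"
  proof
    assume z: "chi12 (int l) = 0"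
    have "\<not> 2 dvd int l" using coprime_l_12 coprime_common_divisor[of "int l" 12 2] by auto
    moreover have "\<not> 3 dvd int l" using coprime_l_12 coprime_common_divisor[of "int l" 12 3] by auto
    moreover have "int l mod 12 \<notin> {1, 5, 7, 11}" using z by (auto simp: chi12_def)
    then have "2 dvd int l \<or> 3 dvd int l" by simp presburger
    ultimately show False by blast
  qed
  then show ?thesis by (auto simp: chi12_def split: if_splits)
qed

text \<open>With n = u + l v the square modulo l^2 is u^2 + 2 l u v, so the sum over v vanishes
  unless l divides 2 b u, that is, unless u = 0; this class contributes l.\<close>

lemma gauss_sum_prime_square:
  assumes "\<not> int l dvd b"
  shows "gauss_sum (l\<^sup>2) b = of_nat l"
proof -
  define f where "f = (\<lambda>n. echar (l\<^sup>2) (b * n\<^sup>2))"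
  define h where "h = (\<lambda>(u, v). u + int l * v)"
  have "(\<Sum>p\<in>{0..<int l} \<times> {0..<int l}. f (h p)) = (\<Sum>n\<in>{0..<int (l\<^sup>2)}. f n)"
  proof (rule sum_residues)
    show "l\<^sup>2 > 0" using l by simp
    show "card ({0..<int l} \<times> {0..<int l}) = l\<^sup>2" by (simp add: power2_eq_square)
    fix i j assume ij: "i \<in> {0..<int l} \<times> {0..<int l}" "j \<in> {0..<int l} \<times> {0..<int l}" "[h i = h j] (mod int (l\<^sup>2))"
    obtain u v u' v' where uv: "i = (u, v)" "j = (u', v')" by (cases i, cases j)
    have r: "u \<in> {0..<int l}" "v \<in> {0..<int l}" "u' \<in> {0..<int l}" "v' \<in> {0..<int l}" using ij uv by auto
    have range: "h (x, y) \<in> {0..<int (l\<^sup>2)}" if "x \<in> {0..<int l}" "y \<in> {0..<int l}" for x y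
    proof -
      have "int l * y \<le> int l * (int l - 1)" using that by (intro mult_left_mono) auto
      then have "x + int l * y < int l * int l" using that by (simp add: algebra_simps)
      moreover have "0 \<le> x + int l * y" using that by simp
      ultimately show ?thesis by (simp add: h_def power2_eq_square)
    qed
    have "h i = h j" using cong_range_eq[OF ij(3)] range r uv by simp
    then have eq: "u + int l * v = u' + int l * v'" by (simp add: h_def uv)
    then have "(u + int l * v) mod int l = (u' + int l * v') mod int l" by simp
    then have "u = u'" using r by simp
    then show "i = j" using eq uv l_pos by simp
  next
    fix n n' assume "[n = n'] (mod int (l\<^sup>2))"
    then show "f n = f n'" unfolding f_def using l by (intro echar_cong cong_mult cong_pow cong_refl) auto
  qed auto
  also have "(\<Sum>p\<in>{0..<int l} \<times> {0..<int l}. f (h p)) = (\<Sum>u\<in>{0..<int l}. \<Sum>v\<in>{0..<int l}. f (u + int l * v))"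
    by (simp add: sum.cartesian_product h_def case_prod_unfold)
  also have "\<dots> = (\<Sum>u\<in>{0..<int l}. echar (l\<^sup>2) (b * u\<^sup>2) * (\<Sum>v\<in>{0..<int l}. echar l ((2 * b * u) * v)))"
    unfolding sum_distrib_left
  proof (intro sum.cong refl)
    fix u v
    have "f (u + int l * v) = echar (l\<^sup>2) (b * u\<^sup>2 + int l * (2 * b * u * v))"
      unfolding f_def using l by (intro echar_cong) (auto simp: cong_iff_dvd_diff power2_eq_square algebra_simps)
    also have "\<dots> = echar (l\<^sup>2) (b * u\<^sup>2) * echar (l\<^sup>2) (int l * (2 * b * u * v))" by (rule echar_add)
    also have "echar (l\<^sup>2) (int l * (2 * b * u * v)) = echar l ((2 * b * u) * v)"
      using l by (simp add: echar_def power2_eq_square)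
    finally show "f (u + int l * v) = echar (l\<^sup>2) (b * u\<^sup>2) * echar l ((2 * b * u) * v)" .
  qed
  also have "\<dots> = (\<Sum>u\<in>{0..<int l}. if u = 0 then of_nat l else 0)"
  proof (intro sum.cong refl)
    fix u assume u: "u \<in> {0..<int l}"
    have "int l dvd 2 * b * u \<longleftrightarrow> u = 0"
    proof
      assume "int l dvd 2 * b * u"
      then have "int l dvd b * u" using l_dvd_2_mult[of "b * u"] by (simp add: mult.assoc)
      then have "int l dvd u" using assms by (simp add: prime_dvd_mult_iff[OF prime_l_int])
      then show "u = 0" using u not_dvd_small[of u] by force
    qed simp
    then show "echar (l\<^sup>2) (b * u\<^sup>2) * (\<Sum>v\<in>{0..<int l}. echar l ((2 * b * u) * v)) = (if u = 0 then of_nat l else 0)"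
      unfolding sum_echar[OF l_pos] by auto
  qed
  also have "\<dots> = of_nat l" using l_pos by simp
  finally show ?thesis by (simp add: gauss_sum_def f_def)
qed

text \<open>The substitution v = 24 b' u turns b v^2 into - b' u^2, so the two Gauss sums are
  complex conjugates and the product is an absolute square. Putting w = t + u makes its phase linear
  in u, and only t = 0 survives.\<close>

lemma gauss_sum_dual:
  assumes b: "b \<in> residue_units l"
  shows "gauss_sum l b * gauss_sum l (hecke_dual l b) = of_nat l"
proof -
  define b' where "b' = hecke_dual l b"
  note dual = hecke_dual[OF l_pos coprime_l_12 b, folded b'_def]
  have b'u: "\<not> int l dvd b'"
  proof
    assume "int l dvd b'"
    then have "int l dvd 1" using dual(2) coprime_common_divisor[of b' "int l" "int l"] by (auto simp: residue_units_def)
    then show False using l by simp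
  qed
  have c24: "coprime (24 * b') (int l)"
  proof -
    have "coprime (12 * 12) (int l)"
      using coprime_l_12 by (simp only: coprime_mult_left_iff coprime_commute[of 12] simp_thms)
    then have "coprime (6 * 24) (int l)" by simp
    then have "coprime 24 (int l)" by (simp only: coprime_mult_left_iff)
    then show ?thesis using dual(2) by (simp add: coprime_mult_left_iff residue_units_def)
  qed
  have g: "gauss_sum l b = (\<Sum>u\<in>{0..<int l}. echar l (- b' * u\<^sup>2))"
  proof -
    have "(\<Sum>u\<in>{0..<int l}. echar l (b * (24 * b' * u)\<^sup>2)) = (\<Sum>v\<in>{0..<int l}. echar l (b * v\<^sup>2))"
    proof (rule sum_residues)
      fix i j assume ij: "i \<in> {0..<int l}" "j \<in> {0..<int l}" "[24 * b' * i = 24 * b' * j] (mod int l)"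
      then have "[i = j] (mod int l)" using c24 cong_mult_lcancel by blast
      then show "i = j" using ij(1,2) by (rule cong_range_eq)
    next
      fix n n' assume "[n = n'] (mod int l)"
      then show "echar l (b * n\<^sup>2) = echar l (b * n'\<^sup>2)" by (intro echar_cong l_pos cong_mult cong_pow cong_refl)
    qed (use l_pos in auto)
    moreover have "echar l (b * (24 * b' * u)\<^sup>2) = echar l (- b' * u\<^sup>2)" for u
    proof (rule echar_cong[OF l_pos])
      have "b * (24 * b' * u)\<^sup>2 = (576 * b * b') * (b' * u\<^sup>2)" by (simp add: power2_eq_square)
      moreover have "[(576 * b * b') * (b' * u\<^sup>2) = (- 1) * (b' * u\<^sup>2)] (mod int l)" by (intro cong_mult cong_refl dual)
      ultimately show "[b * (24 * b' * u)\<^sup>2 = - b' * u\<^sup>2] (mod int l)"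
        by (simp only: mult_minus_left mult_1_left)
    qed
    ultimately show ?thesis by (simp add: gauss_sum_def)
  qed
  have "gauss_sum l b * gauss_sum l b' = (\<Sum>u\<in>{0..<int l}. \<Sum>w\<in>{0..<int l}. echar l (- b' * u\<^sup>2) * echar l (b' * w\<^sup>2))"
    unfolding g by (simp add: gauss_sum_def sum_product)
  also have "\<dots> = (\<Sum>u\<in>{0..<int l}. \<Sum>t\<in>{0..<int l}. echar l (b' * t\<^sup>2) * echar l ((2 * b' * t) * u))"
  proof (rule sum.cong[OF refl])
    fix u
    have "(\<Sum>t\<in>{0..<int l}. echar l (- b' * u\<^sup>2) * echar l (b' * (t + u)\<^sup>2)) = (\<Sum>w\<in>{0..<int l}. echar l (- b' * u\<^sup>2) * echar l (b' * w\<^sup>2))"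
    proof (rule sum_residues)
      fix i j assume ij: "i \<in> {0..<int l}" "j \<in> {0..<int l}" "[i + u = j + u] (mod int l)"
      then have "[i = j] (mod int l)" by (simp add: cong_add_rcancel)
      then show "i = j" using ij(1,2) by (rule cong_range_eq)
    next
      fix n n' assume "[n = n'] (mod int l)"
      then have "echar l (b' * n\<^sup>2) = echar l (b' * n'\<^sup>2)" by (intro echar_cong l_pos cong_mult cong_pow cong_refl)
      then show "echar l (- b' * u\<^sup>2) * echar l (b' * n\<^sup>2) = echar l (- b' * u\<^sup>2) * echar l (b' * n'\<^sup>2)" by simp
    qed (use l_pos in auto)
    moreover have "echar l (- b' * u\<^sup>2) * echar l (b' * (t + u)\<^sup>2) = echar l (b' * t\<^sup>2) * echar l ((2 * b' * t) * u)" for t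
      unfolding echar_add[symmetric] by (rule arg_cong[of _ _ "echar l"]) (simp add: power2_eq_square algebra_simps)
    ultimately show "(\<Sum>w\<in>{0..<int l}. echar l (- b' * u\<^sup>2) * echar l (b' * w\<^sup>2)) = (\<Sum>t\<in>{0..<int l}. echar l (b' * t\<^sup>2) * echar l ((2 * b' * t) * u))"
      by simp
  qed
  also have "\<dots> = (\<Sum>t\<in>{0..<int l}. echar l (b' * t\<^sup>2) * (\<Sum>u\<in>{0..<int l}. echar l ((2 * b' * t) * u)))"
    by (subst sum.swap) (simp add: sum_distrib_left)
  also have "\<dots> = (\<Sum>t\<in>{0..<int l}. if t = 0 then of_nat l else 0)"
  proof (intro sum.cong refl)
    fix t assume t: "t \<in> {0..<int l}"
    have "int l dvd 2 * b' * t \<longleftrightarrow> t = 0"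
    proof
      assume "int l dvd 2 * b' * t"
      then have "int l dvd b' * t" using l_dvd_2_mult[of "b' * t"] by (simp add: mult.assoc)
      then have "int l dvd t" using b'u by (simp add: prime_dvd_mult_iff[OF prime_l_int])
      then show "t = 0" using t not_dvd_small[of t] by force
    qed simp
    then show "echar l (b' * t\<^sup>2) * (\<Sum>u\<in>{0..<int l}. echar l ((2 * b' * t) * u)) = (if t = 0 then of_nat l else 0)"
      unfolding sum_echar[OF l_pos] by auto
  qed
  also have "\<dots> = of_nat l" using l_pos by simp
  finally show ?thesis by (simp add: b'_def)
qed

lemma coprime_l_iff: "coprime b (int l) \<longleftrightarrow> \<not> int l dvd b"
proof
  assume "coprime b (int l)"
  then show "\<not> int l dvd b" using coprime_common_divisor[of b "int l" "int l"] l by auto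
next
  assume "\<not> int l dvd b"
  then have "coprime (int l) b" by (rule prime_imp_coprime[OF prime_l_int])
  then show "coprime b (int l)" by (simp add: coprime_commute)
qed

lemma residue_units_prime: "residue_units l = {1..<int l}"
proof (intro equalityI subsetI)
  fix b assume "b \<in> residue_units l"
  then have "b \<in> {0..<int l}" "\<not> int l dvd b" by (auto simp: residue_units_def coprime_l_iff)
  then show "b \<in> {1..<int l}" by (cases "b = 0") auto
next
  fix b assume "b \<in> {1..<int l}"
  then show "b \<in> residue_units l" using not_dvd_small[of b] by (auto simp: residue_units_def coprime_l_iff)
qed

text \<open>The Legendre symbol of \<open>-n\<close> modulo \<open>l\<close>, in the form in which the Gauss sums produce it.\<close>

definition neg_sqrt_count :: "int \<Rightarrow> int" where
  "neg_sqrt_count n = int (card {r\<in>{0..<int l}. int l dvd r\<^sup>2 + n}) - 1"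

lemma neg_sqrt_count_0: "int l dvd n \<Longrightarrow> neg_sqrt_count n = 0"
proof -
  assume n: "int l dvd n"
  have "{r\<in>{0..<int l}. int l dvd r\<^sup>2 + n} = {0}"
  proof (intro equalityI subsetI)
    fix r assume "r \<in> {r\<in>{0..<int l}. int l dvd r\<^sup>2 + n}"
    then have r: "r \<in> {0..<int l}" "int l dvd r\<^sup>2" using n by (auto simp: dvd_add_left_iff)
    then have "int l dvd r" using prime_dvd_power[OF prime_l_int] by blast
    then show "r \<in> {0}" using r not_dvd_small[of r] by force
  qed (use n l in auto)
  then show ?thesis by (simp add: neg_sqrt_count_def)
qed

text \<open>After the sums are exchanged, the sum over all b detects l | r^2 + n; removing b = 0
  subtracts 1 for each of the l values of r, which is the -1 in
  \<open>neg_sqrt_count\<close>.\<close>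

lemma sum_gauss_sum_echar:
  "(\<Sum>b\<in>residue_units l. gauss_sum l b * echar l (n * b)) = of_nat l * of_int (neg_sqrt_count n)"
proof -
  have "(\<Sum>b\<in>residue_units l. gauss_sum l b * echar l (n * b)) = (\<Sum>b\<in>{1..<int l}. \<Sum>r\<in>{0..<int l}. echar l ((r\<^sup>2 + n) * b))"
    unfolding residue_units_prime gauss_sum_def sum_distrib_right
    by (intro sum.cong refl) (simp add: echar_add[symmetric] algebra_simps)
  also have "\<dots> = (\<Sum>r\<in>{0..<int l}. \<Sum>b\<in>{1..<int l}. echar l ((r\<^sup>2 + n) * b))" by (rule sum.swap)
  also have "\<dots> = (\<Sum>r\<in>{0..<int l}. (if int l dvd r\<^sup>2 + n then of_nat l else 0) - 1)"
  proof (intro sum.cong refl)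
    fix r
    have "{0..<int l} = insert 0 {1..<int l}" using l_pos by auto
    then have "(\<Sum>b\<in>{0..<int l}. echar l ((r\<^sup>2 + n) * b)) = 1 + (\<Sum>b\<in>{1..<int l}. echar l ((r\<^sup>2 + n) * b))" by simp
    then show "(\<Sum>b\<in>{1..<int l}. echar l ((r\<^sup>2 + n) * b)) = (if int l dvd r\<^sup>2 + n then of_nat l else 0) - 1"
      unfolding sum_echar[OF l_pos] by simp
  qed
  also have "\<dots> = of_nat l * of_int (neg_sqrt_count n)"
  proof -
    have "(\<Sum>r\<in>{0..<int l}. if int l dvd r\<^sup>2 + n then of_nat l else (0::complex)) = of_nat (card {r\<in>{0..<int l}. int l dvd r\<^sup>2 + n}) * of_nat l"
      by (subst sum.inter_filter[symmetric]) auto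
    then show ?thesis by (simp add: sum_subtractf neg_sqrt_count_def algebra_simps)
  qed
  finally show ?thesis .
qed

text \<open>Shimura's \<open>T(l\<^sup>2)\<close> in weight \<open>\<lambda> + 1/2\<close> with \<open>\<lambda> = 5\<close>: the powers of \<open>l\<close> are \<open>l\<^bsup>\<lambda>-1\<^esup>\<close> and \<open>l\<^bsup>2\<lambda>-1\<^esup>\<close>.\<close>

definition hecke :: "(int \<Rightarrow> int) \<Rightarrow> int \<Rightarrow> int" where
  "hecke a n = a ((int l)\<^sup>2 * n) + chi12 (int l) * neg_sqrt_count n * (int l) ^ 4 * a n
     + (int l) ^ 9 * (if (int l)\<^sup>2 dvd n then a (n div (int l)\<^sup>2) else 0)"

lemma Im_hecke: "Im \<tau> > 0 \<Longrightarrow> Im ((\<tau> + 24 * of_int b) / (of_nat l)\<^sup>2) > 0"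
  "Im \<tau> > 0 \<Longrightarrow> Im (\<tau> + 24 * of_int b / of_nat l) > 0"
  "Im \<tau> > 0 \<Longrightarrow> Im ((of_nat l)\<^sup>2 * \<tau>) > 0"
proof -
  have 1: "(\<tau> + 24 * of_int b) / (of_nat l)\<^sup>2 = of_real (1 / (real l)\<^sup>2) * (\<tau> + of_real (24 * of_int b))" by simp
  have 2: "\<tau> + 24 * of_int b / of_nat l = \<tau> + of_real (24 * of_int b / real l)" by simp
  have 3: "(of_nat l)\<^sup>2 * \<tau> = of_real ((real l)\<^sup>2) * \<tau>" by simp
  show "Im \<tau> > 0 \<Longrightarrow> Im ((\<tau> + 24 * of_int b) / (of_nat l)\<^sup>2) > 0"
    unfolding 1 using l_pos by (simp del: of_real_mult of_real_divide of_real_power)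
  show "Im \<tau> > 0 \<Longrightarrow> Im (\<tau> + 24 * of_int b / of_nat l) > 0" unfolding 2 by (simp del: of_real_mult of_real_divide)
  show "Im \<tau> > 0 \<Longrightarrow> Im ((of_nat l)\<^sup>2 * \<tau>) > 0" unfolding 3 using l_pos by (simp del: of_real_power)
qed

text \<open>Residues modulo l^2 sorted by their gcd with l^2, namely 1, l or l^2: the three types of
  translates that the inversion treats differently.\<close>

lemma residues_square_split:
  "{0..<int (l\<^sup>2)} = residue_units (l\<^sup>2) \<union> (\<lambda>b. int l * b) ` residue_units l \<union> {0}"
  "residue_units (l\<^sup>2) \<inter> (\<lambda>b. int l * b) ` residue_units l = {}"
  "(residue_units (l\<^sup>2) \<union> (\<lambda>b. int l * b) ` residue_units l) \<inter> {0} = {}"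
proof -
  have cop: "coprime b (int (l\<^sup>2)) \<longleftrightarrow> \<not> int l dvd b" for b
    using coprime_l_iff[of b] by simp
  have units: "b \<in> residue_units (l\<^sup>2) \<longleftrightarrow> b \<in> {0..<int (l\<^sup>2)} \<and> \<not> int l dvd b" for b
    unfolding residue_units_def mem_Collect_eq cop ..
  show "residue_units (l\<^sup>2) \<inter> (\<lambda>b. int l * b) ` residue_units l = {}"
  proof -
    have "int l * b \<notin> residue_units (l\<^sup>2)" for b using units[of "int l * b"] by simp
    then show ?thesis by blast
  qed
  show "(residue_units (l\<^sup>2) \<union> (\<lambda>b. int l * b) ` residue_units l) \<inter> {0} = {}"
    unfolding residue_units_prime using l_pos units[of 0] by auto
  show "{0..<int (l\<^sup>2)} = residue_units (l\<^sup>2) \<union> (\<lambda>b. int l * b) ` residue_units l \<union> {0}"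
  proof (intro equalityI subsetI)
    fix b assume b: "b \<in> {0..<int (l\<^sup>2)}"
    show "b \<in> residue_units (l\<^sup>2) \<union> (\<lambda>b. int l * b) ` residue_units l \<union> {0}"
    proof (cases "int l dvd b")
      case True
      then obtain k where k: "b = int l * k" by (elim dvdE)
      have "int l * k < int l * int l" "0 \<le> int l * k" using b by (auto simp: k power2_eq_square)
      then have "k < int l" "0 \<le> k" using l_pos by (auto simp: zero_le_mult_iff)
      then show ?thesis unfolding residue_units_prime k by (cases "k = 0") auto
    qed (use b units[of b] in blast)
  next
    fix b assume "b \<in> residue_units (l\<^sup>2) \<union> (\<lambda>b. int l * b) ` residue_units l \<union> {0}"
    then consider "b \<in> residue_units (l\<^sup>2)" | k where "b = int l * k" "k \<in> {1..<int l}" | "b = 0"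
      unfolding residue_units_prime by auto
    then show "b \<in> {0..<int (l\<^sup>2)}"
    proof cases
      case 2
      then show ?thesis using l_pos by (auto simp: power2_eq_square)
    qed (use l_pos units[of b] in auto)
  qed
qed

text \<open>The operator is a sum of three parts with distinct behaviour under the inversion. In
  \<open>X\<close>, the translates by units modulo l^2 are permuted among themselves. The other
  translates, collected in \<open>Y\<close>, are exchanged with \<open>Z\<close>, which holds the
  shifts by multiples of 24 / l and the dilation by l^2.\<close>

theorem weak_form_hecke:
  assumes a: "weak_form a"
  shows "weak_form (hecke a)"
proof -
  obtain D where D: "represents a D" using a by (auto simp: weak_form_def)
  have a24: "k mod 24 = 23" if "a k \<noteq> 0" for k using a that by (auto simp: weak_form_def)
  have hol: "D holomorphic_on {\<tau>. Im \<tau> > 0}"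
    and sum: "\<And>\<tau>. Im \<tau> > 0 \<Longrightarrow> ((\<lambda>n. of_int (a n) * qexp (of_int n * \<tau> / 24)) has_sum D \<tau>) UNIV"
    using D by (auto simp: represents_def)
  define ch where "ch = (of_int (chi12 (int l)) :: complex)"
  have ch_sq: "ch * ch = 1" using arg_cong[OF chi12_l_sq, of "of_int :: int \<Rightarrow> complex"] by (simp add: ch_def)
  define L where "L = (of_nat l :: complex)"
  have L: "L \<noteq> 0" using l_pos by (simp add: L_def)
  define X where "X = (\<lambda>\<tau>. \<Sum>b\<in>residue_units (l\<^sup>2). D ((\<tau> + 24 * of_int b) / L\<^sup>2))"
  define Y where "Y = (\<lambda>\<tau>. (\<Sum>b\<in>residue_units l. D ((\<tau> + 24 * of_int (int l * b)) / L\<^sup>2)) + D (\<tau> / L\<^sup>2))"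
  \<comment> \<open>The constants are forced by the exchange with \<open>Y\<close>: (L \<tau>)^6
    over the product L of dual Gauss sums gives L^5, and (L^2 \<tau>)^6 over the scaling L of the
    root gives L^11. Division by L^2 leaves L^9 in the last term, and L^3 in the middle one, to
    which the sum over Gauss sums adds the fourth L.\<close>
  define Z where "Z = (\<lambda>\<tau>. L ^ 5 * ch * (\<Sum>b\<in>residue_units l. gauss_sum l b * D (\<tau> + 24 * of_int b / L)) + L ^ 11 * D (L\<^sup>2 * \<tau>))"
  define T where "T = (\<lambda>\<tau>. (X \<tau> + Y \<tau> + Z \<tau>) / L\<^sup>2)"
  have X: "csqrt (- \<i> * \<tau>) * X (- 1 / \<tau>) = \<tau> ^ 6 * X \<tau>" if \<tau>: "Im \<tau> > 0" for \<tau>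
  proof -
    have "csqrt (- \<i> * \<tau>) * D ((- 1 / \<tau> + 24 * of_int b) / L\<^sup>2) = \<tau> ^ 6 * D ((\<tau> + 24 * of_int (hecke_dual (l\<^sup>2) b)) / L\<^sup>2)"
      if b: "b \<in> residue_units (l\<^sup>2)" for b
    proof -
      \<comment> \<open>Here the character value at l^2 is 1 and the Gauss sum is l, exactly the
        factor by which the root for \<tau> = l^2 z exceeds that for z; hence no constant is
        left.\<close>
      define z where "z = \<tau> / L\<^sup>2"
      have sq: "l\<^sup>2 > 0" using l_pos by simp
      have z: "Im z > 0" using Im_hecke(1)[OF \<tau>, of 0] by (simp add: z_def L_def)
      have lz: "L\<^sup>2 * z = \<tau>" using L by (simp add: z_def)
      have "\<not> int l dvd b"
      proof
        assume "int l dvd b"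
        then have "int l dvd 1" using b coprime_common_divisor[of b "int (l\<^sup>2)" "int l"] by (auto simp: residue_units_def)
        then show False using l by simp
      qed
      then have g: "gauss_sum (l\<^sup>2) b = L" unfolding L_def by (rule gauss_sum_prime_square)
      have c1: "complex_of_int (chi12 (int (l\<^sup>2))) = 1"
        using chi12_l_sq by (simp add: power2_eq_square chi12_mult)
      have cs: "csqrt (- \<i> * \<tau>) = L * csqrt (- \<i> * z)"
        using csqrt_scale[OF l_pos, of "- \<i> * z"] lz unfolding L_def by (metis mult.left_commute)
      have arg: "24 * of_int b / of_nat (l\<^sup>2) - 1 / ((of_nat (l\<^sup>2))\<^sup>2 * z) = (- 1 / \<tau> + 24 * of_int b) / L\<^sup>2"
        using L by (simp add: z_def L_def field_simps power2_eq_square)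
      have "csqrt (- \<i> * z) * 1 * L * D ((- 1 / \<tau> + 24 * of_int b) / L\<^sup>2) = (of_nat (l\<^sup>2) * z) ^ 6 * D (z + 24 * of_int (hecke_dual (l\<^sup>2) b) / of_nat (l\<^sup>2))"
        using represents_rational[OF D a24 sq coprime_sq_12 hecke_dual(1)[OF sq coprime_sq_12 b] z] unfolding arg g c1 .
      moreover have "of_nat (l\<^sup>2) * z = \<tau>" using lz by (simp add: L_def)
      moreover have "z + 24 * of_int (hecke_dual (l\<^sup>2) b) / of_nat (l\<^sup>2) = (\<tau> + 24 * of_int (hecke_dual (l\<^sup>2) b)) / L\<^sup>2"
        by (simp add: z_def L_def add_divide_distrib)
      ultimately show ?thesis unfolding cs by (simp add: mult_ac)
    qed
    then have "csqrt (- \<i> * \<tau>) * X (- 1 / \<tau>) = (\<Sum>b\<in>residue_units (l\<^sup>2). \<tau> ^ 6 * D ((\<tau> + 24 * of_int (hecke_dual (l\<^sup>2) b)) / L\<^sup>2))"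
      unfolding X_def sum_distrib_left by (rule sum.cong[OF refl])
    also have "\<dots> = \<tau> ^ 6 * X \<tau>"
      unfolding X_def sum_distrib_left
      using sum_residue_units_dual[of "l\<^sup>2" "\<lambda>b. \<tau> ^ 6 * D ((\<tau> + 24 * of_int b) / L\<^sup>2)"] l_pos coprime_sq_12 by simp
    finally show ?thesis .
  qed
  have YZ: "csqrt (- \<i> * \<tau>) * Y (- 1 / \<tau>) = \<tau> ^ 6 * Z \<tau>" if \<tau>: "Im \<tau> > 0" for \<tau>
  proof -
    have \<tau>0: "\<tau> \<noteq> 0" using \<tau> by auto
    have "csqrt (- \<i> * \<tau>) * D ((- 1 / \<tau> + 24 * of_int (int l * b)) / L\<^sup>2) = \<tau> ^ 6 * (L ^ 5 * ch * (gauss_sum l (hecke_dual l b) * D (\<tau> + 24 * of_int (hecke_dual l b) / L)))"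
      if b: "b \<in> residue_units l" for b
    proof -
      define g g' where "g = gauss_sum l b" and "g' = gauss_sum l (hecke_dual l b)"
      have gg: "g * g' = L" using gauss_sum_dual[OF b] by (simp add: g_def g'_def L_def)
      define U V where "U = D ((- 1 / \<tau> + 24 * of_int (int l * b)) / L\<^sup>2)" and "V = D (\<tau> + 24 * of_int (hecke_dual l b) / L)"
      have arg: "24 * of_int b / of_nat l - 1 / ((of_nat l)\<^sup>2 * \<tau>) = (- 1 / \<tau> + 24 * of_int (int l * b)) / L\<^sup>2"
        using L \<tau>0 by (simp add: L_def field_simps power2_eq_square)
      have e: "csqrt (- \<i> * \<tau>) * ch * g * U = (L * \<tau>) ^ 6 * V"
        using represents_rational[OF D a24 l_pos coprime_l_12 hecke_dual(1)[OF l_pos coprime_l_12 b] \<tau>]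
        unfolding arg by (simp add: U_def V_def g_def ch_def L_def)
      have "L * (csqrt (- \<i> * \<tau>) * U) = (ch * ch) * (g * g') * (csqrt (- \<i> * \<tau>) * U)"
        by (simp only: ch_sq gg mult_1_left)
      also have "\<dots> = (csqrt (- \<i> * \<tau>) * ch * g * U) * (ch * g')" by (simp only: mult_ac)
      also have "\<dots> = ((L * \<tau>) ^ 6 * V) * (ch * g')" by (simp only: e)
      also have "\<dots> = L * (\<tau> ^ 6 * (L ^ 5 * ch * (g' * V)))" by (simp add: power_mult_distrib eval_nat_numeral)
      finally show ?thesis using L by (simp add: U_def V_def g'_def)
    qed
    then have "csqrt (- \<i> * \<tau>) * (\<Sum>b\<in>residue_units l. D ((- 1 / \<tau> + 24 * of_int (int l * b)) / L\<^sup>2))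
      = (\<Sum>b\<in>residue_units l. \<tau> ^ 6 * (L ^ 5 * ch * (gauss_sum l (hecke_dual l b) * D (\<tau> + 24 * of_int (hecke_dual l b) / L))))"
      unfolding sum_distrib_left by (rule sum.cong[OF refl])
    also have "\<dots> = \<tau> ^ 6 * (L ^ 5 * ch * (\<Sum>b\<in>residue_units l. gauss_sum l b * D (\<tau> + 24 * of_int b / L)))"
      unfolding sum_distrib_left
      by (rule sum_residue_units_dual[OF l_pos coprime_l_12, of "\<lambda>b. \<tau> ^ 6 * (L ^ 5 * ch * (gauss_sum l b * D (\<tau> + 24 * of_int b / L)))"])
    finally have 1: "csqrt (- \<i> * \<tau>) * (\<Sum>b\<in>residue_units l. D ((- 1 / \<tau> + 24 * of_int (int l * b)) / L\<^sup>2))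
      = \<tau> ^ 6 * (L ^ 5 * ch * (\<Sum>b\<in>residue_units l. gauss_sum l b * D (\<tau> + 24 * of_int b / L)))" .
    have 2: "csqrt (- \<i> * \<tau>) * D (- 1 / \<tau> / L\<^sup>2) = \<tau> ^ 6 * (L ^ 11 * D (L\<^sup>2 * \<tau>))"
    proof -
      have "csqrt (- \<i> * (L\<^sup>2 * \<tau>)) * D (- 1 / (L\<^sup>2 * \<tau>)) = (L\<^sup>2 * \<tau>) ^ 6 * D (L\<^sup>2 * \<tau>)"
        using D Im_hecke(3)[OF \<tau>] by (simp add: represents_def L_def)
      moreover have "csqrt (- \<i> * (L\<^sup>2 * \<tau>)) = L * csqrt (- \<i> * \<tau>)"
        using csqrt_scale[OF l_pos, of "- \<i> * \<tau>"] unfolding L_def by (metis mult.left_commute)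
      moreover have "- 1 / \<tau> / L\<^sup>2 = - 1 / (L\<^sup>2 * \<tau>)" by simp
      moreover have "(L\<^sup>2 * \<tau>) ^ 6 = L * (\<tau> ^ 6 * L ^ 11)" by (simp add: power_mult_distrib eval_nat_numeral)
      ultimately have "L * (csqrt (- \<i> * \<tau>) * D (- 1 / \<tau> / L\<^sup>2)) = L * (\<tau> ^ 6 * (L ^ 11 * D (L\<^sup>2 * \<tau>)))"
        by (simp only: mult.assoc)
      then show ?thesis using L by simp
    qed
    show ?thesis unfolding Y_def Z_def distrib_left 1 2 ..
  qed
  \<comment> \<open>The law \<open>YZ\<close> at the point -1/\<tau>, solved for the other side by
    \<open>csqrt_involution\<close>.\<close>
  have ZY: "csqrt (- \<i> * \<tau>) * Z (- 1 / \<tau>) = \<tau> ^ 6 * Y \<tau>" if \<tau>: "Im \<tau> > 0" for \<tau>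
  proof -
    have \<tau>0: "\<tau> \<noteq> 0" using \<tau> by auto
    have e: "csqrt (- \<i> * (- 1 / \<tau>)) * Y \<tau> = (- 1 / \<tau>) ^ 6 * Z (- 1 / \<tau>)"
      using YZ[OF Im_minus_inverse_pos[OF \<tau>]] \<tau>0 by simp
    have "(csqrt (- \<i> * \<tau>) * csqrt (- \<i> * (- 1 / \<tau>))) * (\<tau> ^ 6 * Y \<tau>)
        = csqrt (- \<i> * \<tau>) * \<tau> ^ 6 * (csqrt (- \<i> * (- 1 / \<tau>)) * Y \<tau>)"
      by (simp only: mult_ac)
    also have "\<dots> = \<tau> ^ 6 * (- 1 / \<tau>) ^ 6 * (csqrt (- \<i> * \<tau>) * Z (- 1 / \<tau>))"
      unfolding e by (simp only: mult_ac)
    finally have "(csqrt (- \<i> * \<tau>) * csqrt (- \<i> * (- 1 / \<tau>))) * (\<tau> ^ 6 * Y \<tau>)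
        = \<tau> ^ 6 * (- 1 / \<tau>) ^ 6 * (csqrt (- \<i> * \<tau>) * Z (- 1 / \<tau>))" .
    moreover have "\<tau> ^ 6 * (- 1 / \<tau>) ^ 6 = 1" using \<tau>0 by (simp add: power_mult_distrib[symmetric])
    ultimately show ?thesis unfolding csqrt_involution[OF \<tau>] by (simp only: mult_1_left)
  qed
  have T_S: "csqrt (- \<i> * \<tau>) * T (- 1 / \<tau>) = \<tau> ^ 6 * T \<tau>" if "Im \<tau> > 0" for \<tau>
    unfolding T_def times_divide_eq_right distrib_left X[OF that] YZ[OF that] ZY[OF that] by (simp add: add_ac)
  have D_comp: "(\<lambda>\<tau>. D (f \<tau>)) holomorphic_on {\<tau>. Im \<tau> > 0}" if "f holomorphic_on {\<tau>. Im \<tau> > 0}" "\<And>\<tau>. Im \<tau> > 0 \<Longrightarrow> Im (f \<tau>) > 0" for f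
    using holomorphic_on_compose_gen[OF that(1) hol] that(2) by (auto simp: o_def)
  have T_hol: "T holomorphic_on {\<tau>. Im \<tau> > 0}"
    unfolding T_def X_def Y_def Z_def
    using Im_hecke Im_hecke(1)[where b = 0] L
    by (intro holomorphic_intros D_comp) (auto simp: L_def)
  have T_sum: "((\<lambda>n. of_int (hecke a n) * qexp (of_int n * \<tau> / 24)) has_sum T \<tau>) UNIV" if \<tau>: "Im \<tau> > 0" for \<tau>
  proof -
    define e where "e = (\<lambda>n. qexp (of_int n * \<tau> / 24))"
    \<comment> \<open>All l^2 translates together: the shift by 24 b multiplies the n-th term by the
      additive character of n b modulo l^2, so the sum over b selects the n divisible by
      l^2.\<close>
    have XY: "X \<tau> + Y \<tau> = (\<Sum>b\<in>{0..<int (l\<^sup>2)}. D ((\<tau> + 24 * of_int b) / L\<^sup>2))"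
    proof -
      have inj: "inj_on (\<lambda>b. int l * b) (residue_units l)" using l_pos by (auto simp: inj_on_def)
      show ?thesis
        unfolding residues_square_split(1) 
        by (subst sum.union_disjoint, simp, simp, rule residues_square_split(3),
            subst sum.union_disjoint, simp, simp, rule residues_square_split(2))
           (simp add: sum.reindex[OF inj] X_def Y_def)
    qed
    have 1: "((\<lambda>n. of_int (a ((int l)\<^sup>2 * n)) * e n) has_sum (X \<tau> + Y \<tau>) / L\<^sup>2) UNIV"
    proof -
      have "((\<lambda>n. \<Sum>b\<in>{0..<int (l\<^sup>2)}. of_int (a n) * qexp (of_int n * ((\<tau> + 24 * of_int b) / L\<^sup>2) / 24)) has_sum X \<tau> + Y \<tau>) UNIV"
        unfolding XY by (intro has_sum_sum sum) (use Im_hecke(1)[OF \<tau>] in \<open>auto simp: L_def\<close>)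
      also have "(\<lambda>n. \<Sum>b\<in>{0..<int (l\<^sup>2)}. of_int (a n) * qexp (of_int n * ((\<tau> + 24 * of_int b) / L\<^sup>2) / 24))
          = (\<lambda>n. of_int (a n) * qexp (of_int n * \<tau> / (24 * L\<^sup>2)) * (if int (l\<^sup>2) dvd n then L\<^sup>2 else 0))"
      proof
        fix n
        have "of_int n * ((\<tau> + 24 * of_int b) / L\<^sup>2) / 24 = of_int n * \<tau> / (24 * L\<^sup>2) + of_int (n * b) / of_nat (l\<^sup>2)" for b
          using L by (simp add: L_def field_simps)
        then have "(\<Sum>b\<in>{0..<int (l\<^sup>2)}. of_int (a n) * qexp (of_int n * ((\<tau> + 24 * of_int b) / L\<^sup>2) / 24))
           = of_int (a n) * qexp (of_int n * \<tau> / (24 * L\<^sup>2)) * (\<Sum>b\<in>{0..<int (l\<^sup>2)}. echar (l\<^sup>2) (n * b))"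
          by (simp only: qexp_add qexp_of_int_divide sum_distrib_left mult.assoc)
        also have "(\<Sum>b\<in>{0..<int (l\<^sup>2)}. echar (l\<^sup>2) (n * b)) = (if int (l\<^sup>2) dvd n then L\<^sup>2 else 0)"
          using sum_echar[of "l\<^sup>2" n] l_pos by (simp add: L_def)
        finally show "(\<Sum>b\<in>{0..<int (l\<^sup>2)}. of_int (a n) * qexp (of_int n * ((\<tau> + 24 * of_int b) / L\<^sup>2) / 24))
           = of_int (a n) * qexp (of_int n * \<tau> / (24 * L\<^sup>2)) * (if int (l\<^sup>2) dvd n then L\<^sup>2 else 0)" .
      qed
      also have "((\<lambda>n. of_int (a n) * qexp (of_int n * \<tau> / (24 * L\<^sup>2)) * (if int (l\<^sup>2) dvd n then L\<^sup>2 else 0)) has_sum X \<tau> + Y \<tau>) UNIV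
        \<longleftrightarrow> ((\<lambda>n. of_int (a n) * qexp (of_int n * \<tau> / (24 * L\<^sup>2)) * L\<^sup>2) has_sum X \<tau> + Y \<tau>) (range (\<lambda>m. (int l)\<^sup>2 * m))"
        by (rule has_sum_cong_neutral) auto
      also have "\<dots> \<longleftrightarrow> ((\<lambda>m. of_int (a ((int l)\<^sup>2 * m)) * e m * L\<^sup>2) has_sum X \<tau> + Y \<tau>) UNIV"
      proof (subst has_sum_reindex)
        show "inj (\<lambda>m. (int l)\<^sup>2 * m)" using l_pos by (simp add: inj_on_def)
        have "of_int ((int l)\<^sup>2 * m) * \<tau> / (24 * L\<^sup>2) = of_int m * \<tau> / 24" for m
          using L by (simp add: L_def)
        then show "((\<lambda>n. of_int (a n) * qexp (of_int n * \<tau> / (24 * L\<^sup>2)) * L\<^sup>2) \<circ> (\<lambda>m. (int l)\<^sup>2 * m) has_sum X \<tau> + Y \<tau>) UNIV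
          \<longleftrightarrow> ((\<lambda>m. of_int (a ((int l)\<^sup>2 * m)) * e m * L\<^sup>2) has_sum X \<tau> + Y \<tau>) UNIV"
          by (simp only: o_def e_def)
      qed
      finally have "((\<lambda>m. of_int (a ((int l)\<^sup>2 * m)) * e m * L\<^sup>2 * (1 / L\<^sup>2)) has_sum (X \<tau> + Y \<tau>) * (1 / L\<^sup>2)) UNIV"
        by (rule has_sum_cmult_left)
      then show ?thesis using L by (simp add: field_simps)
    qed
    have 2: "((\<lambda>n. of_int (chi12 (int l) * neg_sqrt_count n * (int l) ^ 4 * a n) * e n) has_sum
       L ^ 3 * ch * (\<Sum>b\<in>residue_units l. gauss_sum l b * D (\<tau> + 24 * of_int b / L))) UNIV"
    proof -
      have "((\<lambda>n. L ^ 3 * ch * (\<Sum>b\<in>residue_units l. gauss_sum l b * (of_int (a n) * qexp (of_int n * (\<tau> + 24 * of_int b / L) / 24)))) has_sum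
         L ^ 3 * ch * (\<Sum>b\<in>residue_units l. gauss_sum l b * D (\<tau> + 24 * of_int b / L))) UNIV"
        by (intro has_sum_cmult_right has_sum_sum sum) (use Im_hecke(2)[OF \<tau>] in \<open>auto simp: L_def\<close>)
      also have "(\<lambda>n. L ^ 3 * ch * (\<Sum>b\<in>residue_units l. gauss_sum l b * (of_int (a n) * qexp (of_int n * (\<tau> + 24 * of_int b / L) / 24))))
         = (\<lambda>n. of_int (chi12 (int l) * neg_sqrt_count n * (int l) ^ 4 * a n) * e n)"
      proof
        fix n
        have "of_int n * (\<tau> + 24 * of_int b / L) / 24 = of_int n * \<tau> / 24 + of_int (n * b) / of_nat l" for b
          using L by (simp add: L_def field_simps)
        then have "gauss_sum l b * (of_int (a n) * qexp (of_int n * (\<tau> + 24 * of_int b / L) / 24)) = (of_int (a n) * e n) * (gauss_sum l b * echar l (n * b))" for b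
          unfolding e_def by (simp only: qexp_add qexp_of_int_divide mult_ac)
        then have "(\<Sum>b\<in>residue_units l. gauss_sum l b * (of_int (a n) * qexp (of_int n * (\<tau> + 24 * of_int b / L) / 24)))
          = (of_int (a n) * e n) * (L * of_int (neg_sqrt_count n))"
          by (simp only: sum_distrib_left[symmetric] sum_gauss_sum_echar L_def)
        then show "L ^ 3 * ch * (\<Sum>b\<in>residue_units l. gauss_sum l b * (of_int (a n) * qexp (of_int n * (\<tau> + 24 * of_int b / L) / 24)))
          = of_int (chi12 (int l) * neg_sqrt_count n * (int l) ^ 4 * a n) * e n"
          by (simp add: ch_def L_def eval_nat_numeral mult_ac)
      qed
      finally show ?thesis .
    qed
    have 3: "((\<lambda>n. of_int ((int l) ^ 9 * (if (int l)\<^sup>2 dvd n then a (n div (int l)\<^sup>2) else 0)) * e n) has_sum L ^ 9 * D (L\<^sup>2 * \<tau>)) UNIV"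
    proof -
      have "((\<lambda>m. L ^ 9 * (of_int (a m) * qexp (of_int m * (L\<^sup>2 * \<tau>) / 24))) has_sum L ^ 9 * D (L\<^sup>2 * \<tau>)) UNIV"
        by (intro has_sum_cmult_right sum) (use Im_hecke(3)[OF \<tau>] in \<open>auto simp: L_def\<close>)
      also have "?this \<longleftrightarrow> ((\<lambda>n. L ^ 9 * (of_int (a (n div (int l)\<^sup>2)) * e n)) has_sum L ^ 9 * D (L\<^sup>2 * \<tau>)) (range (\<lambda>m. (int l)\<^sup>2 * m))"
      proof (subst has_sum_reindex)
        show "inj (\<lambda>m. (int l)\<^sup>2 * m)" using l_pos by (simp add: inj_on_def)
        have "of_int m * (L\<^sup>2 * \<tau>) / 24 = of_int ((int l)\<^sup>2 * m) * \<tau> / 24" for m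
          by (simp add: L_def)
        moreover have "(int l)\<^sup>2 * m div (int l)\<^sup>2 = m" for m using l_pos by simp
        ultimately show "((\<lambda>m. L ^ 9 * (of_int (a m) * qexp (of_int m * (L\<^sup>2 * \<tau>) / 24))) has_sum L ^ 9 * D (L\<^sup>2 * \<tau>)) UNIV \<longleftrightarrow>
           ((\<lambda>n. L ^ 9 * (of_int (a (n div (int l)\<^sup>2)) * e n)) \<circ> (\<lambda>m. (int l)\<^sup>2 * m) has_sum L ^ 9 * D (L\<^sup>2 * \<tau>)) UNIV"
          by (simp only: o_def e_def)
      qed
      also have "\<dots> \<longleftrightarrow> ((\<lambda>n. of_int ((int l) ^ 9 * (if (int l)\<^sup>2 dvd n then a (n div (int l)\<^sup>2) else 0)) * e n) has_sum L ^ 9 * D (L\<^sup>2 * \<tau>)) UNIV"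
        by (rule has_sum_cong_neutral) (auto simp: L_def)
      finally show ?thesis .
    qed
    have "T \<tau> = (X \<tau> + Y \<tau>) / L\<^sup>2 + L ^ 3 * ch * (\<Sum>b\<in>residue_units l. gauss_sum l b * D (\<tau> + 24 * of_int b / L)) + L ^ 9 * D (L\<^sup>2 * \<tau>)"
    proof -
      have "L ^ 5 = L\<^sup>2 * L ^ 3" "L ^ 11 = L\<^sup>2 * L ^ 9" by (simp_all flip: power_add)
      then have "Z \<tau> = L\<^sup>2 * (L ^ 3 * ch * (\<Sum>b\<in>residue_units l. gauss_sum l b * D (\<tau> + 24 * of_int b / L)) + L ^ 9 * D (L\<^sup>2 * \<tau>))"
        unfolding Z_def by (simp only: distrib_left mult.assoc)
      then show ?thesis unfolding T_def using L by (simp add: add_divide_distrib)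
    qed
    with has_sum_add[OF has_sum_add[OF 1 2] 3] show ?thesis
      unfolding hecke_def of_int_add distrib_right by (simp only: e_def)
  qed
  have "represents (hecke a) T" unfolding represents_def using T_hol T_sum T_S by blast
  moreover obtain B where B: "\<And>n. n < B \<Longrightarrow> a n = 0" using a by (auto simp: weak_form_def)
  have sq1: "(int l)\<^sup>2 \<ge> 1" using l_pos by simp
  \<comment> \<open>Of the three terms the last one reaches furthest down, multiplying the pole
    order by l^2; it dictates the new bound.\<close>
  have "hecke a n = 0" if n: "n < - (\<bar>B\<bar> * (int l)\<^sup>2)" for n
  proof -
    have nB: "n < - \<bar>B\<bar>" using n sq1 mult_left_mono[OF sq1, of "\<bar>B\<bar>"] by simp
    then have "a n = 0" using B by simp
    moreover have "a ((int l)\<^sup>2 * n) = 0"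
    proof (rule B)
      have "(int l)\<^sup>2 * n \<le> 1 * n" using nB sq1 by (intro mult_right_mono_neg) auto
      then show "(int l)\<^sup>2 * n < B" using nB by simp
    qed
    moreover have "a (n div (int l)\<^sup>2) = 0" if dvd: "(int l)\<^sup>2 dvd n"
    proof (rule B)
      obtain m where m: "n = (int l)\<^sup>2 * m" using dvd by (elim dvdE)
      have "(int l)\<^sup>2 * m < (int l)\<^sup>2 * (- \<bar>B\<bar>)" using n by (simp add: m mult.commute)
      then have "m < - \<bar>B\<bar>" using sq1 by (simp only: mult_less_cancel_left_pos[of "(int l)\<^sup>2" m "- \<bar>B\<bar>"])
      then show "n div (int l)\<^sup>2 < B" using m l_pos by simp
    qed
    ultimately show ?thesis by (simp add: hecke_def)
  qed
  moreover have "n mod 24 = 23" if n: "hecke a n \<noteq> 0" for n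
  proof -
    \<comment> \<open>l^2 is congruent to 1 modulo 24, so multiplying or dividing an index by l^2
      keeps the class 23.\<close>
    have "chi12 (int l) \<noteq> 0" using chi12_l_sq by auto
    then have "24 * (((int l)\<^sup>2 - 1) div 24) = (int l)\<^sup>2 - 1" by (rule chi12_square)
    then obtain k where k: "(int l)\<^sup>2 = 1 + 24 * k" by (metis add.commute diff_add_cancel)
    have sq: "((int l)\<^sup>2 * m) mod 24 = m mod 24" for m
    proof -
      have "(int l)\<^sup>2 * m = m + 24 * (k * m)" unfolding k by (simp add: algebra_simps)
      then show ?thesis by simp
    qed
    consider "a ((int l)\<^sup>2 * n) \<noteq> 0" | "a n \<noteq> 0" | "(int l)\<^sup>2 dvd n" "a (n div (int l)\<^sup>2) \<noteq> 0"
      using n unfolding hecke_def by (cases "a n = 0"; cases "(int l)\<^sup>2 dvd n"; cases "a (n div (int l)\<^sup>2) = 0") auto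
    then show ?thesis
    proof cases
      case 1 then show ?thesis using a24[OF 1] sq[of n] by simp
    next
      case 2 then show ?thesis by (rule a24)
    next
      case 3 
      then show ?thesis using a24[OF 3(2)] sq[of "n div (int l)\<^sup>2"] by simp
    qed
  qed
  ultimately show ?thesis unfolding weak_form_def by blast
qed

end

section \<open>Forms with prescribed principal part\<close>

definition euler_inverse :: "int fps" where
  "euler_inverse = fps_right_inverse euler_product 1"

lemma euler_product_inverse: "euler_product * euler_inverse = 1"
  unfolding euler_inverse_def by (rule fps_right_inverse) (simp add: euler_product_nth)

lemma e6_eq: "e6 n = fps_nth (E6 * euler_inverse) n"
  by (simp add: e6_def euler_inverse_def)

lemma cfps_euler_inverse: "cfps euler_inverse = inverse (cfps euler_product)"
proof -
  have "cfps euler_product * cfps euler_inverse = 1"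
    by (simp add: cfps_mult[symmetric] euler_product_inverse)
  then show ?thesis by (metis fps_inverse_unique)
qed

text \<open>The Euler product has no zeros in the unit disc, so its reciprocal is holomorphic
  there.\<close>

lemma fps_conv_radius_euler_inverse: "fps_conv_radius (cfps euler_inverse) \<ge> 1"
proof -
  have "min 1 (fps_conv_radius (cfps euler_product)) \<le> fps_conv_radius (inverse (cfps euler_product))"
    by (rule fps_conv_radius_inverse) (auto simp: eval_euler_product_nonzero)
  then show ?thesis using fps_conv_radius_euler_product unfolding cfps_euler_inverse by (simp add: min_absorb1)
qed

lemma eval_euler_inverse:
  assumes "norm z < 1"
  shows "eval_fps (cfps euler_inverse) z = 1 / eval_fps (cfps euler_product) z"
  unfolding cfps_euler_inverse using assms
  by (subst eval_fps_inverse[where r = 1])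
     (auto simp: eval_euler_product_nonzero inverse_eq_divide fps_conv_radius_gt[OF fps_conv_radius_euler_product])

text \<open>The exponents keep the weight 6 (2 i + 1) - (24 i + 1) / 2 at 11/2 for every i and the
  multiplier at that of 1 / eta, while the pole order grows by 1 with each i. One form is thus
  available for every admissible pole.\<close>

definition basis_fps :: "nat \<Rightarrow> int fps" where
  "basis_fps i = E6 ^ (2 * i + 1) * euler_inverse ^ (24 * i + 1)"

text \<open>The coefficients of \<open>E\<^sub>6\<^bsup>2i+1\<^esup> / \<eta>\<^bsup>24i+1\<^esup>\<close>.\<close>

definition basis_coeff :: "nat \<Rightarrow> int \<Rightarrow> int" where
  "basis_coeff i n = (if n mod 24 = 23 \<and> n \<ge> - (24 * int i + 1)
     then fps_nth (basis_fps i) (nat ((n + 24 * int i + 1) div 24)) else 0)"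

lemma basis_fps_eval:
  assumes "norm z < 1"
  shows "fps_conv_radius (cfps (basis_fps i)) \<ge> 1"
    and "eval_fps (cfps (basis_fps i)) z = eval_fps (cfps E6) z ^ (2 * i + 1) / eval_fps (cfps euler_product) z ^ (24 * i + 1)"
proof -
  define A B where "A = cfps E6 ^ (2 * i + 1)" and "B = cfps euler_inverse ^ (24 * i + 1)"
  have AB: "cfps (basis_fps i) = A * B" by (simp only: A_def B_def basis_fps_def cfps_mult cfps_power)
  have A: "fps_conv_radius A \<ge> 1" unfolding A_def
    using fps_conv_radius_power fps_conv_radius_E6 order_trans by blast
  have B: "fps_conv_radius B \<ge> 1" unfolding B_def
    using fps_conv_radius_power fps_conv_radius_euler_inverse order_trans by blast
  have "1 \<le> min (fps_conv_radius A) (fps_conv_radius B)" using A B by simp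
  also have "\<dots> \<le> fps_conv_radius (A * B)" by (rule fps_conv_radius_mult)
  finally show "fps_conv_radius (cfps (basis_fps i)) \<ge> 1" unfolding AB .
  have "eval_fps (A * B) z = eval_fps A z * eval_fps B z"
    by (intro eval_fps_mult fps_conv_radius_gt A B assms)
  also have "eval_fps A z = eval_fps (cfps E6) z ^ (2 * i + 1)"
    unfolding A_def by (intro eval_fps_power fps_conv_radius_gt fps_conv_radius_E6 assms)
  also have "eval_fps B z = eval_fps (cfps euler_inverse) z ^ (24 * i + 1)"
    unfolding B_def by (intro eval_fps_power fps_conv_radius_gt fps_conv_radius_euler_inverse assms)
  finally show "eval_fps (cfps (basis_fps i)) z = eval_fps (cfps E6) z ^ (2 * i + 1) / eval_fps (cfps euler_product) z ^ (24 * i + 1)"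
    unfolding AB eval_euler_inverse[OF assms] by (simp only: power_one_over times_divide_eq_right mult_1_right)
qed

lemma weak_form_basis: "weak_form (basis_coeff i)"
proof -
  define D where "D = (\<lambda>\<tau>. eis6 \<tau> ^ (2 * i + 1) / eta \<tau> ^ (24 * i + 1))"
  have "D holomorphic_on {\<tau>. Im \<tau> > 0}"
    unfolding D_def by (intro holomorphic_intros holomorphic_eis6 holomorphic_eta) (simp add: eta_nonzero)
  moreover have "((\<lambda>n. of_int (basis_coeff i n) * qexp (of_int n * \<tau> / 24)) has_sum D \<tau>) UNIV" if \<tau>: "Im \<tau> > 0" for \<tau>
  proof -
    define u where "u = qexp (- of_nat (24 * i + 1) * \<tau> / 24)"
    have q: "norm (qexp \<tau>) < 1" using \<tau> by (rule norm_qexp_less_1)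
    have D: "D \<tau> = u * eval_fps (cfps (basis_fps i)) (qexp \<tau>)"
    proof -
      have "qexp (\<tau> / 24) ^ (24 * i + 1) * u = 1"
        unfolding u_def qexp_power qexp_add[symmetric] by (simp add: field_simps)
      then have "1 / qexp (\<tau> / 24) ^ (24 * i + 1) = u" by (metis mult.commute nonzero_divide_eq_eq power_not_zero qexp_nonzero)
      moreover have "D \<tau> = (1 / qexp (\<tau> / 24) ^ (24 * i + 1)) * (eis6 \<tau> ^ (2 * i + 1) / eval_fps (cfps euler_product) (qexp \<tau>) ^ (24 * i + 1))"
        unfolding D_def eta_def power_mult_distrib by (simp only: times_divide_times_eq mult_1_left)
      ultimately show ?thesis unfolding basis_fps_eval(2)[OF q] eis6_def by (simp only:)
    qed
    have "((\<lambda>k. u * (fps_nth (cfps (basis_fps i)) k * qexp \<tau> ^ k)) has_sum D \<tau>) UNIV"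
      unfolding D by (intro has_sum_cmult_right has_sum_eval_fps fps_conv_radius_gt basis_fps_eval(1)[OF q] q)
    also have "?this \<longleftrightarrow> ((\<lambda>n. of_int (basis_coeff i n) * qexp (of_int n * \<tau> / 24)) has_sum D \<tau>) (range (\<lambda>k. 24 * int k - (24 * int i + 1)))"
    proof (subst has_sum_reindex)
      show "inj (\<lambda>k. 24 * int k - (24 * int i + 1))" by (auto simp: inj_on_def)
      have "of_int (basis_coeff i (24 * int k - (24 * int i + 1))) * qexp (of_int (24 * int k - (24 * int i + 1)) * \<tau> / 24)
        = u * (fps_nth (cfps (basis_fps i)) k * qexp \<tau> ^ k)" for k
      proof -
        have "(24 * int k - (24 * int i + 1)) mod 24 = 23" by presburger
        then have "basis_coeff i (24 * int k - (24 * int i + 1)) = fps_nth (basis_fps i) k"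
          by (simp add: basis_coeff_def)
        moreover have "of_int (24 * int k - (24 * int i + 1)) * \<tau> / 24 = - of_nat (24 * i + 1) * \<tau> / 24 + of_nat k * \<tau>"
          by (simp add: field_simps)
        ultimately show ?thesis by (simp only: qexp_add qexp_power u_def fps_nth_cfps mult_ac)
      qed
      then show "((\<lambda>k. u * (fps_nth (cfps (basis_fps i)) k * qexp \<tau> ^ k)) has_sum D \<tau>) UNIV \<longleftrightarrow>
        ((\<lambda>n. of_int (basis_coeff i n) * qexp (of_int n * \<tau> / 24)) \<circ> (\<lambda>k. 24 * int k - (24 * int i + 1)) has_sum D \<tau>) UNIV"
        by (simp only: o_def)
    qed
    also have "\<dots> \<longleftrightarrow> ((\<lambda>n. of_int (basis_coeff i n) * qexp (of_int n * \<tau> / 24)) has_sum D \<tau>) UNIV"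
    proof (rule has_sum_cong_neutral)
      fix n :: int assume n: "n \<in> UNIV - range (\<lambda>k. 24 * int k - (24 * int i + 1))"
      have "\<not> (n mod 24 = 23 \<and> n \<ge> - (24 * int i + 1))"
      proof
        assume A: "n mod 24 = 23 \<and> n \<ge> - (24 * int i + 1)"
        define m where "m = (n + 24 * int i + 1) div 24"
        have "n = 24 * m - (24 * int i + 1)" "m \<ge> 0" using A unfolding m_def by presburger+
        then have "n = 24 * int (nat m) - (24 * int i + 1)" by simp
        then show False using n by blast
      qed
      then have "basis_coeff i n = 0" unfolding basis_coeff_def by (rule if_not_P)
      then show "of_int (basis_coeff i n) * qexp (of_int n * \<tau> / 24) = 0" by simp
    qed auto
    finally show ?thesis .
  qed
  moreover have "csqrt (- \<i> * \<tau>) * D (- 1 / \<tau>) = \<tau> ^ 6 * D \<tau>" if \<tau>: "Im \<tau> > 0" for \<tau>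
  proof -
    have \<tau>0: "\<tau> \<noteq> 0" using \<tau> by auto
    define s where "s = csqrt (- \<i> * \<tau>)"
    have s0: "s \<noteq> 0" unfolding s_def by (rule csqrt_nonzero[OF \<tau>])
    \<comment> \<open>The 24 i extra factors of the root give (- i \<tau>)^(12 i), and (- i)^12 = 1;
      a single root remains, as weight 11/2 demands.\<close>
    have s24: "s ^ (24 * i + 1) = \<tau> ^ (12 * i) * s"
    proof -
      have "(s ^ 2) ^ (12 * i) = ((- \<i>) ^ 12) ^ i * \<tau> ^ (12 * i)"
        unfolding s_def by (simp add: power_mult_distrib power_mult)
      also have "(- \<i>) ^ 12 = 1" by (simp add: power_minus_even[of 12, OF even_numeral] eval_nat_numeral)
      finally have "(s ^ 2) ^ (12 * i) = \<tau> ^ (12 * i)" by simp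
      then have "s ^ (24 * i) = \<tau> ^ (12 * i)" by (simp flip: power_mult)
      then show ?thesis by (simp add: mult.commute)
    qed
    have "D (- 1 / \<tau>) = ((\<tau> ^ 6) ^ (2 * i + 1) * eis6 \<tau> ^ (2 * i + 1)) / (s ^ (24 * i + 1) * eta \<tau> ^ (24 * i + 1))"
      unfolding D_def eis6_inverse[OF \<tau>] eta_inverse[OF \<tau>] s_def[symmetric] power_mult_distrib ..
    also have "(\<tau> ^ 6) ^ (2 * i + 1) = \<tau> ^ (12 * i) * \<tau> ^ 6"
      by (simp add: add.commute flip: power_mult power_add)
    finally have "s * D (- 1 / \<tau>) = (s * \<tau> ^ (12 * i)) * (\<tau> ^ 6 * eis6 \<tau> ^ (2 * i + 1)) / ((s * \<tau> ^ (12 * i)) * eta \<tau> ^ (24 * i + 1))"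
      unfolding s24 by (simp add: mult_ac)
    also have "\<dots> = \<tau> ^ 6 * D \<tau>"
      using s0 \<tau>0 by (simp add: D_def)
    finally show ?thesis unfolding s_def .
  qed
  ultimately have "represents (basis_coeff i) D" unfolding represents_def by blast
  moreover have "\<forall>n < - (24 * int i + 1). basis_coeff i n = 0" by (simp add: basis_coeff_def)
  moreover have "\<forall>n. basis_coeff i n \<noteq> 0 \<longrightarrow> n mod 24 = 23" by (simp add: basis_coeff_def)
  ultimately show ?thesis unfolding weak_form_def by blast
qed

lemma fps_nth_power_0: "fps_nth F 0 = 1 \<Longrightarrow> fps_nth (F ^ n) 0 = (1 :: int)"
  by (induction n) simp_all

lemma basis_coeff_leading: "basis_coeff i (- (24 * int i + 1)) = 1"
proof -
  have "fps_nth euler_product 0 = 1" by (simp add: euler_product_nth)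
  moreover have "fps_nth (euler_product * euler_inverse) 0 = 1" by (simp add: euler_product_inverse)
  ultimately have "fps_nth euler_inverse 0 = 1" by simp
  then have "fps_nth (basis_fps i) 0 = 1"
    unfolding basis_fps_def fps_mult_nth_0 by (simp only: fps_nth_power_0 E6_def) (simp add: fps_nth_power_0)
  moreover have "(- (24 * int i + 1)) mod 24 = 23" by presburger
  ultimately show ?thesis by (simp add: basis_coeff_def)
qed

text \<open>Elimination from the deepest pole: leading coefficient 1 allows the coefficient there to
  be prescribed without leaving the integers. The target \<open>t\<close> is arbitrary in the
  induction, since the subtraction alters all the coefficients still to be prescribed.\<close>

lemma exists_weak_form:
  "\<exists>a. weak_form a \<and> (\<forall>n<0. n mod 24 = 23 \<longrightarrow> a n = (if n \<ge> - (24 * int N + 1) then t n else 0))"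
proof (induction N arbitrary: t)
  case 0
  have "t (-1) * basis_coeff 0 n + 0 * basis_coeff 0 n = (if n \<ge> - (24 * int 0 + 1) then t n else 0)" if "n < 0" for n
    using that basis_coeff_leading[of 0] by (cases "n = -1") (auto simp: basis_coeff_def)
  then show ?case using weak_form_linear[OF weak_form_basis weak_form_basis, of "t (-1)" 0 0 0] by blast
next
  case (Suc N)
  define c where "c = t (- (24 * int (Suc N) + 1))"
  obtain a where a: "weak_form a"
    "\<And>n. n < 0 \<Longrightarrow> n mod 24 = 23 \<Longrightarrow> a n = (if n \<ge> - (24 * int N + 1) then t n - c * basis_coeff (Suc N) n else 0)"
    using Suc[of "\<lambda>n. t n - c * basis_coeff (Suc N) n"] by blast
  have "1 * a n + c * basis_coeff (Suc N) n = (if n \<ge> - (24 * int (Suc N) + 1) then t n else 0)" if n: "n < 0" "n mod 24 = 23" for n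
  proof -
    have "n \<ge> - (24 * int N + 1) \<or> n = - (24 * int (Suc N) + 1) \<or> n < - (24 * int (Suc N) + 1)"
      using n by presburger
    then consider "n \<ge> - (24 * int N + 1)" | "n = - (24 * int (Suc N) + 1)" | "n < - (24 * int (Suc N) + 1)"
      by blast
    then show ?thesis
    proof cases
      case 1 then show ?thesis using a(2)[OF n] by simp
    next
      case 2 then show ?thesis using a(2)[OF n] basis_coeff_leading[of "Suc N"] by (simp add: c_def)
    next
      case 3 then show ?thesis using a(2)[OF n] by (simp add: basis_coeff_def)
    qed
  qed
  then show ?case using weak_form_linear[OF a(1) weak_form_basis, of 1 c "Suc N"] by blast
qed

lemma weak_form_eqI:
  assumes "weak_form a" "weak_form b" "\<And>n. n < 0 \<Longrightarrow> n mod 24 = 23 \<Longrightarrow> a n = b n"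
  shows "a n = b n"
proof -
  have "1 * a k + (- 1) * b k = 0" if "k < 0" for k
  proof (cases "k mod 24 = 23")
    case True then show ?thesis using assms(3)[OF that] by simp
  next
    case False
    then have "a k = 0" "b k = 0" using assms(1,2) unfolding weak_form_def by blast+
    then show ?thesis by simp
  qed
  from weak_form_eq_0[OF weak_form_linear[OF assms(1,2), of 1 "- 1"] this, of n] show ?thesis by simp
qed

section \<open>Divisibility along powers of a prime\<close>

context
  fixes l :: nat
  assumes prime: "prime l" and l: "l > 3"
begin

lemma square_mod_24: "(int l)\<^sup>2 mod 24 = 1"
proof -
  have "chi12 (int l) \<noteq> 0" using chi12_l_sq[OF prime l] by auto
  then have "24 * (((int l)\<^sup>2 - 1) div 24) = (int l)\<^sup>2 - 1" by (rule chi12_square)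
  then show ?thesis by presburger
qed

text \<open>Existence comes from elimination and uniqueness from \<open>weak_form_eqI\<close>, so
  the choice determines the form.\<close>

definition prime_form :: "nat \<Rightarrow> int \<Rightarrow> int" where
  "prime_form j = (SOME a. weak_form a \<and> (\<forall>n<0. n mod 24 = 23 \<longrightarrow> a n = (if n = - (((int l)\<^sup>2) ^ j) then 1 else 0)))"

lemma prime_form:
  "weak_form (prime_form j)"
  "n < 0 \<Longrightarrow> n mod 24 = 23 \<Longrightarrow> prime_form j n = (if n = - (((int l)\<^sup>2) ^ j) then 1 else 0)"
proof -
  define P where "P = ((int l)\<^sup>2) ^ j"
  \<comment> \<open>P = l^(2 j) is congruent to 1 modulo 24, so - P is an admissible index of the
    shape -(24 N + 1).\<close>
  have "P mod 24 = 1"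
    unfolding P_def using square_mod_24 power_mod[of "(int l)\<^sup>2" 24 j] by simp
  moreover have "P > 0" using l by (simp add: P_def)
  define N where "N = nat (P div 24)"
  have "P = 24 * (P div 24) + 1" using \<open>P mod 24 = 1\<close> by presburger
  moreover have "P div 24 \<ge> 0" using \<open>P > 0\<close> by simp
  ultimately have PN: "P = 24 * int N + 1" by (simp add: N_def)
  obtain a where a: "weak_form a" "\<forall>n<0. n mod 24 = 23 \<longrightarrow> a n = (if n \<ge> - (24 * int N + 1) then if n = - P then 1 else 0 else 0)"
    using exists_weak_form[of N "\<lambda>n. if n = - P then 1 else 0"] by blast
  have "a n = (if n = - P then 1 else 0)" if "n < 0" "n mod 24 = 23" for n
    using a(2) that PN by (cases "n = - P") auto
  with a(1) have "\<exists>a. weak_form a \<and> (\<forall>n<0. n mod 24 = 23 \<longrightarrow> a n = (if n = - P then 1 else 0))" by blast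
  then have *: "weak_form (prime_form j) \<and> (\<forall>n<0. n mod 24 = 23 \<longrightarrow> prime_form j n = (if n = - P then 1 else 0))"
    unfolding prime_form_def P_def[symmetric] by (rule someI_ex)
  show "weak_form (prime_form j)" using * by blast
  show "n < 0 \<Longrightarrow> n mod 24 = 23 \<Longrightarrow> prime_form j n = (if n = - (((int l)\<^sup>2) ^ j) then 1 else 0)"
    using * unfolding P_def by blast
qed

text \<open>Each Hecke term acts on the only pole, at - l^(2j): the first moves it to - l^(2j - 2)
  when j > 0, the last moves it to - l^(2j + 2), and the middle one keeps it with a factor that
  vanishes for j > 0, because l then divides the index.\<close>

lemma hecke_prime_form_neg:
  assumes n: "n < 0" "n mod 24 = 23"
  shows "hecke l (prime_form j) n = (if (int l)\<^sup>2 * n = - (((int l)\<^sup>2) ^ j) then 1 else 0)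
     + (if n = -1 \<and> j = 0 then chi12 (int l) * neg_sqrt_count l (-1) * (int l) ^ 4 else 0)
     + (int l) ^ 9 * (if n = - (((int l)\<^sup>2) ^ Suc j) then 1 else 0)"
proof -
  have sq: "(int l)\<^sup>2 > 0" using l by simp
  obtain k where k: "(int l)\<^sup>2 = 24 * k + 1" using square_mod_24 by (metis mult_div_mod_eq)
  have mod: "((int l)\<^sup>2 * m) mod 24 = m mod 24" for m
  proof -
    have "(int l)\<^sup>2 * m = m + 24 * (k * m)" unfolding k by (simp add: algebra_simps)
    then show ?thesis by simp
  qed
  have 1: "prime_form j ((int l)\<^sup>2 * n) = (if (int l)\<^sup>2 * n = - (((int l)\<^sup>2) ^ j) then 1 else 0)"
    using n sq mod[of n] by (intro prime_form) (auto simp: mult_pos_neg)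
  have 2: "chi12 (int l) * neg_sqrt_count l n * (int l) ^ 4 * prime_form j n
     = (if n = -1 \<and> j = 0 then chi12 (int l) * neg_sqrt_count l (-1) * (int l) ^ 4 else 0)"
  proof (cases "n = - (((int l)\<^sup>2) ^ j)")
    case True
    show ?thesis
    proof (cases j)
      case 0 then show ?thesis using True prime_form(2)[OF n, of j] by simp
    next
      case (Suc i)
      then have "int l dvd n" unfolding True by (simp add: power2_eq_square)
      then have "neg_sqrt_count l n = 0" by (rule neg_sqrt_count_0[OF prime l])
      then show ?thesis using Suc by simp
    qed
  next
    case False
    then show ?thesis using prime_form(2)[OF n, of j] by auto
  qed
  have 3: "(if (int l)\<^sup>2 dvd n then prime_form j (n div (int l)\<^sup>2) else 0) = (if n = - (((int l)\<^sup>2) ^ Suc j) then 1 else 0)"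
  proof (cases "(int l)\<^sup>2 dvd n")
    case True
    then obtain m where m: "n = (int l)\<^sup>2 * m" by (elim dvdE)
    have "m < 0" using n(1) sq unfolding m by (simp add: mult_less_0_iff)
    moreover have "m mod 24 = 23" using n(2) mod[of m] m by simp
    ultimately have "prime_form j m = (if m = - (((int l)\<^sup>2) ^ j) then 1 else 0)" by (rule prime_form)
    moreover have "n div (int l)\<^sup>2 = m" using sq m by simp
    moreover have "n = - (((int l)\<^sup>2) ^ Suc j) \<longleftrightarrow> m = - (((int l)\<^sup>2) ^ j)"
    proof -
      have "- (((int l)\<^sup>2) ^ Suc j) = (int l)\<^sup>2 * (- (((int l)\<^sup>2) ^ j))" by simp
      then show ?thesis unfolding m using sq by (metis less_irrefl mult_cancel_left)
    qed
    ultimately show ?thesis using True by simp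
  next
    case False
    then have "n \<noteq> - (((int l)\<^sup>2) ^ Suc j)" by auto
    then show ?thesis using False by simp
  qed
  show ?thesis unfolding hecke_def[OF prime l] 1 2 3 ..
qed

text \<open>The constant is the middle factor at index -1. The first Hecke term has no pole here, as
  -1 is not a multiple of l^2.\<close>

lemma hecke_prime_form_0:
  "\<exists>c. \<forall>n. hecke l (prime_form 0) n = (int l) ^ 9 * prime_form 1 n + (int l) ^ 4 * c * prime_form 0 n"
proof (intro exI allI)
  fix n
  define c where "c = chi12 (int l) * neg_sqrt_count l (-1)"
  have "hecke l (prime_form 0) n = (int l) ^ 9 * prime_form 1 n + (int l ^ 4 * c) * prime_form 0 n"
  proof (rule weak_form_eqI[where n = n and b = "\<lambda>n. (int l) ^ 9 * prime_form 1 n + (int l ^ 4 * c) * prime_form 0 n"])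
    show "weak_form (hecke l (prime_form 0))" by (intro weak_form_hecke prime l prime_form)
    show "weak_form (\<lambda>n. (int l) ^ 9 * prime_form 1 n + (int l ^ 4 * c) * prime_form 0 n)" by (intro weak_form_linear prime_form)
    fix n :: int assume n: "n < 0" "n mod 24 = 23"
    have "(int l)\<^sup>2 * n \<noteq> - 1"
    proof
      assume "(int l)\<^sup>2 * n = - 1"
      then have "int l dvd 1" by (metis dvd_minus_iff dvd_mult2 dvd_triv_left power2_eq_square)
      then show False using l by simp
    qed
    then show "hecke l (prime_form 0) n = (int l) ^ 9 * prime_form 1 n + (int l ^ 4 * c) * prime_form 0 n"
      unfolding hecke_prime_form_neg[OF n] prime_form(2)[OF n] by (simp add: c_def)
  qed
  then show "hecke l (prime_form 0) n = (int l) ^ 9 * prime_form 1 n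
      + (int l) ^ 4 * (chi12 (int l) * neg_sqrt_count l (-1)) * prime_form 0 n" by (simp only: c_def)
qed

lemma hecke_prime_form_Suc:
  "hecke l (prime_form (Suc j)) n = (int l) ^ 9 * prime_form (Suc (Suc j)) n + prime_form j n"
proof -
  have "hecke l (prime_form (Suc j)) n = (int l) ^ 9 * prime_form (Suc (Suc j)) n + 1 * prime_form j n"
  proof (rule weak_form_eqI[where n = n and b = "\<lambda>n. (int l) ^ 9 * prime_form (Suc (Suc j)) n + 1 * prime_form j n"])
    show "weak_form (hecke l (prime_form (Suc j)))" by (intro weak_form_hecke prime l prime_form)
    show "weak_form (\<lambda>n. (int l) ^ 9 * prime_form (Suc (Suc j)) n + 1 * prime_form j n)" by (intro weak_form_linear prime_form)
    fix n :: int assume n: "n < 0" "n mod 24 = 23"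
    have "(int l)\<^sup>2 * n = - (((int l)\<^sup>2) ^ Suc j) \<longleftrightarrow> n = - (((int l)\<^sup>2) ^ j)"
    proof -
      have "- (((int l)\<^sup>2) ^ Suc j) = (int l)\<^sup>2 * (- (((int l)\<^sup>2) ^ j))" by simp
      moreover have "(int l)\<^sup>2 \<noteq> 0" using l by simp
      ultimately show ?thesis by (metis mult_cancel_left)
    qed
    then show "hecke l (prime_form (Suc j)) n = (int l) ^ 9 * prime_form (Suc (Suc j)) n + 1 * prime_form j n"
      unfolding hecke_prime_form_neg[OF n] prime_form(2)[OF n] by simp
  qed
  then show ?thesis by simp
qed

text \<open>Strong induction on k, for all j at once; truncated subtraction makes the claim trivial
  for j \<ge> k. The definition of the operator is solved for the coefficient at l^2 x, where x
  already contains l^(2k - 2).\<close>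

lemma prime_form_dvd: "(int l) ^ (4 * (k - j)) dvd prime_form j (((int l)\<^sup>2) ^ k * m)"
proof (induction k arbitrary: j m rule: less_induct)
  case (less k)
  show ?case
  proof (cases k)
    case 0
    then show ?thesis by simp
  next
    case (Suc i)
    define x where "x = ((int l)\<^sup>2) ^ i * m"
    have IH: "(int l) ^ (4 * (i - j')) dvd prime_form j' x" for j'
      unfolding x_def by (rule less) (simp add: Suc)
    have pow: "(int l) ^ p dvd (int l) ^ q * y" if "p \<le> q" for p q y
      using that by (intro dvd_mult2 le_imp_power_dvd)
    have pow_mult: "(int l) ^ p dvd (int l) ^ q * y" if "(int l) ^ r dvd y" "p \<le> q + r" for p q r y
    proof -
      have "(int l) ^ (q + r) dvd (int l) ^ q * y" using that(1) by (simp add: power_add mult_dvd_mono)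
      then show ?thesis by (rule dvd_trans[OF le_imp_power_dvd[OF that(2)]])
    qed
    define c where "c = chi12 (int l) * neg_sqrt_count l x"
    have split: "prime_form j ((int l)\<^sup>2 * x) = hecke l (prime_form j) x - (int l) ^ 4 * (c * prime_form j x)
       - (int l) ^ 9 * (if (int l)\<^sup>2 dvd x then prime_form j (x div (int l)\<^sup>2) else 0)"
      by (simp add: hecke_def[OF prime l] c_def)
    \<comment> \<open>Passing from level k - 1 to level k raises the target by at most 4, which l^4
      pays.\<close>
    have A: "(int l) ^ (4 * (k - j)) dvd (int l) ^ 4 * (d * prime_form j x)" for d
    proof (rule pow_mult)
      show "(int l) ^ (4 * (i - j)) dvd d * prime_form j x" using IH by (rule dvd_mult)
      show "4 * (k - j) \<le> 4 + 4 * (i - j)" using Suc by simp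
    qed
    \<comment> \<open>Two levels cost at most 8 against the available 9; at k = 1 the target itself
      is at most 4.\<close>
    have B: "(int l) ^ (4 * (k - j)) dvd (int l) ^ 9 * (if (int l)\<^sup>2 dvd x then prime_form j (x div (int l)\<^sup>2) else 0)"
    proof (cases i)
      case 0
      then have "4 * (k - j) \<le> 9" using Suc by simp
      then show ?thesis by (rule pow)
    next
      case (Suc i')
      define y where "y = ((int l)\<^sup>2) ^ i' * m"
      have "x = (int l)\<^sup>2 * y" by (simp add: x_def y_def Suc)
      then have "(if (int l)\<^sup>2 dvd x then prime_form j (x div (int l)\<^sup>2) else 0) = prime_form j y" using l by simp
      moreover have "(int l) ^ (4 * (i' - j)) dvd prime_form j y"
        unfolding y_def by (rule less) (simp add: Suc \<open>k = Suc i\<close>)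
      moreover have "4 * (k - j) \<le> 9 + 4 * (i' - j)" using Suc \<open>k = Suc i\<close> by simp
      ultimately show ?thesis using pow_mult by (simp only:)
    qed
    \<comment> \<open>The upper neighbour at level k - 1 falls short by at most 8 and is multiplied
      by l^9; the lower one has no such factor, but (k - 1) - (j - 1) = k - j. For j = 0 the second
      term is covered by \<open>A\<close>.\<close>
    have "(int l) ^ (4 * (k - j)) dvd hecke l (prime_form j) x"
    proof (cases j)
      case 0
      obtain d where d: "\<And>n. hecke l (prime_form 0) n = (int l) ^ 9 * prime_form 1 n + (int l) ^ 4 * d * prime_form 0 n"
        using hecke_prime_form_0 by blast
      have "(int l) ^ (4 * (k - j)) dvd (int l) ^ 9 * prime_form 1 x"
        by (rule pow_mult[OF IH]) (simp add: Suc 0)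
      moreover have "(int l) ^ (4 * (k - j)) dvd (int l) ^ 4 * (d * prime_form 0 x)" using A[of d] 0 by simp
      ultimately show ?thesis unfolding 0 d mult.assoc by (rule dvd_add)
    next
      case (Suc j')
      have "(int l) ^ (4 * (k - j)) dvd (int l) ^ 9 * prime_form (Suc (Suc j')) x"
        by (rule pow_mult[OF IH]) (simp add: Suc \<open>k = Suc i\<close>)
      moreover have "(int l) ^ (4 * (k - j)) dvd prime_form j' x"
        using IH[of j'] by (simp only: Suc \<open>k = Suc i\<close> diff_Suc_Suc)
      ultimately show ?thesis unfolding Suc hecke_prime_form_Suc by (rule dvd_add)
    qed
    then have "(int l) ^ (4 * (k - j)) dvd prime_form j ((int l)\<^sup>2 * x)"
      unfolding split using A[of c] B by (intro dvd_diff)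
    moreover have "(int l)\<^sup>2 * x = ((int l)\<^sup>2) ^ k * m" by (simp add: x_def Suc)
    ultimately show ?thesis by (simp only:)
  qed
qed

text \<open>Both \<open>prime_form 0\<close> and \<open>basis_coeff 0\<close> have principal part
  q^(-1/24), hence they coincide, and the index 24 n - 1 belongs to q^(n - 1/24).\<close>

lemma prime_form_0_eq_e6: "prime_form 0 (24 * int n - 1) = e6 n"
proof -
  have "prime_form 0 k = basis_coeff 0 k" for k
  proof (rule weak_form_eqI[OF prime_form(1) weak_form_basis])
    fix n :: int assume n: "n < 0" "n mod 24 = 23"
    show "prime_form 0 n = basis_coeff 0 n"
      using basis_coeff_leading[of 0] n unfolding prime_form(2)[OF n] by (cases "n = -1") (auto simp: basis_coeff_def)
  qed
  moreover have "(24 * int n - 1) mod 24 = 23" by presburger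
  ultimately show ?thesis by (simp add: basis_coeff_def basis_fps_def e6_eq)
qed

text \<open>Stated through the index 24 N - 1, on which the divisibility of coefficients depends;
  the residue \<open>delta\<close> is translated into this condition afterwards.\<close>

theorem e6_dvd:
  assumes "24 * int N - 1 = (int l) ^ (2 * k) * m"
  shows "(int l) ^ (4 * k) dvd e6 N"
  using prime_form_dvd[of k 0 m] assms by (simp add: prime_form_0_eq_e6[symmetric] power_mult)

end

theorem theorem7p10:
  fixes k n :: nat
  assumes "k \<ge> 1"
  shows "[e6 (11 ^ (2 * k) * n + delta 11 (2 * k)) = 0] (mod 11 ^ (2 * k))"
proof -
  define d where "d = delta 11 (2 * k)"
  have "\<not> (11 :: nat) dvd 24" by simp
  then have "coprime 24 (11 :: nat)" using prime_imp_coprime[of "11 :: nat" 24] by (simp add: coprime_commute)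
  \<comment> \<open>Unique existence gives the definite description in \<open>delta\<close> its
    defining property.\<close>
  then have "\<exists>!d::nat. 0 < d \<and> d < 11 ^ (2 * k) \<and> [24 * d = 1] (mod 11 ^ (2 * k))"
    using assms by (intro ex1_delta) auto
  from theI'[OF this] have "[24 * d = 1] (mod 11 ^ (2 * k))" by (simp add: d_def delta_def)
  then have "[24 * int d = 1] (mod 11 ^ (2 * k))"
    unfolding cong_int_iff[symmetric] by (simp only: of_nat_mult of_nat_power of_nat_numeral of_nat_1)
  then have "(11 :: int) ^ (2 * k) dvd 24 * int d - 1" by (simp add: cong_iff_dvd_diff)
  then obtain m where m: "24 * int d - 1 = 11 ^ (2 * k) * m" by (elim dvdE)
  \<comment> \<open>As \<open>d\<close> is inverse to 24 modulo 11^(2 k), the index 24 N - 1 is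
    divisible by 11^(2 k) along the whole progression.\<close>
  have "24 * int (11 ^ (2 * k) * n + d) - 1 = (int 11) ^ (2 * k) * (24 * int n + m)"
    using m by (simp add: algebra_simps)
  then have "(int 11) ^ (4 * k) dvd e6 (11 ^ (2 * k) * n + d)"
    by (intro e6_dvd[where m = "24 * int n + m"]) simp_all
  moreover have "(11 :: int) ^ (2 * k) dvd (int 11) ^ (4 * k)" unfolding of_nat_numeral by (rule le_imp_power_dvd) simp
  ultimately have "(11 :: int) ^ (2 * k) dvd e6 (11 ^ (2 * k) * n + d)" by (rule dvd_trans[rotated])
  then show ?thesis by (simp add: cong_0_iff d_def)
qed

end
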